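(* Suppose that the Regularity assumption of the context holds, that $\beta,\rho,\Delta,\Lambda>0$ (fixed, independent of the target accuracy $\varepsilon$) satisfy the corrected inequalities of the context, and that $\|\lambda_0\|\le\Lambda$, $\rho\|c(x_0)\|\le\Lambda$. (i) If $\mathcal N_{\chi^{\mathrm{cor}}\Delta}(\mathcal S_{\mathrm{det}}^{\mathrm{cor}})\subset\mathcal U$, then deterministic NR-LALM+SOC finds an $\varepsilon$-KKT pair with $\mathcal O(\varepsilon^{-2})$ iteration, first-order-oracle, primal-solve, and correction-solve complexities. (ii) If, in addition to the common hypotheses, the Oracle assumption of the context holds, consider stochastic NR-LALM+SOC with projected SPIDER, horizon $K\ge2$, and $B=K$, $Q=\lceil\sqrt K\rceil$, $b=\max\{1,\lceil2D_1L_s^2(\chi^{\mathrm{cor}})^2Q\rceil\}$. Under almost-sure admissibility (almost surely the iterates remain in the regularity region up to iteration $K$), it has $\mathcal O(\varepsilon^{-3})$ stochastic-gradient complexity and $\mathcal O(\varepsilon^{-2})$ constraint/Jacobian evaluation and solve complexities for obtaining a stochastic $\varepsilon$-KKT pair: there is a constant $C$ independent of $K$ and $\varepsilon$ such that whenever $K-1\ge C\varepsilon^{-2}$, the pair $(x_{\widehat k+1},\lambda_{\widehat k+1})$, with $\widehat k$ uniform on $\{1,\ldots,K-1\}$ and independent of the oracle samples, is a stochastic $\varepsilon$-KKT pair, and taking $K$ of order $\varepsilon^{-2}$ gives the stated counts. If instead of almost-sure admissibility, for a fixed $\delta\in(0,1)$ there is a known Borel set $\mathcal X_\delta$ with an exact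 membership test such that $$x_0\in\mathcal X_\delta,\qquad \mathcal S_{\mathrm{st}}^{\mathrm{cor}}(\delta)\subseteq\mathcal X_\delta,\qquad \mathcal N_{\chi^{\mathrm{cor}}\Delta}(\mathcal X_\delta)\subset\mathcal U,$$ then the safeguarded restart procedure of the context, with $K$ of order $\varepsilon^{-2}$, returns a stochastic $\varepsilon$-KKT pair with the same orders in expectation. (iii) For deterministic NR-LALM+SOC, if $\mathcal N_{\chi^{\mathrm{cor}}\Delta}(\mathcal S_{\mathrm{det}}^{\mathrm{cor}})\subset\mathcal U$, $\mathcal S_{\mathrm{det}}^{\mathrm{cor}}$ is compact, and the function $\mathcal E(x,\lambda,w):=\mathcal L_\rho(x,\lambda)+\frac\beta4\|w\|^2$ has the Kurdyka--Łojasiewicz (KL) property at every point of the cluster set of the sequence $(x_k,\lambda_k,p_{k-1})_{k\ge1}$, then the primal--dual trajectory has finite length, $\sum_{k\ge0}(\|x_{k+1}-x_k\|+\|\lambda_{k+1}-\lambda_k\|)<\infty$, and $(x_k,\lambda_k)$ converges to a KKT pair.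
   Context: Problem: minimize $f(x)$ over $x\in\mathbb R^n$ subject to $c(x)=0$, with $f:\mathbb R^n\to\mathbb R$, $c:\mathbb R^n\to\mathbb R^m$. Norms are Euclidean for vectors and spectral for matrices; $\nabla c(x):=(\nabla c_1(x),\ldots,\nabla c_m(x))\in\mathbb R^{n\times m}$; $\mathcal L_\rho(x,\lambda):=f(x)+\langle\lambda,c(x)\rangle+\frac\rho2\|c(x)\|^2$; $\mathcal N_r(S):=\{y:\operatorname{dist}(y,S)\le r\}$. All random variables are assumed measurable. A pair $(x,\lambda)$ is an $\varepsilon$-KKT pair if $\|\nabla f(x)+\nabla c(x)\lambda\|\le\varepsilon$ and $\|c(x)\|\le\varepsilon$, and a KKT pair if this holds with $\varepsilon=0$. A random pair is a stochastic $\varepsilon$-KKT pair if $\mathbb E\|\nabla f(x)+\nabla c(x)\lambda\|^2\le\varepsilon^2$ and $\mathbb E\|c(x)\|^2\le\varepsilon^2$. Regularity assumption: $f$ and $c$ are continuously differentiable on a nonempty open set $\mathcal U\subseteq\mathbb R^n$, and there are $\underline f\in\mathbb R$ and positive constants $G,L_f,M,L_c,\sigma$ such that for all $x,y\in\mathcal U$ and $u\in\mathbb R^m$: (i) $f(x)\ge\underline f$, $\|\nabla f(x)\|\le G$, $\|\nabla f(x)-\nabla f(y)\|\le L_f\|x-y\|$; (ii) $\|\nabla c(x)\|\le M$, $\|\nabla c(x)-\nabla c(y)\|\le L_c\|x-y\|$; (iii) $\|\nabla c(x)u\|\ge\sigma\|u\|$. Corrected constants: $\kappa_q:=L_c/(2\sigma)$,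 $\kappa_d:=L_c^3/(8\sigma^2)$, $\chi^{\mathrm{cor}}:=1+\kappa_q\Delta$, $$C_{\mathrm{mod}}^{\mathrm{cor}}:=G\kappa_q+\frac{L_f}{2}(\chi^{\mathrm{cor}})^2+\kappa_d\Delta^2(3\Lambda+\rho M\Delta)+\frac{\rho}{2}\kappa_d^2\Delta^6,\quad A_p^{\mathrm{cor}}:=\beta+\rho M\kappa_d\Delta^3,$$ $$B_p^{\mathrm{cor}}:=A_p^{\mathrm{cor}}+(L_f+L_c\Lambda)\chi^{\mathrm{cor}},\quad C_{\lambda,p}^{\mathrm{cor}}:=\frac4{\sigma^2}\max\{(A_p^{\mathrm{cor}})^2,(B_p^{\mathrm{cor}})^2\},$$ $$\overline\Phi_1^{\mathrm{cor}}:=f(x_0)+G\chi^{\mathrm{cor}}\Delta+\frac{4\Lambda^2}{\rho}+\frac{C_{\lambda,p}^{\mathrm{cor}}}{\rho}\Delta^2,\quad H_{\mathrm{det}}^{\mathrm{cor}}:=\overline\Phi_1^{\mathrm{cor}}+\frac{\Lambda^2}{2\rho},$$ $$\mathcal S_{\mathrm{det}}^{\mathrm{cor}}:=\{x\in\mathbb R^n:f(x)\le H_{\mathrm{det}}^{\mathrm{cor}},\ \|c(x)\|\le2\Lambda/\rho\}.$$ Corrected inequalities: $$\Lambda\ge\frac{G+\beta\Delta+\rho M\kappa_d\Delta^4}{\sigma},\quad \frac{G}{\beta}+\frac{3M\Lambda}{\beta+\rho\sigma^2}\le\Delta,\quad C_{\mathrm{mod}}^{\mathrm{cor}}\le\frac{3\beta}{8},\quad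 \rho\ge\frac{8C_{\lambda,p}^{\mathrm{cor}}}{\beta}.$$ NR-LALM+SOC (deterministic): from $(x_0,\lambda_0)$, for $k\ge0$, $p_k$ solves $$(\beta I_n+\rho\nabla c(x_k)\nabla c(x_k)^\top)p_k=-\nabla f(x_k)-\nabla c(x_k)(\lambda_k+\rho c(x_k)),$$ then $z_k=x_k+p_k$, $r_k=c(z_k)-c(x_k)-\nabla c(x_k)^\top p_k$, $q_k=-\nabla c(z_k)(\nabla c(z_k)^\top\nabla c(z_k))^{-1}r_k$, $x_{k+1}=z_k+q_k$, $\lambda_{k+1}=\lambda_k+\rho c(x_{k+1})$. Each iteration uses one evaluation of the objective gradient (or estimator), evaluations of $\nabla c$ at $x_k$ and $z_k$ and of $c$ at $z_k$ and $x_{k+1}$, one primal solve (for $p_k$) and one $m\times m$ correction solve (for $q_k$). The iterates remain in the regularity region up to iteration $N$ if $[x_k,z_k]\cup[z_k,x_{k+1}]\subset\mathcal U$ for $0\le k\le N-1$. Oracle assumption: $f(x)=\mathbb E[F(x;\xi)]$ for $x\in\mathcal U$; for almost every $\xi$, $F(\cdot;\xi)$ is differentiable on $\mathcal U$; and there are $\sigma_f,L_s\ge0$ such that for all $x,y\in\mathcal U$: (i) $\mathbb E[\nabla F(x;\xi)]=\nabla f(x)$ and $\mathbb E\|\nabla F(x;\xi)-\nabla f(x)\|^2\le\sigma_f^2$; (ii) $\mathbb E\|\nabla F(x;\xi)-\nabla F(y;\xi)\|^2\le L_s^2\|x-y\|^2$. Stochastic NR-LALM+SOC with projected SPIDER (positive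 integers $Q,B,b$): from $(x_0,\lambda_0)$, at iteration $k\ge0$ a batch $\{\xi_{k,i}\}$ of independent copies of $\xi$, independent of the history before the $k$th batch, is drawn, of size $B$ if $k\equiv0\pmod Q$ and $b$ otherwise, and $$h_k=\begin{cases}\frac1B\sum_{i=1}^B\nabla F(x_k;\xi_{k,i}),&k\equiv0\pmod Q,\\ h_{k-1}+\frac1b\sum_{i=1}^b[\nabla F(x_k;\xi_{k,i})-\nabla F(x_{k-1};\xi_{k,i})],&\text{otherwise},\end{cases}$$ $v_k:=\operatorname{Proj}_{\{w:\|w\|\le G\}}(h_k)$. Then $p_k$ solves $$(\beta I_n+\rho\nabla c(x_k)\nabla c(x_k)^\top)p_k=-v_k-\nabla c(x_k)(\lambda_k+\rho c(x_k)),$$ and $z_k=x_k+p_k$, $r_k=c(z_k)-c(x_k)-\nabla c(x_k)^\top p_k$, $q_k=-\nabla c(z_k)(\nabla c(z_k)^\top\nabla c(z_k))^{-1}r_k$, $x_{k+1}=z_k+q_k$, $\lambda_{k+1}=\lambda_k+\rho c(x_{k+1})$. An iteration with $k\equiv0\pmod Q$ costs $B$ stochastic-gradient evaluations, any other costs $2b$. Stochastic constants: $C_{\lambda,e}:=4/\sigma^2$, $C_e^\star:=2/\beta+C_{\lambda,e}/\rho$, $D_1:=8C_e^\star/\beta$, $\underline\Phi:=\underline f-\Lambda^2/(2\rho)$, $D_0^{\mathrm{cor}}:=\Delta^2+4(\overline\Phi_1^{\mathrm{cor}}-\underline\Phi)/\beta$, $\Gamma_e^{\mathrm{cor}}:=2\sigma_f^2+D_0^{\mathrm{cor}}/D_1$,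 $$H_{\mathrm{st}}^{\mathrm{cor}}(\delta):=H_{\mathrm{det}}^{\mathrm{cor}}+\frac{2C_e^\star\Gamma_e^{\mathrm{cor}}}{\delta},\quad \mathcal S_{\mathrm{st}}^{\mathrm{cor}}(\delta):=\{x\in\mathbb R^n:f(x)\le H_{\mathrm{st}}^{\mathrm{cor}}(\delta),\ \|c(x)\|\le2\Lambda/\rho\}.$$ Safeguarded restart procedure: an attempt runs stochastic NR-LALM+SOC from $(x_0,\lambda_0)$ while the current iterate lies in $\mathcal X_\delta$, stopping at the exit time $\tau_{\mathrm{ex}}:=\inf\{k\ge1:x_k\notin\mathcal X_\delta\}$ if $\tau_{\mathrm{ex}}\le K$; it is accepted if $\tau_{\mathrm{ex}}>K$. After each exit, restart from $(x_0,\lambda_0)$ with fresh independent samples. From the first accepted attempt, draw $\widehat k$ independently and uniformly from $\{1,\ldots,K-1\}$ and return $(x_{\widehat k+1},\lambda_{\widehat k+1})$. KL property: for $\mathcal D\subseteq\mathbb R^q$ open, a continuously differentiable $h:\mathcal D\to\mathbb R$ has the KL property at $\bar z\in\mathcal D$ if there exist a neighborhood $\mathcal V\subseteq\mathcal D$ of $\bar z$, $\eta>0$, and a continuous concave $\varphi:[0,\eta)\to[0,\infty)$ with $\varphi(0)=0$, $\varphi\in C^1((0,\eta))$, $\varphi'>0$ on $(0,\eta)$, such that $\varphi'(h(z)-h(\bar z))\|\nabla h(z)\|\ge1$ whenever $z\in\mathcal V$ and $0<h(z)-h(\bar z)<\eta$. Here it is applied to $\mathcal E$ on $\mathcal U\times\mathbb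 R^m\times\mathbb R^n$. Complexity convention: $\mathcal O(\varepsilon^{-a})$ bounds are with constants independent of $\varepsilon$ (as $\varepsilon\to0$). *)

theory Defs
  imports "HOL-Probability.Probability"
begin

definition grad :: "('a::real_inner \<Rightarrow> real) \<Rightarrow> 'a \<Rightarrow> 'a" where
  "grad h z = (THE g. GDERIV h z :> g)"

(* The n x m matrix whose columns are the gradients of the components (the transposed Jacobian). *)
definition cgrad :: "(real^'n \<Rightarrow> real^'m) \<Rightarrow> real^'n \<Rightarrow> real^'m^'n" where
  "cgrad c x = (\<chi> i j. grad (\<lambda>y. c y $ j) x $ i)"

definition spectral_norm :: "real^'m^'n \<Rightarrow> real" where
  "spectral_norm A = onorm ((*v) A)"

(* infdist to the empty set is 0 in the library, whereas here the distance to the empty set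
   is infinite; hence the extra conjunct. *)
definition nbhd :: "real \<Rightarrow> 'a::metric_space set \<Rightarrow> 'a set" where
  "nbhd r S = {y. S \<noteq> {} \<and> infdist y S \<le> r}"

record lalm_params =
  f_low :: real
  G :: real
  L_f :: real
  M_c :: real
  L_c :: real
  sigma_c :: real
  beta :: real
  rho :: real
  Delta :: real
  Lam :: real

definition regularity ::
  "(real^'n \<Rightarrow> real) \<Rightarrow> (real^'n \<Rightarrow> real^'m) \<Rightarrow> (real^'n) set \<Rightarrow> lalm_params \<Rightarrow> bool" where
  "regularity f c U P \<longleftrightarrow>
     open U \<and> U \<noteq> {} \<and>
     (\<forall>x\<in>U. f differentiable (at x)) \<and> continuous_on U (grad f) \<and>
     (\<forall>x\<in>U. c differentiable (at x)) \<and> continuous_on U (cgrad c) \<and>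
     0 < G P \<and> 0 < L_f P \<and> 0 < M_c P \<and> 0 < L_c P \<and> 0 < sigma_c P \<and>
     (\<forall>x\<in>U. f_low P \<le> f x \<and> norm (grad f x) \<le> G P) \<and>
     (\<forall>x\<in>U. \<forall>y\<in>U. norm (grad f x - grad f y) \<le> L_f P * norm (x - y)) \<and>
     (\<forall>x\<in>U. spectral_norm (cgrad c x) \<le> M_c P) \<and>
     (\<forall>x\<in>U. \<forall>y\<in>U. spectral_norm (cgrad c x - cgrad c y) \<le> L_c P * norm (x - y)) \<and>
     (\<forall>x\<in>U. \<forall>u. sigma_c P * norm u \<le> norm (cgrad c x *v u))"

definition kappa_q :: "lalm_params \<Rightarrow> real" where
  "kappa_q P = L_c P / (2 * sigma_c P)"

definition kappa_d :: "lalm_params \<Rightarrow> real" where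
  "kappa_d P = (L_c P)^3 / (8 * (sigma_c P)^2)"

definition chi_cor :: "lalm_params \<Rightarrow> real" where
  "chi_cor P = 1 + kappa_q P * Delta P"

definition C_mod :: "lalm_params \<Rightarrow> real" where
  "C_mod P = G P * kappa_q P + L_f P / 2 * (chi_cor P)^2
     + kappa_d P * (Delta P)^2 * (3 * Lam P + rho P * M_c P * Delta P)
     + rho P / 2 * (kappa_d P)^2 * (Delta P)^6"

definition A_p :: "lalm_params \<Rightarrow> real" where
  "A_p P = beta P + rho P * M_c P * kappa_d P * (Delta P)^3"

definition B_p :: "lalm_params \<Rightarrow> real" where
  "B_p P = A_p P + (L_f P + L_c P * Lam P) * chi_cor P"

definition C_lambda_p :: "lalm_params \<Rightarrow> real" where
  "C_lambda_p P = 4 / (sigma_c P)^2 * max ((A_p P)^2) ((B_p P)^2)"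

definition Phi1_bar :: "('a \<Rightarrow> real) \<Rightarrow> 'a \<Rightarrow> lalm_params \<Rightarrow> real" where
  "Phi1_bar f x0 P = f x0 + G P * chi_cor P * Delta P + 4 * (Lam P)^2 / rho P
     + C_lambda_p P / rho P * (Delta P)^2"

definition H_det :: "('a \<Rightarrow> real) \<Rightarrow> 'a \<Rightarrow> lalm_params \<Rightarrow> real" where
  "H_det f x0 P = Phi1_bar f x0 P + (Lam P)^2 / (2 * rho P)"

definition S_det ::
  "(real^'n \<Rightarrow> real) \<Rightarrow> (real^'n \<Rightarrow> real^'m) \<Rightarrow> real^'n \<Rightarrow> lalm_params \<Rightarrow> (real^'n) set" where
  "S_det f c x0 P = {x. f x \<le> H_det f x0 P \<and> norm (c x) \<le> 2 * Lam P / rho P}"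

definition corrected_inequalities :: "lalm_params \<Rightarrow> bool" where
  "corrected_inequalities P \<longleftrightarrow>
     Lam P \<ge> (G P + beta P * Delta P + rho P * M_c P * kappa_d P * (Delta P)^4) / sigma_c P \<and>
     G P / beta P + 3 * M_c P * Lam P / (beta P + rho P * (sigma_c P)^2) \<le> Delta P \<and>
     C_mod P \<le> 3 * beta P / 8 \<and>
     rho P \<ge> 8 * C_lambda_p P / beta P"

definition C_lambda_e :: "lalm_params \<Rightarrow> real" where
  "C_lambda_e P = 4 / (sigma_c P)^2"

definition C_e_star :: "lalm_params \<Rightarrow> real" where
  "C_e_star P = 2 / beta P + C_lambda_e P / rho P"

definition D1_const :: "lalm_params \<Rightarrow> real" where
  "D1_const P = 8 * C_e_star P / beta P"

definition Phi_low :: "lalm_params \<Rightarrow> real" where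
  "Phi_low P = f_low P - (Lam P)^2 / (2 * rho P)"

definition D0_const :: "('a \<Rightarrow> real) \<Rightarrow> 'a \<Rightarrow> lalm_params \<Rightarrow> real" where
  "D0_const f x0 P = (Delta P)^2 + 4 * (Phi1_bar f x0 P - Phi_low P) / beta P"

definition Gamma_e :: "('a \<Rightarrow> real) \<Rightarrow> 'a \<Rightarrow> lalm_params \<Rightarrow> real \<Rightarrow> real" where
  "Gamma_e f x0 P \<sigma>f = 2 * \<sigma>f^2 + D0_const f x0 P / D1_const P"

definition H_st :: "('a \<Rightarrow> real) \<Rightarrow> 'a \<Rightarrow> lalm_params \<Rightarrow> real \<Rightarrow> real \<Rightarrow> real" where
  "H_st f x0 P \<sigma>f \<delta> = H_det f x0 P + 2 * C_e_star P * Gamma_e f x0 P \<sigma>f / \<delta>"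

definition S_st :: "(real^'n \<Rightarrow> real) \<Rightarrow> (real^'n \<Rightarrow> real^'m) \<Rightarrow> real^'n \<Rightarrow> lalm_params
    \<Rightarrow> real \<Rightarrow> real \<Rightarrow> (real^'n) set" where
  "S_st f c x0 P \<sigma>f \<delta> = {x. f x \<le> H_st f x0 P \<sigma>f \<delta> \<and> norm (c x) \<le> 2 * Lam P / rho P}"

(* f and c are only assumed differentiable on U and grad, cgrad are unspecified elsewhere,
   so differentiability is part of the notion. *)
definition eps_KKT ::
  "(real^'n \<Rightarrow> real) \<Rightarrow> (real^'n \<Rightarrow> real^'m) \<Rightarrow> real \<Rightarrow> real^'n \<Rightarrow> real^'m \<Rightarrow> bool" where
  "eps_KKT f c \<epsilon> x l \<longleftrightarrow>
     f differentiable (at x) \<and> c differentiable (at x) \<and>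
     norm (grad f x + cgrad c x *v l) \<le> \<epsilon> \<and> norm (c x) \<le> \<epsilon>"

abbreviation KKT ::
  "(real^'n \<Rightarrow> real) \<Rightarrow> (real^'n \<Rightarrow> real^'m) \<Rightarrow> real^'n \<Rightarrow> real^'m \<Rightarrow> bool" where
  "KKT f c x l \<equiv> eps_KKT f c 0 x l"

(* Measurability and integrability are explicit because the Bochner integral of a
   non-integrable function is 0. The completion is used because gradients along iterates are
   only controlled almost surely. *)
definition mean_square_le :: "'w measure \<Rightarrow> ('w \<Rightarrow> 'a::euclidean_space) \<Rightarrow> real \<Rightarrow> bool" where
  "mean_square_le M X v \<longleftrightarrow>
     X \<in> borel_measurable (completion M) \<and>
     integrable (completion M) (\<lambda>\<omega>. (norm (X \<omega>))^2) \<and>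
     (\<integral>\<omega>. (norm (X \<omega>))^2 \<partial>completion M) \<le> v"

definition stochastic_eps_KKT ::
  "'w measure \<Rightarrow> (real^'n \<Rightarrow> real) \<Rightarrow> (real^'n \<Rightarrow> real^'m) \<Rightarrow> real
    \<Rightarrow> ('w \<Rightarrow> real^'n) \<Rightarrow> ('w \<Rightarrow> real^'m) \<Rightarrow> bool" where
  "stochastic_eps_KKT M f c \<epsilon> X Y \<longleftrightarrow>
     X \<in> borel_measurable (completion M) \<and> Y \<in> borel_measurable (completion M) \<and>
     (AE \<omega> in M. f differentiable (at (X \<omega>)) \<and> c differentiable (at (X \<omega>))) \<and>
     mean_square_le M (\<lambda>\<omega>. grad f (X \<omega>) + cgrad c (X \<omega>) *v Y \<omega>) (\<epsilon>^2) \<and>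
     mean_square_le M (\<lambda>\<omega>. c (X \<omega>)) (\<epsilon>^2)"

(* One iteration from (x, l) to (x', l') with primal step p and gradient estimate v. *)
definition soc_step ::
  "(real^'n \<Rightarrow> real^'m) \<Rightarrow> lalm_params \<Rightarrow> real^'n \<Rightarrow> real^'n \<Rightarrow> real^'m
    \<Rightarrow> real^'n \<Rightarrow> real^'n \<Rightarrow> real^'m \<Rightarrow> bool" where
  "soc_step c P v x l p x' l' \<longleftrightarrow>
     (beta P *\<^sub>R mat 1 + rho P *\<^sub>R (cgrad c x ** transpose (cgrad c x))) *v p
       = - v - cgrad c x *v (l + rho P *\<^sub>R c x) \<and>
     (let z = x + p;
          r = c z - c x - transpose (cgrad c x) *v p;
          q = - (cgrad c z *v (matrix_inv (transpose (cgrad c z) ** cgrad c z) *v r))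
      in x' = z + q \<and> l' = l + rho P *\<^sub>R c x')"

definition det_run ::
  "(real^'n \<Rightarrow> real) \<Rightarrow> (real^'n \<Rightarrow> real^'m) \<Rightarrow> lalm_params \<Rightarrow> real^'n \<Rightarrow> real^'m
    \<Rightarrow> (nat \<Rightarrow> real^'n) \<Rightarrow> (nat \<Rightarrow> real^'m) \<Rightarrow> (nat \<Rightarrow> real^'n) \<Rightarrow> bool" where
  "det_run f c P x0 l0 x l p \<longleftrightarrow>
     x 0 = x0 \<and> l 0 = l0 \<and>
     (\<forall>k. soc_step c P (grad f (x k)) (x k) (l k) (p k) (x (Suc k)) (l (Suc k)))"

definition in_region :: "(real^'n) set \<Rightarrow> nat \<Rightarrow> (nat \<Rightarrow> real^'n) \<Rightarrow> (nat \<Rightarrow> real^'n) \<Rightarrow> bool" where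
  "in_region U N x p \<longleftrightarrow>
     (\<forall>k<N. closed_segment (x k) (x k + p k) \<union> closed_segment (x k + p k) (x (Suc k)) \<subseteq> U)"

datatype operation =
  Objective_Gradient | Jacobian_Evaluation | Constraint_Evaluation | Primal_Solve | Correction_Solve

(* Per iteration: the gradient (or its estimator) at x_k, the Jacobian at x_k and z_k, the
   constraints at z_k and x_{k+1}, and one linear solve each for p_k and q_k. *)
fun per_iteration :: "operation \<Rightarrow> nat" where
  "per_iteration Objective_Gradient = 1"
| "per_iteration Jacobian_Evaluation = 2"
| "per_iteration Constraint_Evaluation = 2"
| "per_iteration Primal_Solve = 1"
| "per_iteration Correction_Solve = 1"

definition operation_count :: "operation \<Rightarrow> nat \<Rightarrow> nat" where
  "operation_count a N = N * per_iteration a"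

definition first_order_oracle_count :: "nat \<Rightarrow> nat" where
  "first_order_oracle_count N = operation_count Objective_Gradient N
     + operation_count Jacobian_Evaluation N + operation_count Constraint_Evaluation N"

abbreviation oracle_grad :: "(real^'n \<Rightarrow> 'xi \<Rightarrow> real) \<Rightarrow> real^'n \<Rightarrow> 'xi \<Rightarrow> real^'n" where
  "oracle_grad F x s \<equiv> grad (\<lambda>y. F y s) x"

(* D is the law of the random variable xi. *)
definition oracle_assumption ::
  "(real^'n \<Rightarrow> real) \<Rightarrow> (real^'n \<Rightarrow> 'xi \<Rightarrow> real) \<Rightarrow> 'xi measure \<Rightarrow> (real^'n) set
    \<Rightarrow> real \<Rightarrow> real \<Rightarrow> bool" where
  "oracle_assumption f F D U \<sigma>f Ls \<longleftrightarrow>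
     prob_space D \<and> 0 \<le> \<sigma>f \<and> 0 \<le> Ls \<and>
     (\<forall>x\<in>U. integrable D (F x) \<and> f x = (\<integral>s. F x s \<partial>D)) \<and>
     (AE s in D. \<forall>x\<in>U. (\<lambda>y. F y s) differentiable (at x)) \<and>
     (\<forall>x\<in>U. integrable D (oracle_grad F x) \<and> (\<integral>s. oracle_grad F x s \<partial>D) = grad f x) \<and>
     (\<forall>x\<in>U. integrable D (\<lambda>s. (norm (oracle_grad F x s - grad f x))^2) \<and>
            (\<integral>s. (norm (oracle_grad F x s - grad f x))^2 \<partial>D) \<le> \<sigma>f^2) \<and>
     (\<forall>x\<in>U. \<forall>y\<in>U. integrable D (\<lambda>s. (norm (oracle_grad F x s - oracle_grad F y s))^2) \<and>
            (\<integral>s. (norm (oracle_grad F x s - oracle_grad F y s))^2 \<partial>D) \<le> Ls^2 * (norm (x - y))^2)"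

definition batch_size :: "nat \<Rightarrow> nat \<Rightarrow> nat \<Rightarrow> nat \<Rightarrow> nat" where
  "batch_size Q B b k = (if k mod Q = 0 then B else b)"

definition spider_estimate ::
  "(real^'n \<Rightarrow> 'xi \<Rightarrow> real) \<Rightarrow> nat \<Rightarrow> nat \<Rightarrow> nat \<Rightarrow> (nat \<Rightarrow> nat \<Rightarrow> 'xi)
    \<Rightarrow> (nat \<Rightarrow> real^'n) \<Rightarrow> (nat \<Rightarrow> real^'n) \<Rightarrow> nat \<Rightarrow> real^'n" where
  "spider_estimate F Q B b s x h k =
     (if k mod Q = 0
      then (1 / real B) *\<^sub>R (\<Sum>i=1..B. oracle_grad F (x k) (s k i))
      else h (k - 1) + (1 / real b) *\<^sub>R
             (\<Sum>i=1..b. oracle_grad F (x k) (s k i) - oracle_grad F (x (k - 1)) (s k i)))"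

(* One sample path. The recursion is executed as long as no iterate has left X, so X = UNIV is
   the method without safeguard; after an exit the sequences carry no information. *)
definition spider_run ::
  "(real^'n \<Rightarrow> 'xi \<Rightarrow> real) \<Rightarrow> (real^'n \<Rightarrow> real^'m) \<Rightarrow> lalm_params \<Rightarrow> nat \<Rightarrow> nat \<Rightarrow> nat
    \<Rightarrow> real^'n \<Rightarrow> real^'m \<Rightarrow> (real^'n) set \<Rightarrow> nat \<Rightarrow> (nat \<Rightarrow> nat \<Rightarrow> 'xi)
    \<Rightarrow> (nat \<Rightarrow> real^'n) \<Rightarrow> (nat \<Rightarrow> real^'m) \<Rightarrow> (nat \<Rightarrow> real^'n) \<Rightarrow> (nat \<Rightarrow> real^'n) \<Rightarrow> bool" where
  "spider_run F c P Q B b x0 l0 X N s x l h p \<longleftrightarrow>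
     x 0 = x0 \<and> l 0 = l0 \<and>
     (\<forall>k<N. (\<forall>j\<le>k. x j \<in> X) \<longrightarrow>
        h k = spider_estimate F Q B b s x h k \<and>
        soc_step c P (closest_point (cball 0 (G P)) (h k)) (x k) (l k) (p k)
          (x (Suc k)) (l (Suc k)))"

(* H k is the history before the k-th batch: it makes all quantities determined before that
   batch measurable and is independent of the batch. *)
definition spider_process ::
  "'w measure \<Rightarrow> 'xi measure \<Rightarrow> (real^'n \<Rightarrow> 'xi \<Rightarrow> real) \<Rightarrow> (real^'n \<Rightarrow> real^'m) \<Rightarrow> lalm_params
    \<Rightarrow> nat \<Rightarrow> nat \<Rightarrow> nat \<Rightarrow> real^'n \<Rightarrow> real^'m \<Rightarrow> (real^'n) set \<Rightarrow> nat
    \<Rightarrow> (nat \<Rightarrow> 'w measure) \<Rightarrow> (nat \<Rightarrow> nat \<Rightarrow> 'w \<Rightarrow> 'xi)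
    \<Rightarrow> (nat \<Rightarrow> 'w \<Rightarrow> real^'n) \<Rightarrow> (nat \<Rightarrow> 'w \<Rightarrow> real^'m)
    \<Rightarrow> (nat \<Rightarrow> 'w \<Rightarrow> real^'n) \<Rightarrow> (nat \<Rightarrow> 'w \<Rightarrow> real^'n) \<Rightarrow> bool" where
  "spider_process M D F c P Q B b x0 l0 X N H \<xi> x l h p \<longleftrightarrow>
     prob_space M \<and>
     (\<forall>k\<le>N. subalgebra M (H k)) \<and> (\<forall>k<N. subalgebra (H (Suc k)) (H k)) \<and>
     (\<forall>k\<le>N. x k \<in> borel_measurable (H k) \<and> l k \<in> borel_measurable (H k)) \<and>
     (\<forall>k<N. h k \<in> borel_measurable (H (Suc k)) \<and> p k \<in> borel_measurable (H (Suc k))) \<and>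
     (\<forall>k<N. \<forall>i\<in>{1..batch_size Q B b k}. \<xi> k i \<in> H (Suc k) \<rightarrow>\<^sub>M D \<and> distr M D (\<xi> k i) = D) \<and>
     (\<forall>k<N. prob_space.indep_vars M (\<lambda>_. D) (\<xi> k) {1..batch_size Q B b k}) \<and>
     (\<forall>k<N. prob_space.indep_set M (sets (H k))
        (sigma_sets (space M)
          {\<xi> k i -` A \<inter> space M | i A. i \<in> {1..batch_size Q B b k} \<and> A \<in> sets D})) \<and>
     (AE \<omega> in M. spider_run F c P Q B b x0 l0 X N (\<lambda>k i. \<xi> k i \<omega>)
        (\<lambda>k. x k \<omega>) (\<lambda>k. l k \<omega>) (\<lambda>k. h k \<omega>) (\<lambda>k. p k \<omega>))"

definition uniform_index ::
  "'w measure \<Rightarrow> nat \<Rightarrow> 'w set set \<Rightarrow> ('w \<Rightarrow> nat) \<Rightarrow> bool" where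
  "uniform_index M K \<A> khat \<longleftrightarrow>
     khat \<in> M \<rightarrow>\<^sub>M count_space UNIV \<and>
     distr M (count_space UNIV) khat = measure_pmf (pmf_of_set {1..K - 1}) \<and>
     prob_space.indep_set M {khat -` S \<inter> space M | S. True} \<A>"

definition spider_cost :: "nat \<Rightarrow> nat \<Rightarrow> nat \<Rightarrow> nat \<Rightarrow> nat" where
  "spider_cost Q B b N = (\<Sum>k<N. if k mod Q = 0 then B else 2 * b)"

definition Q_of :: "nat \<Rightarrow> nat" where
  "Q_of K = nat \<lceil>sqrt (real K)\<rceil>"

definition b_of :: "lalm_params \<Rightarrow> real \<Rightarrow> nat \<Rightarrow> nat" where
  "b_of P Ls K = max 1 (nat \<lceil>2 * D1_const P * Ls^2 * (chi_cor P)^2 * real (Q_of K)\<rceil>)"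

definition horizon_of_order :: "real \<Rightarrow> real \<Rightarrow> real \<Rightarrow> nat \<Rightarrow> bool" where
  "horizon_of_order C a \<epsilon> K \<longleftrightarrow> 2 \<le> K \<and> C / \<epsilon>^2 \<le> real (K - 1) \<and> real K \<le> a / \<epsilon>^2"

(* The infimum of the empty set is infinity. *)
definition exit_time :: "'a set \<Rightarrow> (nat \<Rightarrow> 'a) \<Rightarrow> enat" where
  "exit_time X x = (INF k\<in>{k. 1 \<le> k \<and> x k \<notin> X}. enat k)"

definition accepted :: "nat \<Rightarrow> 'a set \<Rightarrow> (nat \<Rightarrow> 'a) \<Rightarrow> bool" where
  "accepted K X x \<longleftrightarrow> exit_time X x > enat K"

definition attempt_length :: "nat \<Rightarrow> 'a set \<Rightarrow> (nat \<Rightarrow> 'a) \<Rightarrow> nat" where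
  "attempt_length K X x = the_enat (min (exit_time X x) (enat K))"

(* Attempts are indexed by the natural numbers; those after the first accepted one are fictitious
   and are neither charged for nor used by the output. *)
definition restart_process ::
  "'w measure \<Rightarrow> 'xi measure \<Rightarrow> (real^'n \<Rightarrow> 'xi \<Rightarrow> real) \<Rightarrow> (real^'n \<Rightarrow> real^'m) \<Rightarrow> lalm_params
    \<Rightarrow> nat \<Rightarrow> nat \<Rightarrow> nat \<Rightarrow> real^'n \<Rightarrow> real^'m \<Rightarrow> (real^'n) set \<Rightarrow> nat
    \<Rightarrow> (nat \<Rightarrow> nat \<Rightarrow> 'w measure) \<Rightarrow> (nat \<Rightarrow> nat \<Rightarrow> nat \<Rightarrow> 'w \<Rightarrow> 'xi)
    \<Rightarrow> (nat \<Rightarrow> nat \<Rightarrow> 'w \<Rightarrow> real^'n) \<Rightarrow> (nat \<Rightarrow> nat \<Rightarrow> 'w \<Rightarrow> real^'m)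
    \<Rightarrow> (nat \<Rightarrow> nat \<Rightarrow> 'w \<Rightarrow> real^'n) \<Rightarrow> (nat \<Rightarrow> nat \<Rightarrow> 'w \<Rightarrow> real^'n)
    \<Rightarrow> ('w \<Rightarrow> nat) \<Rightarrow> bool" where
  "restart_process M D F c P Q B b x0 l0 X K H \<xi> x l h p khat \<longleftrightarrow>
     prob_space M \<and>
     (\<forall>t. spider_process M D F c P Q B b x0 l0 X K (H t) (\<xi> t) (x t) (l t) (h t) (p t)) \<and>
     prob_space.indep_sets M (\<lambda>t. sets (H t K)) UNIV \<and>
     uniform_index M K (sigma_sets (space M) (\<Union>t. sets (H t K))) khat"

definition first_accepted :: "nat \<Rightarrow> 'a set \<Rightarrow> (nat \<Rightarrow> nat \<Rightarrow> 'w \<Rightarrow> 'a) \<Rightarrow> 'w \<Rightarrow> nat" where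
  "first_accepted K X x \<omega> = (LEAST t. accepted K X (\<lambda>k. x t k \<omega>))"

(* Expected total cost over all attempts up to and including the first accepted one, where
   cost N is the cost of N iterations. *)
definition expected_restart_cost ::
  "'w measure \<Rightarrow> (nat \<Rightarrow> nat) \<Rightarrow> nat \<Rightarrow> 'a set \<Rightarrow> (nat \<Rightarrow> nat \<Rightarrow> 'w \<Rightarrow> 'a) \<Rightarrow> ennreal" where
  "expected_restart_cost M cost K X x =
     (\<integral>\<^sup>+ \<omega>. (\<Sum>t. if \<forall>j<t. \<not> accepted K X (\<lambda>k. x j k \<omega>)
                 then of_nat (cost (attempt_length K X (\<lambda>k. x t k \<omega>))) else 0) \<partial>M)"

definition KL_property :: "'a::euclidean_space set \<Rightarrow> ('a \<Rightarrow> real) \<Rightarrow> 'a \<Rightarrow> bool" where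
  "KL_property D h zb \<longleftrightarrow>
     zb \<in> D \<and>
     (\<exists>V \<eta> \<phi>. V \<subseteq> D \<and> zb \<in> interior V \<and> 0 < \<eta> \<and>
        continuous_on {0..<\<eta>} \<phi> \<and> concave_on {0..<\<eta>} \<phi> \<and> (\<forall>s\<in>{0..<\<eta>}. 0 \<le> \<phi> s) \<and>
        \<phi> 0 = 0 \<and>
        (\<forall>s\<in>{0<..<\<eta>}. \<phi> differentiable (at s)) \<and> continuous_on {0<..<\<eta>} (deriv \<phi>) \<and>
        (\<forall>s\<in>{0<..<\<eta>}. 0 < deriv \<phi> s) \<and>
        (\<forall>z\<in>V. 0 < h z - h zb \<and> h z - h zb < \<eta> \<longrightarrow>
           1 \<le> deriv \<phi> (h z - h zb) * norm (grad h z)))"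

definition cluster_set :: "(nat \<Rightarrow> 'a::topological_space) \<Rightarrow> 'a set" where
  "cluster_set s = {z. \<exists>r. strict_mono r \<and> (s \<circ> r) \<longlonglongrightarrow> z}"

definition aug_lagrangian ::
  "(real^'n \<Rightarrow> real) \<Rightarrow> (real^'n \<Rightarrow> real^'m) \<Rightarrow> real \<Rightarrow> real^'n \<Rightarrow> real^'m \<Rightarrow> real" where
  "aug_lagrangian f c r x l = f x + l \<bullet> c x + r / 2 * (norm (c x))^2"

definition lyapunov ::
  "(real^'n \<Rightarrow> real) \<Rightarrow> (real^'n \<Rightarrow> real^'m) \<Rightarrow> lalm_params
    \<Rightarrow> (real^'n) \<times> (real^'m) \<times> (real^'n) \<Rightarrow> real" where
  "lyapunov f c P = (\<lambda>(x, l, w). aug_lagrangian f c (rho P) x l + beta P / 4 * (norm w)^2)"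

end

theory Submission
  imports Defs
begin

text \<open>
  Write \<open>J\<close> for the gradient matrix of \<open>c\<close> at \<open>x\<close> and \<open>e = v - \<nabla>f(x)\<close> for the gradient error. The correction \<open>q\<close>
  cancels the linearisation error of the primal step up to a quartic term, \<open>c(x') = c(x) + J\<^sup>T p + d\<close> with
  \<open>\<parallel>d\<parallel> \<le> \<kappa>\<^sub>d \<parallel>p\<parallel>\<^sup>4\<close>, so that the primal system reads \<open>J \<lambda>' = - v - \<beta> p + \<rho> J d\<close>. Since \<open>J\<close> is bounded below,
  this identity keeps the multipliers in the ball of radius \<open>\<Lambda>\<close> and, applied to two consecutive steps, bounds
  their increments by step lengths and gradient errors. Consequently the augmented Lagrangian plus a multiple
  of the last squared step decreases up to squared errors, which gives \<open>\<Sum> \<parallel>p\<parallel>\<^sup>2 \<le> D\<^sub>0 + D\<^sub>1 \<Sum> \<parallel>e\<parallel>\<^sup>2\<close> and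
  bounds both residuals. Without errors this yields the deterministic rate, and the Kurdyka-Lojasiewicz
  inequality at one cluster point yields finite length.

  In the stochastic case the SPIDER recursion gives the converse estimate
  \<open>\<Sum> E\<parallel>e\<parallel>\<^sup>2 \<le> \<sigma>\<^sub>f\<^sup>2 + \<Sum> E\<parallel>p\<parallel>\<^sup>2 / (2 D\<^sub>1)\<close>, and the two together bound both sums independently of the horizon. The
  bound on the errors holds up to the exit time, where the objective value forces the accumulated squared
  error above \<open>\<Gamma>\<^sub>e / \<delta>\<close>; by Markov's inequality an attempt is rejected with probability at most \<open>\<delta>\<close>, and summing
  over independent attempts costs only a factor \<open>1 / (1 - \<delta>)\<close>.
\<close>

section \<open>Gradients and Taylor estimates\<close>

text \<open>The one-step estimates presuppose a bounded multiplier and a step inside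
  \<open>U\<close>, while staying in \<open>U\<close> is itself a consequence of accumulated
  descent. The circle opens because the multiplier and constraint bounds follow from one step
  without any descent; descent is needed only for the value of \<open>f\<close>, and an induction
  along the run alternates the two. The increment estimate compares two consecutive steps, so the
  potential starts after the first step, which is paid for by the a priori bounds inside
  \<open>Phi1_bar\<close> and \<open>D0_const\<close>. With noise, combining the two inequalities
  between steps and errors absorbs half of the expected error into itself, which is legitimate only
  once that expectation is known to be finite; integrability is therefore carried along the
  recursion. Independence of a batch from the past enters as a product law followed by Fubini. The
  restart analysis never conditions on acceptance: acceptance provides the pathwise bounds, and is
  dropped before integrating.\<close>

lemma grad_eqI: "GDERIV h z :> g \<Longrightarrow> grad h z = g"
  for h :: "'a::real_inner \<Rightarrow> real"
  unfolding grad_def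
proof (rule the_equality)
  fix g' assume "GDERIV h z :> g" "GDERIV h z :> g'"
  then have "(\<lambda>u. u \<bullet> g') = (\<lambda>u. u \<bullet> g)"
    unfolding gderiv_def by (metis has_derivative_unique)
  then show "g' = g"
    by (metis vector_eq_ldot)
qed

text \<open>\<open>grad\<close> is a definite description, so it has meaning only once a
  representing vector exists; one is assembled from the derivative on the standard basis.\<close>

lemma GDERIV_grad:
  fixes h :: "'a::euclidean_space \<Rightarrow> real"
  assumes "h differentiable (at x)"
  shows "GDERIV h x :> grad h x"
proof -
  obtain D where D: "(h has_derivative D) (at x)"
    using assms by (auto simp: differentiable_def)
  interpret D: linear D using D by (rule has_derivative_linear)
  define g where "g = (\<Sum>b\<in>Basis. D b *\<^sub>R b)"
  have "D u = u \<bullet> g" for u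
  proof -
    have "D u = D (\<Sum>b\<in>Basis. (u \<bullet> b) *\<^sub>R b)"
      by (simp add: euclidean_representation)
    also have "\<dots> = (\<Sum>b\<in>Basis. (u \<bullet> b) * D b)"
      by (simp add: D.sum D.scaleR)
    finally show ?thesis
      by (simp add: g_def inner_sum_right mult.commute)
  qed
  then have "D = (\<lambda>u. u \<bullet> g)" by blast
  with D have "GDERIV h x :> g"
    by (simp add: gderiv_def)
  then show ?thesis
    by (simp add: grad_eqI)
qed

lemma has_derivative_cgrad:
  fixes c :: "real^'n \<Rightarrow> real^'m"
  assumes "c differentiable (at x)"
  shows "(c has_derivative (\<lambda>u. transpose (cgrad c x) *v u)) (at x)"
proof -
  obtain D where D: "(c has_derivative D) (at x)"
    using assms by (auto simp: differentiable_def)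
  have "D u $ j = (transpose (cgrad c x) *v u) $ j" for u j
  proof -
    have d: "((\<lambda>y. c y $ j) has_derivative (\<lambda>u. D u $ j)) (at x)"
      using bounded_linear.has_derivative[OF bounded_linear_vec_nth D] .
    then have "(\<lambda>y. c y $ j) differentiable (at x)"
      by (auto simp: differentiable_def)
    from GDERIV_grad[OF this] d have "(\<lambda>u. D u $ j) = (\<lambda>u. u \<bullet> grad (\<lambda>y. c y $ j) x)"
      unfolding gderiv_def by (metis has_derivative_unique)
    then have "D u $ j = u \<bullet> grad (\<lambda>y. c y $ j) x" by metis
    then show ?thesis
      by (simp add: matrix_vector_mult_def transpose_def cgrad_def inner_vec_def mult.commute)
  qed
  then have "D = (\<lambda>u. transpose (cgrad c x) *v u)"
    by (simp add: fun_eq_iff vec_eq_iff)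
  with D show ?thesis by simp
qed

declare transpose_matrix_vector [simp del]

lemma inner_matrix_transpose:
  fixes A :: "real^'m^'n"
  shows "x \<bullet> (A *v y) = (transpose A *v x) \<bullet> y"
  by (metis dot_lmul_matrix vector_transpose_matrix transpose_transpose)

lemma norm_mult_spectral: "norm (A *v u) \<le> spectral_norm A * norm u"
  for A :: "real^'m^'n"
  unfolding spectral_norm_def by (rule onorm) simp

text \<open>Pairing \<open>transpose A *v u\<close> with itself moves one factor back to
  \<open>A\<close>, and one power of its norm cancels. A single bound on \<open>cgrad\<close> thus
  controls both orientations.\<close>

lemma norm_transpose_mult_spectral: "norm (transpose A *v u) \<le> spectral_norm A * norm u"
  for A :: "real^'m^'n"
proof (cases "transpose A *v u = 0")
  case True
  then show ?thesis
    by (simp add: spectral_norm_def onorm_pos_le)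
next
  case False
  have "norm (transpose A *v u) * norm (transpose A *v u) = u \<bullet> (A *v (transpose A *v u))"
    by (simp add: inner_matrix_transpose power2_eq_square[symmetric] power2_norm_eq_inner)
  also have "\<dots> \<le> norm u * norm (A *v (transpose A *v u))"
    by (rule norm_cauchy_schwarz)
  also have "\<dots> \<le> norm u * (spectral_norm A * norm (transpose A *v u))"
    by (intro mult_left_mono norm_mult_spectral) simp
  also have "\<dots> = (spectral_norm A * norm u) * norm (transpose A *v u)"
    by (simp only: ac_simps)
  finally show ?thesis
    using False by (simp del: transpose_matrix_vector)
qed

lemma tendsto_matrix_vector_mult:
  fixes A :: "'a \<Rightarrow> real^'m^'n"
  assumes "(A \<longlongrightarrow> A0) F" "(v \<longlongrightarrow> v0) F"
  shows "((\<lambda>k. A k *v v k) \<longlongrightarrow> A0 *v v0) F"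
proof (rule vec_tendstoI)
  fix i
  show "((\<lambda>k. (A k *v v k) $ i) \<longlongrightarrow> (A0 *v v0) $ i) F"
    unfolding matrix_vector_mult_def vec_lambda_beta
    by (intro tendsto_sum tendsto_mult tendsto_vec_nth assms)
qed

text \<open>Only the deviation of the derivative from its value at \<open>x\<close> matters, and it
  grows linearly along the segment; comparison with a quadratic majorant yields the factor 1/2. The
  hypotheses concern a single segment because \<open>U\<close> is not assumed convex.\<close>

lemma norm_taylor_segment_le:
  fixes g :: "'a::real_normed_vector \<Rightarrow> 'b::real_normed_vector"
  assumes g': "\<And>y. y \<in> closed_segment x z \<Longrightarrow> (g has_derivative g' y) (at y)"
    and L: "\<And>y h. y \<in> closed_segment x z \<Longrightarrow> norm (g' y h - g' x h) \<le> L * norm (y - x) * norm h"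
  shows "norm (g z - g x - g' x (z - x)) \<le> L / 2 * (norm (z - x))\<^sup>2"
proof -
  define \<gamma> where "\<gamma> = (\<lambda>t. x + t *\<^sub>R (z - x))"
  have \<gamma>: "\<gamma> t \<in> closed_segment x z" if "t \<in> {0..1}" for t
    using that by (auto simp: \<gamma>_def closed_segment_def algebra_simps intro!: exI[of _ t])
  define \<phi> where "\<phi> t = g (\<gamma> t) - t *\<^sub>R g' x (z - x)" for t
  have lin: "linear (g' y)" if "y \<in> closed_segment x z" for y
    using g'[OF that] by (rule has_derivative_linear)
  have d: "(\<phi> has_vector_derivative (g' (\<gamma> t) (z - x) - g' x (z - x))) (at t)" if "t \<in> {0..1}" for t
  proof -
    have "((\<lambda>t. g (\<gamma> t)) has_derivative (\<lambda>s. g' (\<gamma> t) (s *\<^sub>R (z - x)))) (at t)"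
      by (rule has_derivative_compose[of \<gamma>, OF _ g'[OF \<gamma>[OF that]]])
         (auto simp: \<gamma>_def intro!: derivative_eq_intros)
    then show ?thesis
      unfolding \<phi>_def has_vector_derivative_def
      by (auto intro!: derivative_eq_intros
          simp: linear_cmul[OF lin[OF \<gamma>[OF that]], of _ "z - x"] scaleR_diff_right[of _ "g' _ _"]
          simp del: scaleR_diff_right)
  qed
  have "norm (\<phi> 1 - \<phi> 0) \<le> L / 2 * (norm (z - x))\<^sup>2 * 1\<^sup>2 - L / 2 * (norm (z - x))\<^sup>2 * 0\<^sup>2"
  proof (rule differentiable_bound_general[where \<phi>'="\<lambda>t. L * t * (norm (z - x))\<^sup>2"
        and f'="\<lambda>t. g' (\<gamma> t) (z - x) - g' x (z - x)"])
    show "continuous_on {0..1} \<phi>"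
      using d by (meson continuous_at_imp_continuous_on has_vector_derivative_continuous)
    fix t :: real assume t: "0 < t" "t < 1"
    then show "(\<phi> has_vector_derivative g' (\<gamma> t) (z - x) - g' x (z - x)) (at t)"
      using d by auto
    show "((\<lambda>t. L / 2 * (norm (z - x))\<^sup>2 * t\<^sup>2) has_vector_derivative L * t * (norm (z - x))\<^sup>2) (at t)"
      by (auto intro!: derivative_eq_intros simp: has_real_derivative_iff_has_vector_derivative[symmetric])
    have "norm (g' (\<gamma> t) (z - x) - g' x (z - x)) \<le> L * norm (\<gamma> t - x) * norm (z - x)"
      using L \<gamma> t by auto
    also have "\<dots> = L * t * (norm (z - x))\<^sup>2"
      using t by (simp add: \<gamma>_def power2_eq_square)
    finally show "norm (g' (\<gamma> t) (z - x) - g' x (z - x)) \<le> L * t * (norm (z - x))\<^sup>2" .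
  qed (auto intro!: continuous_intros)
  then show ?thesis
    by (simp add: \<phi>_def \<gamma>_def algebra_simps)
qed

section \<open>One step of the corrected method\<close>

lemma transpose_diff: "transpose (A - B) = transpose A - transpose B" for A B :: "real^'m^'n"
  by (simp add: transpose_def vec_eq_iff)

lemma soc_step_iff:
  "soc_step c P v x l p x' l' \<longleftrightarrow>
     beta P *\<^sub>R p + rho P *\<^sub>R (cgrad c x *v (transpose (cgrad c x) *v p))
       = - v - cgrad c x *v (l + rho P *\<^sub>R c x) \<and>
     x' = x + p - cgrad c (x + p) *v
       (matrix_inv (transpose (cgrad c (x + p)) ** cgrad c (x + p)) *v
         (c (x + p) - c x - transpose (cgrad c x) *v p)) \<and>
     l' = l + rho P *\<^sub>R c x'"
  by (simp add: soc_step_def Let_def matrix_vector_mult_add_rdistrib scaleR_matrix_vector_assoc[symmetric]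
      matrix_vector_mul_assoc[symmetric] conj_assoc)

lemma mult_matrix_inv: "invertible A \<Longrightarrow> A ** matrix_inv A = mat 1"
  unfolding invertible_def matrix_inv_def by (rule someI2_ex) auto

section \<open>Consequences of the regularity assumption on \<open>U\<close>\<close>

locale lalm =
  fixes f :: "real^'n \<Rightarrow> real" and c :: "real^'n \<Rightarrow> real^'m" and U :: "(real^'n) set" and P :: lalm_params
  assumes reg: "regularity f c U P"
    and pos: "0 < beta P" "0 < rho P" "0 < Delta P" "0 < Lam P"
    and ineqs: "corrected_inequalities P"
begin

abbreviation kkt_residual where "kkt_residual y m \<equiv> grad f y + cgrad c y *v m"

lemma param_pos [simp]:
  "0 < G P" "0 < L_f P" "0 < M_c P" "0 < L_c P" "0 < sigma_c P"
  "0 < beta P" "0 < rho P" "0 < Delta P" "0 < Lam P"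
  using reg pos by (auto simp: regularity_def)

lemma param_nonneg [simp]:
  "0 \<le> G P" "0 \<le> L_f P" "0 \<le> M_c P" "0 \<le> L_c P" "0 \<le> sigma_c P"
  "0 \<le> beta P" "0 \<le> rho P" "0 \<le> Delta P" "0 \<le> Lam P"
  using param_pos by (auto intro: less_imp_le)

lemma param_nonzero [simp]: "sigma_c P \<noteq> 0" "beta P \<noteq> 0" "rho P \<noteq> 0"
  using param_pos by (metis less_irrefl)+

lemma kappa_q_pos [simp]: "0 < kappa_q P" and kappa_d_pos [simp]: "0 < kappa_d P"
  by (auto simp: kappa_q_def kappa_d_def intro!: divide_pos_pos mult_pos_pos zero_less_power)

lemma chi_ge_1: "1 \<le> chi_cor P"
  by (simp add: chi_cor_def less_imp_le)

lemma chi_pos [simp]: "0 < chi_cor P"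
  using chi_ge_1 by linarith

lemma kappa_chi_nonneg [simp]: "0 \<le> kappa_q P" "0 \<le> kappa_d P" "0 \<le> chi_cor P"
  by (auto intro: less_imp_le)

lemma A_p_pos [simp]: "0 < A_p P"
  by (auto simp: A_p_def intro!: add_pos_nonneg mult_nonneg_nonneg less_imp_le)

lemma B_p_ge_A_p: "A_p P \<le> B_p P"
  using less_imp_le[OF chi_pos] by (auto simp: B_p_def intro!: mult_nonneg_nonneg add_nonneg_nonneg)

lemma open_U: "open U"
  using reg by (auto simp: regularity_def)

lemma f_differentiable: "x \<in> U \<Longrightarrow> f differentiable (at x)"
  and c_differentiable: "x \<in> U \<Longrightarrow> c differentiable (at x)"
  using reg by (auto simp: regularity_def)

lemma f_has_derivative: "x \<in> U \<Longrightarrow> (f has_derivative (\<lambda>u. u \<bullet> grad f x)) (at x)"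
  using GDERIV_grad[OF f_differentiable] by (simp add: gderiv_def)

lemma c_has_derivative: "x \<in> U \<Longrightarrow> (c has_derivative (\<lambda>u. transpose (cgrad c x) *v u)) (at x)"
  using has_derivative_cgrad[OF c_differentiable] .

lemma continuous_on_grad: "continuous_on U (grad f)"
  and continuous_on_cgrad: "continuous_on U (cgrad c)"
  using reg by (auto simp: regularity_def)

lemma continuous_on_c: "continuous_on U c"
  using c_differentiable by (meson continuous_at_imp_continuous_on differentiable_imp_continuous_within)

lemma f_low_le: "x \<in> U \<Longrightarrow> f_low P \<le> f x"
  and norm_grad_le: "x \<in> U \<Longrightarrow> norm (grad f x) \<le> G P"
  and grad_lipschitz: "x \<in> U \<Longrightarrow> y \<in> U \<Longrightarrow> norm (grad f x - grad f y) \<le> L_f P * norm (x - y)"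
  and cgrad_lower: "x \<in> U \<Longrightarrow> sigma_c P * norm u \<le> norm (cgrad c x *v u)"
  using reg by (auto simp: regularity_def)

lemma cgrad_upper: "x \<in> U \<Longrightarrow> norm (cgrad c x *v u) \<le> M_c P * norm u"
  using reg by (intro order_trans[OF norm_mult_spectral] mult_right_mono) (auto simp: regularity_def)

lemma cgrad_transpose_upper: "x \<in> U \<Longrightarrow> norm (transpose (cgrad c x) *v u) \<le> M_c P * norm u"
  using reg by (intro order_trans[OF norm_transpose_mult_spectral] mult_right_mono) (auto simp: regularity_def)

lemma cgrad_lipschitz:
  assumes "x \<in> U" "y \<in> U"
  shows "norm (cgrad c x *v u - cgrad c y *v u) \<le> L_c P * norm (x - y) * norm u"
proof -
  have "norm (cgrad c x *v u - cgrad c y *v u) \<le> spectral_norm (cgrad c x - cgrad c y) * norm u"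
    using norm_mult_spectral[of "cgrad c x - cgrad c y" u] by (simp add: matrix_vector_mult_diff_rdistrib)
  also have "\<dots> \<le> L_c P * norm (x - y) * norm u"
    using reg assms by (auto simp: regularity_def intro!: mult_right_mono)
  finally show ?thesis .
qed

lemma cgrad_transpose_lipschitz:
  assumes "x \<in> U" "y \<in> U"
  shows "norm (transpose (cgrad c x) *v u - transpose (cgrad c y) *v u) \<le> L_c P * norm (x - y) * norm u"
proof -
  have "norm (transpose (cgrad c x) *v u - transpose (cgrad c y) *v u)
      \<le> spectral_norm (cgrad c x - cgrad c y) * norm u"
    using norm_transpose_mult_spectral[of "cgrad c x - cgrad c y" u]
    by (simp add: transpose_diff matrix_vector_mult_diff_rdistrib)
  also have "\<dots> \<le> L_c P * norm (x - y) * norm u"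
    using reg assms by (auto simp: regularity_def intro!: mult_right_mono)
  finally show ?thesis .
qed

lemma c_taylor:
  assumes "closed_segment x z \<subseteq> U"
  shows "norm (c z - c x - transpose (cgrad c x) *v (z - x)) \<le> L_c P / 2 * (norm (z - x))\<^sup>2"
proof (rule norm_taylor_segment_le[where g'="\<lambda>y u. transpose (cgrad c y) *v u"])
  fix y h assume "y \<in> closed_segment x z"
  then show "(c has_derivative (*v) (transpose (cgrad c y))) (at y)"
    and "norm (transpose (cgrad c y) *v h - transpose (cgrad c x) *v h) \<le> L_c P * norm (y - x) * norm h"
    using assms c_has_derivative cgrad_transpose_lipschitz[of y x] by auto
qed

lemma f_taylor:
  assumes "closed_segment x z \<subseteq> U"
  shows "\<bar>f z - f x - (z - x) \<bullet> grad f x\<bar> \<le> L_f P / 2 * (norm (z - x))\<^sup>2"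
proof -
  have "norm (f z - f x - (z - x) \<bullet> grad f x) \<le> L_f P / 2 * (norm (z - x))\<^sup>2"
  proof (rule norm_taylor_segment_le[where g'="\<lambda>y u. u \<bullet> grad f y"])
    fix y h assume y: "y \<in> closed_segment x z"
    then show "(f has_derivative (\<lambda>u. u \<bullet> grad f y)) (at y)"
      using assms f_has_derivative by auto
    have "norm (h \<bullet> grad f y - h \<bullet> grad f x) \<le> norm h * norm (grad f y - grad f x)"
      by (metis inner_diff_right Cauchy_Schwarz_ineq2 real_norm_def)
    also have "\<dots> \<le> norm h * (L_f P * norm (y - x))"
      using assms y by (intro mult_left_mono grad_lipschitz) auto
    finally show "norm (h \<bullet> grad f y - h \<bullet> grad f x) \<le> L_f P * norm (y - x) * norm h"
      by (simp add: mult.commute)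
  qed
  then show ?thesis by simp
qed

lemma f_lipschitz_segment:
  assumes "closed_segment x z \<subseteq> U"
  shows "\<bar>f z - f x\<bar> \<le> G P * norm (z - x)"
proof -
  have "norm (f z - f x) \<le> G P * norm (z - x)"
  proof (rule differentiable_bound[where f'="\<lambda>y u. u \<bullet> grad f y" and S="closed_segment x z"])
    fix y assume y: "y \<in> closed_segment x z"
    then show "(f has_derivative (\<lambda>u. u \<bullet> grad f y)) (at y within closed_segment x z)"
      using assms f_has_derivative has_derivative_at_withinI by blast
    show "onorm (\<lambda>u. u \<bullet> grad f y) \<le> G P"
    proof (rule onorm_le)
      fix u
      have "norm (u \<bullet> grad f y) \<le> norm u * norm (grad f y)"
        using Cauchy_Schwarz_ineq2 by auto
      also have "\<dots> \<le> norm u * G P"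
        using y assms norm_grad_le by (intro mult_left_mono) auto
      finally show "norm (u \<bullet> grad f y) \<le> G P * norm u"
        by (simp add: mult.commute)
    qed
  qed auto
  then show ?thesis by simp
qed

section \<open>The primal and correction solves\<close>

text \<open>The two parts of the right-hand side have different gains. The response to
  \<open>v\<close> sees only the coercivity \<open>beta P\<close>, whereas the response to
  \<open>w\<close> is the image under \<open>cgrad c x\<close> of a system whose coercivity also
  contains \<open>rho P * (sigma_c P)^2\<close>. Adding both gives the left side of the second
  corrected inequality.\<close>

lemma primal_step_bound:
  assumes x: "x \<in> U" and v: "norm v \<le> G P" and w: "norm w \<le> 3 * Lam P"
    and p: "beta P *\<^sub>R p + rho P *\<^sub>R (cgrad c x *v (transpose (cgrad c x) *v p)) = - v - cgrad c x *v w"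
  shows "norm p \<le> Delta P"
proof -
  define A where "A = cgrad c x"
  define D where "D = beta P + rho P * (sigma_c P)\<^sup>2"
  have D: "D > 0" by (auto simp: D_def intro!: add_pos_nonneg)
  define T where "T y = beta P *\<^sub>R y + rho P *\<^sub>R (transpose A *v (A *v y))" for y
  have coercive: "D * (norm y)\<^sup>2 \<le> y \<bullet> T y" for y
  proof -
    have "y \<bullet> (transpose A *v (A *v y)) = (norm (A *v y))\<^sup>2"
      by (simp add: inner_matrix_transpose power2_norm_eq_inner)
    moreover have "(sigma_c P * norm y)\<^sup>2 \<le> (norm (A *v y))\<^sup>2"
      using cgrad_lower[OF x] by (intro power_mono) (auto simp: A_def)
    ultimately show ?thesis
      by (simp add: T_def D_def inner_add_right power2_norm_eq_inner[symmetric] algebra_simps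
          power_mult_distrib mult_left_mono)
  qed
  have linT: "linear T"
    by (intro linearI) (auto simp: T_def algebra_simps)
  have "inj T"
  proof (rule linear_injective_0[THEN iffD2, OF linT], intro allI impI)
    fix y assume "T y = 0"
    then have "D * (norm y)\<^sup>2 \<le> 0" using coercive[of y] by simp
    then show "y = 0" using D by (simp add: mult_le_0_iff)
  qed
  then have "surj T"
    using linT linear_injective_imp_surjective by blast
  then obtain y where y: "T y = w" by (metis surjD)
  have "D * (norm y)\<^sup>2 \<le> norm y * norm w"
    using coercive[of y] norm_cauchy_schwarz[of y w] y by simp
  then have y_bound: "norm y \<le> norm w / D"
    using D by (cases "y = 0") (auto simp: power2_eq_square field_simps)
  \<comment> \<open>\<open>- A y\<close> is the response to \<open>A w\<close>, because \<open>A (\<beta> I + \<rho> A\<^sup>T A) = (\<beta> I + \<rho> A A\<^sup>T) A\<close>.\<close>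
  define p1 where "p1 = p + A *v y"
  have "beta P *\<^sub>R p1 + rho P *\<^sub>R (A *v (transpose A *v p1))
      = (- v - A *v w) + A *v (beta P *\<^sub>R y + rho P *\<^sub>R (transpose A *v (A *v y)))"
    using p by (simp add: p1_def A_def algebra_simps matrix_vector_right_distrib)
  also have "\<dots> = - v"
    using y by (simp add: T_def)
  finally have p1: "beta P *\<^sub>R p1 + rho P *\<^sub>R (A *v (transpose A *v p1)) = - v" .
  have "p1 \<bullet> (A *v (transpose A *v p1)) = (norm (transpose A *v p1))\<^sup>2"
    by (simp add: inner_matrix_transpose power2_norm_eq_inner)
  then have "beta P * (norm p1)\<^sup>2 \<le> p1 \<bullet> (beta P *\<^sub>R p1 + rho P *\<^sub>R (A *v (transpose A *v p1)))"
    by (simp add: inner_add_right power2_norm_eq_inner)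
  also have "\<dots> \<le> norm p1 * G P"
    unfolding p1 using norm_cauchy_schwarz[of p1 "- v"] mult_left_mono[OF v norm_ge_zero[of p1]] by simp
  finally have p1_bound: "norm p1 \<le> G P / beta P"
    by (cases "p1 = 0") (auto simp: power2_eq_square field_simps)
  have "norm p \<le> norm p1 + norm (A *v y)"
    unfolding p1_def using norm_triangle_ineq4[of "p + A *v y" "A *v y"] by simp
  also have "norm (A *v y) \<le> M_c P * (norm w / D)"
    using cgrad_upper[OF x, of y] mult_left_mono[OF y_bound param_nonneg(3)] by (simp add: A_def)
  also have "M_c P * (norm w / D) \<le> M_c P * (3 * Lam P / D)"
    using w D by (intro mult_left_mono divide_right_mono) auto
  finally have "norm p \<le> G P / beta P + 3 * M_c P * Lam P / D"
    using p1_bound by (simp add: mult.commute mult.left_commute)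
  also have "\<dots> \<le> Delta P"
    using ineqs by (simp add: corrected_inequalities_def D_def)
  finally show ?thesis .
qed

text \<open>\<open>q\<close> is the least-norm solution of the linear equation that removes
  \<open>r\<close>; the Gram matrix is invertible by the lower bound on \<open>cgrad\<close>.
  Testing the normal equations with \<open>u\<close> bounds \<open>A *v u\<close> as a whole, which
  gives the gain \<open>1 / sigma_c P\<close> instead of one involving \<open>M_c P\<close>.\<close>

lemma correction_step:
  assumes z: "z \<in> U" and q: "q = - (cgrad c z *v (matrix_inv (transpose (cgrad c z) ** cgrad c z) *v r))"
  shows "transpose (cgrad c z) *v q = - r" and "norm q \<le> norm r / sigma_c P"
proof -
  define A where "A = cgrad c z"
  define u where "u = matrix_inv (transpose A ** A) *v r"
  have "inj ((*v) (transpose A ** A))"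
  proof (rule linear_injective_0[THEN iffD2], simp, intro allI impI)
    fix y assume "(transpose A ** A) *v y = 0"
    then have "y \<bullet> (transpose A *v (A *v y)) = 0"
      by (simp add: matrix_vector_mul_assoc)
    then have "norm (A *v y) = 0"
      by (metis inner_eq_zero_iff inner_matrix_transpose norm_zero transpose_transpose)
    then have "sigma_c P * norm y \<le> 0"
      using cgrad_lower[OF z, of y] by (simp add: A_def)
    then show "y = 0" using param_pos(5) by (simp add: mult_le_0_iff)
  qed
  then have "invertible (transpose A ** A)"
    by (simp add: matrix_left_invertible_injective invertible_left_inverse)
  then have "(transpose A ** A) *v u = r"
    by (simp add: u_def matrix_vector_mul_assoc mult_matrix_inv)
  then have r: "transpose A *v (A *v u) = r"
    by (simp add: matrix_vector_mul_assoc)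
  have q': "q = - (A *v u)"
    by (simp add: q A_def u_def)
  then show "transpose (cgrad c z) *v q = - r"
    using r by (simp add: A_def[symmetric] linear_neg[OF matrix_vector_mul_linear])
  have "norm (A *v u) * norm (A *v u) = u \<bullet> r"
    using r by (metis inner_matrix_transpose power2_eq_square power2_norm_eq_inner transpose_transpose)
  also have "\<dots> \<le> norm u * norm r"
    by (rule norm_cauchy_schwarz)
  also have "\<dots> \<le> norm (A *v u) / sigma_c P * norm r"
    using cgrad_lower[OF z, of u] by (intro mult_right_mono) (auto simp: A_def field_simps)
  finally show "norm q \<le> norm r / sigma_c P"
    by (cases "A *v u = 0") (auto simp: q' field_simps)
qed


section \<open>Good steps and their invariants\<close>

text \<open>Collects what the one-step estimates need besides the step equations. The factor 2 in
  the constraint bound is there because \<open>rho P\<close> times the new constraint value is a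
  difference of two multipliers of norm at most \<open>Lam P\<close>; together with \<open>l\<close>
  it gives the \<open>3 * Lam P\<close> of the primal bound.\<close>

definition good_step where
  "good_step v x l p x' l' \<longleftrightarrow>
     soc_step c P v x l p x' l' \<and> norm v \<le> G P \<and> norm l \<le> Lam P \<and> rho P * norm (c x) \<le> 2 * Lam P \<and>
     closed_segment x (x + p) \<subseteq> U \<and> closed_segment (x + p) x' \<subseteq> U"

lemma good_stepD:
  assumes "good_step v x l p x' l'"
  shows "x \<in> U" "x + p \<in> U" "x' \<in> U" "norm v \<le> G P" "norm l \<le> Lam P" "rho P * norm (c x) \<le> 2 * Lam P"
    "l' = l + rho P *\<^sub>R c x'"
    "beta P *\<^sub>R p + rho P *\<^sub>R (cgrad c x *v (transpose (cgrad c x) *v p))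
       = - v - cgrad c x *v (l + rho P *\<^sub>R c x)"
  using assms ends_in_segment by (auto simp: good_step_def soc_step_iff)

lemma soc_step_norm_p:
  assumes "soc_step c P v x l p x' l'" "x \<in> U" "norm v \<le> G P" "norm l \<le> Lam P" "rho P * norm (c x) \<le> 2 * Lam P"
  shows "norm p \<le> Delta P"
proof (rule primal_step_bound)
  have "norm (l + rho P *\<^sub>R c x) \<le> norm l + rho P * norm (c x)"
    using norm_triangle_ineq[of l "rho P *\<^sub>R c x"] by simp
  then show "norm (l + rho P *\<^sub>R c x) \<le> 3 * Lam P"
    using assms by linarith
qed (use assms in \<open>auto simp: soc_step_iff\<close>)

lemma good_step_norm_p:
  assumes "good_step v x l p x' l'" shows "norm p \<le> Delta P"
  using soc_step_norm_p good_stepD[OF assms] assms by (auto simp: good_step_def)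

text \<open>Asks only for the first segment to lie in \<open>U\<close>: the bound on
  \<open>q\<close> is what later places the second segment in \<open>U\<close>, so it cannot
  presuppose a good step.\<close>

lemma soc_step_correction:
  assumes step: "soc_step c P v x l p x' l'" and seg: "closed_segment x (x + p) \<subseteq> U"
  obtains q where "x' = x + p + q" "norm q \<le> kappa_q P * (norm p)\<^sup>2"
    "transpose (cgrad c (x + p)) *v q = - (c (x + p) - c x - transpose (cgrad c x) *v p)"
proof -
  define r where "r = c (x + p) - c x - transpose (cgrad c x) *v p"
  define q where "q = - (cgrad c (x + p) *v (matrix_inv (transpose (cgrad c (x + p)) ** cgrad c (x + p)) *v r))"
  have z: "x + p \<in> U" using seg by auto
  have "norm r \<le> L_c P / 2 * (norm p)\<^sup>2"
    using c_taylor[OF seg] by (simp add: r_def)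
  then have "norm r / sigma_c P \<le> L_c P / 2 * (norm p)\<^sup>2 / sigma_c P"
    by (intro divide_right_mono) auto
  also have "\<dots> = kappa_q P * (norm p)\<^sup>2"
    by (simp add: kappa_q_def)
  finally have "norm q \<le> kappa_q P * (norm p)\<^sup>2"
    using correction_step(2)[OF z q_def] by linarith
  moreover have "x' = x + p + q"
    using step by (simp add: soc_step_iff q_def r_def)
  ultimately show ?thesis
    using correction_step(1)[OF z q_def] that by (simp add: r_def)
qed

text \<open>The correction cancels the linearisation error with the Jacobian at
  \<open>x + p\<close>, so what remains is the Taylor remainder of \<open>c\<close> from
  \<open>x + p\<close> to \<open>x'\<close>. It is quadratic in \<open>q\<close>, which is quadratic
  in \<open>p\<close>; hence the fourth power, and \<open>kappa_d P\<close> equals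
  \<open>L_c P / 2 * (kappa_q P)^2\<close>.\<close>

lemma good_step_expansion:
  assumes step: "good_step v x l p x' l'"
  obtains q d where "x' = x + p + q" "norm q \<le> kappa_q P * (norm p)\<^sup>2"
    "c x' = c x + transpose (cgrad c x) *v p + d" "norm d \<le> kappa_d P * (norm p)^4"
proof -
  obtain q where q: "x' = x + p + q" "norm q \<le> kappa_q P * (norm p)\<^sup>2"
    "transpose (cgrad c (x + p)) *v q = - (c (x + p) - c x - transpose (cgrad c x) *v p)"
    using step soc_step_correction unfolding good_step_def by metis
  define d where "d = c x' - c x - transpose (cgrad c x) *v p"
  have "norm d = norm (c x' - c (x + p) - transpose (cgrad c (x + p)) *v (x' - (x + p)))"
    unfolding q(1) d_def using q(3) by (simp add: algebra_simps)
  also have "\<dots> \<le> L_c P / 2 * (norm (x' - (x + p)))\<^sup>2"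
    using step by (intro c_taylor) (auto simp: good_step_def)
  also have "\<dots> \<le> L_c P / 2 * (kappa_q P * (norm p)\<^sup>2)\<^sup>2"
    using q by (intro mult_left_mono power_mono) auto
  also have "\<dots> = kappa_d P * (norm p)^4"
    by (simp add: kappa_q_def kappa_d_def power2_eq_square power3_eq_cube power4_eq_xxxx)
  finally show ?thesis
    using q that[of q d] by (simp add: d_def)
qed

lemma good_step_displacement:
  assumes step: "good_step v x l p x' l'"
  shows "norm (x' - x) \<le> chi_cor P * norm p" "norm (x' - (x + p)) + norm p \<le> chi_cor P * norm p"
proof -
  obtain q where q: "x' = x + p + q" "norm q \<le> kappa_q P * (norm p)\<^sup>2"
    using good_step_expansion[OF step] by metis
  \<comment> \<open>Trading one factor \<open>norm p\<close> for \<open>Delta P\<close> makes the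
    correction linear in the step; this is the origin of \<open>chi_cor\<close>.\<close>
  have "norm q \<le> kappa_q P * (Delta P * norm p)"
    using good_step_norm_p[OF step]
    by (intro order_trans[OF q(2)] mult_left_mono) (auto simp: power2_eq_square mult_right_mono)
  then show 1: "norm (x' - (x + p)) + norm p \<le> chi_cor P * norm p"
    using q by (simp add: chi_cor_def algebra_simps del: mult_le_cancel_left)
  have "norm (x' - x) \<le> norm (x' - (x + p)) + norm p"
    using norm_triangle_ineq[of "x' - (x + p)" p] by simp
  with 1 show "norm (x' - x) \<le> chi_cor P * norm p" by linarith
qed

lemma good_step_dual_identity:
  assumes step: "good_step v x l p x' l'"
  obtains w where "cgrad c x *v l' = w - v - beta P *\<^sub>R p"
    "norm w \<le> rho P * M_c P * kappa_d P * (norm p)^4"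
proof -
  obtain d where d: "c x' = c x + transpose (cgrad c x) *v p + d" "norm d \<le> kappa_d P * (norm p)^4"
    using good_step_expansion[OF step] by metis
  note D = good_stepD[OF step]
  \<comment> \<open>Inserting the expansion of \<open>c x'\<close> into the multiplier update
    reproduces the penalised left side of the primal system, so that only \<open>d\<close> is left
    over.\<close>
  have "cgrad c x *v l' = rho P *\<^sub>R (cgrad c x *v d) - v - beta P *\<^sub>R p"
    using D(8) by (simp add: D(7) d(1) algebra_simps matrix_vector_right_distrib)
  moreover have "norm (rho P *\<^sub>R (cgrad c x *v d)) \<le> rho P * (M_c P * (kappa_d P * (norm p)^4))"
    using d(2) cgrad_upper[OF D(1), of d]
    by (auto intro!: mult_left_mono elim!: order_trans)
  ultimately show ?thesis
    using that by (simp add: mult.assoc)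
qed

lemma quartic_le:
  assumes "norm p \<le> Delta P"
  shows "rho P * M_c P * kappa_d P * (norm p)^4 \<le> (A_p P - beta P) * norm p"
proof -
  have "(norm p)^4 = (norm p)^3 * norm p" by (simp add: power4_eq_xxxx power3_eq_cube)
  also have "\<dots> \<le> (Delta P)^3 * norm p"
    using assms by (intro mult_right_mono power_mono) auto
  finally have "rho P * M_c P * kappa_d P * (norm p)^4 \<le> rho P * M_c P * kappa_d P * ((Delta P)^3 * norm p)"
    by (intro mult_left_mono) (auto intro!: mult_nonneg_nonneg)
  then show ?thesis by (simp add: A_p_def mult.assoc)
qed

text \<open>The lower bound on \<open>cgrad\<close> turns the dual identity into a bound on
  \<open>l'\<close>, and the first corrected inequality says that this bound is at most
  \<open>Lam P\<close>. No decrease of the objective enters, so both invariants pass from one good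
  step to the next.\<close>

lemma good_step_next_bounds:
  assumes step: "good_step v x l p x' l'"
  shows "norm l' \<le> Lam P" "rho P * norm (c x') \<le> 2 * Lam P"
proof -
  note D = good_stepD[OF step] and p = good_step_norm_p[OF step]
  obtain w where w: "cgrad c x *v l' = w - v - beta P *\<^sub>R p"
    "norm w \<le> rho P * M_c P * kappa_d P * (norm p)^4"
    using good_step_dual_identity[OF step] .
  have "norm (w - v - beta P *\<^sub>R p) \<le> norm w + norm v + beta P * norm p"
    by (smt (verit) norm_scaleR norm_triangle_ineq4 param_nonneg(6) abs_of_nonneg)
  also have "norm w \<le> rho P * M_c P * kappa_d P * (Delta P)^4"
    using p by (intro order_trans[OF w(2)] mult_left_mono power_mono) (auto intro!: mult_nonneg_nonneg)
  also have "beta P * norm p \<le> beta P * Delta P"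
    using p by (intro mult_left_mono) auto
  finally have "sigma_c P * norm l' \<le> G P + beta P * Delta P + rho P * M_c P * kappa_d P * (Delta P)^4"
    using cgrad_lower[OF D(1), of l'] D(4) w(1) by simp
  then have "norm l' \<le> (G P + beta P * Delta P + rho P * M_c P * kappa_d P * (Delta P)^4) / sigma_c P"
    by (simp add: field_simps)
  also have "\<dots> \<le> Lam P"
    using ineqs by (simp add: corrected_inequalities_def)
  finally show l': "norm l' \<le> Lam P" .
  have "rho P * norm (c x') = norm (l' - l)"
    by (simp add: D(7))
  also have "\<dots> \<le> 2 * Lam P"
    using norm_triangle_ineq4[of l' l] l' D(5) by linarith
  finally show "rho P * norm (c x') \<le> 2 * Lam P" .
qed

text \<open>The radius is \<open>Delta P + kappa_q P * (Delta P)^2\<close>, the greatest lengths of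
  \<open>p\<close> and \<open>q\<close> together. The first segment has to be placed in
  \<open>U\<close> before the bound on \<open>q\<close>, and with it the second segment, becomes
  available.\<close>

lemma good_step_ball:
  assumes step: "soc_step c P v x l p x' l'" and b: "norm v \<le> G P" "norm l \<le> Lam P" "rho P * norm (c x) \<le> 2 * Lam P"
    and ball: "cball x (chi_cor P * Delta P) \<subseteq> U"
  shows "good_step v x l p x' l'"
proof -
  have sub: "cball x (Delta P) \<subseteq> U"
    using ball chi_ge_1 by (meson mult_le_cancel_right1 order_trans param_nonneg(8) param_pos(8) subset_cball
        not_less)
  then have x: "x \<in> U" by auto
  have p: "norm p \<le> Delta P"
    using soc_step_norm_p step x b by blast
  have seg1: "closed_segment x (x + p) \<subseteq> cball x (Delta P)"
    using p by (intro closed_segment_subset) (auto simp: dist_norm)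
  with sub have seg1: "closed_segment x (x + p) \<subseteq> U" by blast
  obtain q where q: "x' = x + p + q" "norm q \<le> kappa_q P * (norm p)\<^sup>2"
    using soc_step_correction[OF step seg1] by metis
  have "norm q \<le> kappa_q P * (Delta P)\<^sup>2"
    using p by (intro order_trans[OF q(2)] mult_left_mono power_mono) auto
  then have pq: "norm p + norm q \<le> chi_cor P * Delta P"
    using p by (simp add: chi_cor_def algebra_simps power2_eq_square)
  have "closed_segment (x + p) x' \<subseteq> cball x (chi_cor P * Delta P)"
  proof (intro closed_segment_subset)
    have "norm p \<le> chi_cor P * Delta P"
      using pq norm_ge_zero[of q] by linarith
    then show "x + p \<in> cball x (chi_cor P * Delta P)"
      by (simp add: dist_norm)
    show "x' \<in> cball x (chi_cor P * Delta P)"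
      using pq norm_triangle_ineq[of p q] unfolding q(1) mem_cball
      by (metis add.assoc add_diff_cancel_left' dist_commute dist_norm order_trans)
  qed auto
  with seg1 b step ball show ?thesis
    by (auto simp: good_step_def)
qed

section \<open>Descent of the augmented Lagrangian\<close>

text \<open>With \<open>t = norm p\<close> the left side gathers all remainders in the expansion of
  the augmented Lagrangian: the curvature of \<open>f\<close> along both segments, its slope along
  \<open>q\<close>, and the effect of the constraint defect. Higher powers of \<open>t\<close> are
  traded for powers of \<open>Delta P\<close>, and the two curvature terms fit under
  \<open>(chi_cor P)^2\<close>.\<close>

lemma model_error_le:
  assumes "0 \<le> t" "t \<le> Delta P"
  shows "L_f P / 2 * t\<^sup>2 + G P * (kappa_q P * t\<^sup>2) + L_f P / 2 * (kappa_q P * t\<^sup>2)\<^sup>2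
    + (3 * Lam P + rho P * M_c P * Delta P) * (kappa_d P * t^4) + rho P / 2 * (kappa_d P * t^4)\<^sup>2
    \<le> 3 * beta P / 8 * t\<^sup>2"
proof -
  have t4: "t^4 \<le> (Delta P)\<^sup>2 * t\<^sup>2"
    using mult_right_mono[OF power_mono[OF assms(2,1), of 2] zero_le_power2[of t]]
    by (simp add: power_add[symmetric])
  have t8: "t^8 \<le> (Delta P)^6 * t\<^sup>2"
    using mult_right_mono[OF power_mono[OF assms(2,1), of 6] zero_le_power2[of t]]
    by (simp add: power_add[symmetric])
  have k: "0 \<le> kappa_q P" "0 \<le> kappa_d P"
    by (auto intro: less_imp_le)
  have "L_f P / 2 * t\<^sup>2 + L_f P / 2 * (kappa_q P * t\<^sup>2)\<^sup>2 \<le> L_f P / 2 * t\<^sup>2 + L_f P / 2 * (kappa_q P)\<^sup>2 *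
      ((Delta P)\<^sup>2 * t\<^sup>2)"
    using t4 mult_left_mono[OF t4, of "L_f P / 2 * (kappa_q P)\<^sup>2"]
    by (simp add: power_mult_distrib power_mult[symmetric] mult.assoc)
  also have "\<dots> \<le> L_f P / 2 * (chi_cor P)\<^sup>2 * t\<^sup>2"
  proof -
    have "1 + (kappa_q P)\<^sup>2 * (Delta P)\<^sup>2 \<le> (chi_cor P)\<^sup>2"
      using k by (simp add: chi_cor_def power2_sum power_mult_distrib)
    from mult_left_mono[OF this, of "L_f P / 2 * t\<^sup>2"] show ?thesis
      by (simp add: algebra_simps)
  qed
  finally have 1: "L_f P / 2 * t\<^sup>2 + L_f P / 2 * (kappa_q P * t\<^sup>2)\<^sup>2 \<le> L_f P / 2 * (chi_cor P)\<^sup>2 * t\<^sup>2" .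
  have 2: "(3 * Lam P + rho P * M_c P * Delta P) * (kappa_d P * t^4)
      \<le> kappa_d P * (Delta P)\<^sup>2 * (3 * Lam P + rho P * M_c P * Delta P) * t\<^sup>2"
    using mult_left_mono[OF t4, of "(3 * Lam P + rho P * M_c P * Delta P) * kappa_d P"] k
    by (simp add: mult_ac add_nonneg_nonneg)
  have 3: "rho P / 2 * (kappa_d P * t^4)\<^sup>2 \<le> rho P / 2 * (kappa_d P)\<^sup>2 * (Delta P)^6 * t\<^sup>2"
    using mult_left_mono[OF t8, of "rho P / 2 * (kappa_d P)\<^sup>2"]
    by (simp add: power_mult_distrib power_mult[symmetric] mult.assoc)
  have "C_mod P * t\<^sup>2 \<le> 3 * beta P / 8 * t\<^sup>2"
    using ineqs by (intro mult_right_mono) (auto simp: corrected_inequalities_def)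
  moreover have "C_mod P * t\<^sup>2 = G P * (kappa_q P * t\<^sup>2) + L_f P / 2 * (chi_cor P)\<^sup>2 * t\<^sup>2
      + kappa_d P * (Delta P)\<^sup>2 * (3 * Lam P + rho P * M_c P * Delta P) * t\<^sup>2
      + rho P / 2 * (kappa_d P)\<^sup>2 * (Delta P)^6 * t\<^sup>2"
    by (simp add: C_mod_def algebra_simps)
  ultimately show ?thesis
    using 1 2 3 by linarith
qed

abbreviation AL where "AL \<equiv> aug_lagrangian f c (rho P)"

text \<open>Pairing the primal system with \<open>p\<close> cancels the first-order terms up to the
  gradient error and leaves \<open>- beta P * (norm p)^2\<close> besides a penalty term of
  favourable sign. The remainders consume at most three eighths of it.\<close>

lemma good_step_descent:
  assumes step: "good_step v x l p x' l'"
  shows "AL x' l \<le> AL x l - 5 * beta P / 8 * (norm p)\<^sup>2 + norm (v - grad f x) * norm p"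
proof -
  note D = good_stepD[OF step] and p = good_step_norm_p[OF step]
  obtain q d where q: "x' = x + p + q" "norm q \<le> kappa_q P * (norm p)\<^sup>2"
    and d: "c x' = c x + transpose (cgrad c x) *v p + d" "norm d \<le> kappa_d P * (norm p)^4"
    using good_step_expansion[OF step] by metis
  define t where "t = transpose (cgrad c x) *v p"
  have "p \<bullet> (cgrad c x *v t) = (norm t)\<^sup>2"
    by (simp add: t_def inner_matrix_transpose power2_norm_eq_inner)
  moreover have "p \<bullet> (cgrad c x *v (l + rho P *\<^sub>R c x)) = t \<bullet> (l + rho P *\<^sub>R c x)"
    by (simp add: t_def inner_matrix_transpose)
  ultimately have opt: "beta P * (norm p)\<^sup>2 + rho P * (norm t)\<^sup>2 = - (p \<bullet> v) - t \<bullet> (l + rho P *\<^sub>R c x)"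
    using arg_cong[OF D(8), of "\<lambda>u. p \<bullet> u"]
    by (simp add: t_def[symmetric] inner_add_right inner_diff_right power2_norm_eq_inner)
  have AL: "AL x' l - AL x l = f x' - f x + (t \<bullet> (l + rho P *\<^sub>R c x) + rho P / 2 * (norm t)\<^sup>2)
      + (l + rho P *\<^sub>R c x + rho P *\<^sub>R t) \<bullet> d + rho P / 2 * (norm d)\<^sup>2"
    unfolding aug_lagrangian_def d(1) t_def[symmetric]
    by (simp add: power2_norm_eq_inner inner_add_left inner_add_right inner_commute algebra_simps)
  have fz: "f (x + p) - f x \<le> p \<bullet> grad f x + L_f P / 2 * (norm p)\<^sup>2"
    using abs_le_D1[OF f_taylor[of x "x + p"]] step by (auto simp: good_step_def)
  have "f x' - f (x + p) \<le> q \<bullet> grad f (x + p) + L_f P / 2 * (norm q)\<^sup>2"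
    using abs_le_D1[OF f_taylor[of "x + p" x']] step by (auto simp: good_step_def q(1))
  moreover have "q \<bullet> grad f (x + p) \<le> G P * norm q"
    using norm_cauchy_schwarz[of q "grad f (x + p)"] mult_left_mono[OF norm_grad_le[OF D(2)] norm_ge_zero[of q]]
    by (simp add: mult.commute)
  moreover have "G P * norm q \<le> G P * (kappa_q P * (norm p)\<^sup>2)"
    using q(2) by (intro mult_left_mono) auto
  moreover have "L_f P / 2 * (norm q)\<^sup>2 \<le> L_f P / 2 * (kappa_q P * (norm p)\<^sup>2)\<^sup>2"
    using q(2) by (intro mult_left_mono power_mono) auto
  ultimately have fx': "f x' - f (x + p) \<le> G P * (kappa_q P * (norm p)\<^sup>2) + L_f P / 2 * (kappa_q P * (norm p)\<^sup>2)\<^sup>2"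
    by linarith
  have "norm (l + rho P *\<^sub>R c x + rho P *\<^sub>R t) \<le> norm l + rho P * norm (c x) + rho P * norm t"
    using norm_triangle_ineq[of "l + rho P *\<^sub>R c x" "rho P *\<^sub>R t"] norm_triangle_ineq[of l "rho P *\<^sub>R c x"] by simp
  also have "norm t \<le> M_c P * Delta P"
    using cgrad_transpose_upper[OF D(1), of p] mult_left_mono[OF p param_nonneg(3)] unfolding t_def by linarith
  finally have lt: "norm (l + rho P *\<^sub>R c x + rho P *\<^sub>R t) \<le> 3 * Lam P + rho P * M_c P * Delta P"
    using D(5,6) by (simp add: mult_left_mono mult.assoc)
  have "(l + rho P *\<^sub>R c x + rho P *\<^sub>R t) \<bullet> d \<le> norm (l + rho P *\<^sub>R c x + rho P *\<^sub>R t) * norm d"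
    by (rule norm_cauchy_schwarz)
  also have "\<dots> \<le> (3 * Lam P + rho P * M_c P * Delta P) * (kappa_d P * (norm p)^4)"
    using lt d(2) by (intro mult_mono) (auto intro: order_trans[OF norm_ge_zero])
  finally have ld: "(l + rho P *\<^sub>R c x + rho P *\<^sub>R t) \<bullet> d \<le> (3 * Lam P + rho P * M_c P * Delta P) * (kappa_d P *
      (norm p)^4)" .
  have dd: "rho P / 2 * (norm d)\<^sup>2 \<le> rho P / 2 * (kappa_d P * (norm p)^4)\<^sup>2"
    using d(2) by (intro mult_left_mono power_mono) auto
  have pe: "p \<bullet> grad f x - p \<bullet> v \<le> norm (v - grad f x) * norm p"
    using norm_cauchy_schwarz[of p "grad f x - v"] by (simp add: inner_diff_right norm_minus_commute mult.commute)
  have tt: "0 \<le> rho P * (norm t)\<^sup>2" by simp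
  show ?thesis
    using AL fz fx' ld dd pe tt opt model_error_le[OF norm_ge_zero p] by linarith
qed

lemma good_step_dual_ascent:
  assumes step: "good_step v x l p x' l'"
  shows "AL x' l' = AL x' l + (norm (l' - l))\<^sup>2 / rho P"
  using good_stepD(7)[OF step] param_pos(7)
  by (simp add: aug_lagrangian_def inner_add_left power2_norm_eq_inner[symmetric] power2_eq_square[of "rho P * _"]
      power2_eq_square[of "norm _"])

section \<open>Stationarity residual and multiplier increments\<close>

text \<open>The dual identity uses data at \<open>x\<close>, the residual data at \<open>x'\<close>.
  Moving \<open>grad f\<close> and \<open>cgrad c\<close> to the new point costs
  \<open>(L_f P + L_c P * Lam P) * chi_cor P\<close> per unit of step length, which is the excess of
  \<open>B_p P\<close> over \<open>A_p P\<close>.\<close>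

lemma good_step_residual:
  assumes step: "good_step v x l p x' l'"
  shows "norm (kkt_residual x' l') \<le> B_p P * norm p + norm (v - grad f x)"
proof -
  note D = good_stepD[OF step] and p = good_step_norm_p[OF step]
  obtain w where w: "cgrad c x *v l' = w - v - beta P *\<^sub>R p"
    "norm w \<le> rho P * M_c P * kappa_d P * (norm p)^4"
    using good_step_dual_identity[OF step] .
  have l': "norm l' \<le> Lam P" by (rule good_step_next_bounds[OF step])
  have "kkt_residual x' l' = (grad f x' - grad f x) + (cgrad c x' *v l' - cgrad c x *v l')
      + (w - beta P *\<^sub>R p) + (grad f x - v)"
    by (simp add: w(1))
  also have "norm \<dots> \<le> norm (grad f x' - grad f x) + norm (cgrad c x' *v l' - cgrad c x *v l')
      + (norm w + beta P * norm p) + norm (v - grad f x)"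
    by (smt (verit) norm_scaleR norm_triangle_ineq norm_triangle_ineq4 norm_minus_commute param_nonneg(6)
        abs_of_nonneg)
  also have "norm (grad f x' - grad f x) \<le> L_f P * (chi_cor P * norm p)"
    using good_step_displacement(1)[OF step]
    by (intro order_trans[OF grad_lipschitz[OF D(3,1)]] mult_left_mono) auto
  also have "norm (cgrad c x' *v l' - cgrad c x *v l') \<le> L_c P * (chi_cor P * norm p) * Lam P"
    using good_step_displacement(1)[OF step] l'
    by (intro order_trans[OF cgrad_lipschitz[OF D(3,1)]] mult_mono mult_left_mono) (auto intro!: mult_nonneg_nonneg)
  also have "norm w \<le> (A_p P - beta P) * norm p"
    using w(2) quartic_le[OF p] by linarith
  finally show ?thesis
    by (simp add: B_p_def algebra_simps)
qed

text \<open>Two consecutive dual identities are subtracted at the base point \<open>x1\<close>,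
  where \<open>cgrad\<close> is bounded below. Only the older one has to be transported, from
  \<open>x0\<close> to \<open>x1\<close>, so the transport cost falls on \<open>p0\<close>, whose
  coefficient is \<open>B_p P\<close>, while \<open>p1\<close> keeps \<open>A_p P\<close>.\<close>

lemma good_step_increment:
  assumes step0: "good_step v0 x0 l0 p0 x1 l1" and step1: "good_step v1 x1 l1 p1 x2 l2"
  shows "sigma_c P * norm (l2 - l1)
    \<le> A_p P * norm p1 + B_p P * norm p0 + norm (v1 - grad f x1) + norm (v0 - grad f x0)"
proof -
  note D0 = good_stepD[OF step0] and p0 = good_step_norm_p[OF step0]
  note D1 = good_stepD[OF step1] and p1 = good_step_norm_p[OF step1]
  obtain w0 where w0: "cgrad c x0 *v l1 = w0 - v0 - beta P *\<^sub>R p0"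
    "norm w0 \<le> rho P * M_c P * kappa_d P * (norm p0)^4"
    using good_step_dual_identity[OF step0] .
  obtain w1 where w1: "cgrad c x1 *v l2 = w1 - v1 - beta P *\<^sub>R p1"
    "norm w1 \<le> rho P * M_c P * kappa_d P * (norm p1)^4"
    using good_step_dual_identity[OF step1] .
  have "cgrad c x1 *v (l2 - l1) = cgrad c x1 *v l2 - cgrad c x0 *v l1 - (cgrad c x1 *v l1 - cgrad c x0 *v l1)"
    by (simp add: matrix_vector_mult_diff_distrib)
  also have "\<dots> = (w1 - beta P *\<^sub>R p1) - (w0 - beta P *\<^sub>R p0) + (grad f x0 - grad f x1) + (grad f x1 - v1) -
      (grad f x0 - v0)
      - (cgrad c x1 *v l1 - cgrad c x0 *v l1)"
    by (simp add: w0(1) w1(1))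
  also have "norm \<dots> \<le> (norm w1 + beta P * norm p1) + (norm w0 + beta P * norm p0) + norm (grad f x1 - grad f x0)
      + norm (v1 - grad f x1) + norm (v0 - grad f x0) + norm (cgrad c x1 *v l1 - cgrad c x0 *v l1)"
    by (smt (verit) norm_scaleR norm_triangle_ineq norm_triangle_ineq4 norm_minus_commute param_nonneg(6)
        abs_of_nonneg)
  also have "norm (grad f x1 - grad f x0) \<le> L_f P * (chi_cor P * norm p0)"
    using good_step_displacement(1)[OF step0]
    by (intro order_trans[OF grad_lipschitz[OF D0(3,1)]] mult_left_mono) auto
  also have "norm (cgrad c x1 *v l1 - cgrad c x0 *v l1) \<le> L_c P * (chi_cor P * norm p0) * Lam P"
    using good_step_displacement(1)[OF step0] D1(5)
    by (intro order_trans[OF cgrad_lipschitz[OF D0(3,1)]] mult_mono mult_left_mono) (auto intro!: mult_nonneg_nonneg)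
  also have "norm w1 \<le> (A_p P - beta P) * norm p1"
    using w1(2) quartic_le[OF p1] by linarith
  also have "norm w0 \<le> (A_p P - beta P) * norm p0"
    using w0(2) quartic_le[OF p0] by linarith
  finally show ?thesis
    using cgrad_lower[OF D1(1), of "l2 - l1"]
    by (simp add: B_p_def algebra_simps)
qed

lemma good_step_increment_square:
  assumes step0: "good_step v0 x0 l0 p0 x1 l1" and step1: "good_step v1 x1 l1 p1 x2 l2"
  shows "(norm (l2 - l1))\<^sup>2 \<le> C_lambda_p P * ((norm p1)\<^sup>2 + (norm p0)\<^sup>2)
    + C_lambda_e P * ((norm (v1 - grad f x1))\<^sup>2 + (norm (v0 - grad f x0))\<^sup>2)"
proof -
  define a b e1 e0 where "a = A_p P * norm p1" and "b = B_p P * norm p0"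
    and "e1 = norm (v1 - grad f x1)" and "e0 = norm (v0 - grad f x0)"
  define m where "m = max ((A_p P)\<^sup>2) ((B_p P)\<^sup>2)"
  have "(sigma_c P * norm (l2 - l1))\<^sup>2 \<le> (a + b + e1 + e0)\<^sup>2"
    using good_step_increment[OF assms] by (intro power_mono) (auto simp: a_def b_def e1_def e0_def)
  also have "\<dots> \<le> 4 * (a\<^sup>2 + b\<^sup>2 + e1\<^sup>2 + e0\<^sup>2)"
  proof -
    \<comment> \<open>The six squared differences add up to four times the sum of squares minus the
      square of the sum.\<close>
    have "0 \<le> (a - b)\<^sup>2 + (a - e1)\<^sup>2 + (a - e0)\<^sup>2 + (b - e1)\<^sup>2 + (b - e0)\<^sup>2 + (e1 - e0)\<^sup>2" by simp
    then show ?thesis by (simp add: power2_eq_square algebra_simps)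
  qed
  also have "\<dots> \<le> 4 * (m * (norm p1)\<^sup>2 + m * (norm p0)\<^sup>2 + e1\<^sup>2 + e0\<^sup>2)"
    by (auto simp: a_def b_def m_def power_mult_distrib intro!: mult_right_mono add_mono)
  finally have "(norm (l2 - l1))\<^sup>2 \<le> 4 * (m * (norm p1)\<^sup>2 + m * (norm p0)\<^sup>2 + e1\<^sup>2 + e0\<^sup>2) / (sigma_c P)\<^sup>2"
    by (subst pos_le_divide_eq) (simp_all add: power_mult_distrib mult.commute)
  also have "\<dots> = C_lambda_p P * ((norm p1)\<^sup>2 + (norm p0)\<^sup>2) + C_lambda_e P * (e1\<^sup>2 + e0\<^sup>2)"
    by (simp add: C_lambda_p_def C_lambda_e_def m_def algebra_simps add_divide_distrib)
  finally show ?thesis by (simp add: e1_def e0_def)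
qed


section \<open>The potential along a run\<close>

lemma C_lambda_nonneg [simp]: "0 \<le> C_lambda_p P" "0 \<le> C_lambda_e P"
  by (auto simp: C_lambda_p_def C_lambda_e_def le_max_iff_disj)

lemma C_e_star_pos [simp]: "0 < C_e_star P"
  unfolding C_e_star_def by (intro add_pos_nonneg divide_pos_pos divide_nonneg_pos) auto

lemma C_e_star_nonneg [simp]: "0 \<le> C_e_star P"
  using C_e_star_pos by (rule less_imp_le)

lemma D1_pos [simp]: "0 < D1_const P"
  by (simp add: D1_const_def)

lemma C_lambda_p_over_rho: "C_lambda_p P / rho P \<le> beta P / 8"
  using ineqs by (simp add: corrected_inequalities_def field_simps)

text \<open>Completing the square in the size of the constraint. This is why
  \<open>(Lam P)^2 / (2 * rho P)\<close> separates \<open>H_det\<close> from \<open>Phi1_bar\<close>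
  and \<open>Phi_low\<close> from \<open>f_low\<close>.\<close>

lemma AL_ge: "norm l \<le> Lam P \<Longrightarrow> f x - (Lam P)\<^sup>2 / (2 * rho P) \<le> AL x l"
proof -
  assume l: "norm l \<le> Lam P"
  define t where "t = norm (c x)"
  have "0 \<le> (norm l - rho P * t)\<^sup>2 / (2 * rho P)" by simp
  also have "\<dots> = (norm l)\<^sup>2 / (2 * rho P) - norm l * t + rho P / 2 * t\<^sup>2"
    by (simp add: power2_diff add_divide_distrib diff_divide_distrib power_mult_distrib) (simp add: power2_eq_square)
  finally have "norm l * t \<le> (norm l)\<^sup>2 / (2 * rho P) + rho P / 2 * t\<^sup>2" by simp
  moreover have "- (norm l * t) \<le> l \<bullet> c x"
    using Cauchy_Schwarz_ineq2[of l "c x"] by (simp add: t_def abs_le_iff)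
  moreover have "(norm l)\<^sup>2 / (2 * rho P) \<le> (Lam P)\<^sup>2 / (2 * rho P)"
    using l by (intro divide_right_mono power_mono) auto
  ultimately show ?thesis
    by (simp add: aug_lagrangian_def t_def)
qed

definition good_run where
  "good_run n v x l p \<longleftrightarrow> (\<forall>k<n. good_step (v k) (x k) (l k) (p k) (x (Suc k)) (l (Suc k)))"

lemma good_runD: "good_run n v x l p \<Longrightarrow> k < n \<Longrightarrow> good_step (v k) (x k) (l k) (p k) (x (Suc k)) (l (Suc k))"
  by (simp add: good_run_def)

text \<open>Starts the telescoping: the first multiplier increment has no earlier step to be
  compared with, so everything is bounded a priori. The multiplier and penalty terms contribute
  \<open>2 * (Lam P)^2 / rho P\<close> each, hence the 4 in \<open>Phi1_bar\<close>.\<close>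

lemma AL_first:
  assumes step: "good_step v x l p x' l'"
  shows "AL x' l' + C_lambda_p P / rho P * (norm p)\<^sup>2 \<le> Phi1_bar f x P"
proof -
  note D = good_stepD[OF step] and p = good_step_norm_p[OF step]
  note l' = good_step_next_bounds[OF step]
  have "f (x + p) - f x \<le> G P * norm p"
    using abs_le_D1[OF f_lipschitz_segment[of x "x + p"]] step by (auto simp: good_step_def)
  moreover have "f x' - f (x + p) \<le> G P * norm (x' - (x + p))"
    using abs_le_D1[OF f_lipschitz_segment[of "x + p" x']] step by (auto simp: good_step_def)
  moreover have "G P * (norm (x' - (x + p)) + norm p) \<le> G P * (chi_cor P * Delta P)"
    using order_trans[OF good_step_displacement(2)[OF step] mult_left_mono[OF p kappa_chi_nonneg(3)]]
    by (intro mult_left_mono) auto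
  ultimately have fx': "f x' \<le> f x + G P * chi_cor P * Delta P"
    by (simp add: algebra_simps)
  define t where "t = rho P * norm (c x')"
  have t: "0 \<le> t" "t \<le> 2 * Lam P" using l'(2) by (auto simp: t_def)
  have c: "norm (c x') = t / rho P"
    using param_pos(7) by (simp add: t_def)
  have "l' \<bullet> c x' \<le> norm l' * norm (c x')" by (rule norm_cauchy_schwarz)
  also have "\<dots> \<le> Lam P * (2 * Lam P / rho P)"
    unfolding c using t l'(1) by (intro mult_mono divide_right_mono) auto
  finally have 1: "l' \<bullet> c x' \<le> 2 * (Lam P)\<^sup>2 / rho P"
    by (simp add: power2_eq_square mult_ac)
  have "rho P / 2 * (norm (c x'))\<^sup>2 = t\<^sup>2 / (2 * rho P)"
    unfolding c using param_pos(7) by (simp add: field_simps power2_eq_square)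
  also have "\<dots> \<le> (2 * Lam P)\<^sup>2 / (2 * rho P)"
    using t by (intro divide_right_mono power_mono) auto
  finally have 2: "rho P / 2 * (norm (c x'))\<^sup>2 \<le> 2 * (Lam P)\<^sup>2 / rho P"
    by (simp add: power_mult_distrib)
  have 3: "C_lambda_p P / rho P * (norm p)\<^sup>2 \<le> C_lambda_p P / rho P * (Delta P)\<^sup>2"
    using p by (intro mult_left_mono power_mono) auto
  show ?thesis
    using fx' 1 2 3 by (simp add: aug_lagrangian_def Phi1_bar_def)
qed

text \<open>Budget for the decrease of five eighths of \<open>beta P * (norm p1)^2\<close>: one
  eighth pays for the gradient error, one eighth for the share of \<open>p1\<close> in the
  multiplier increment, one eighth for the weight \<open>C_lambda_p P / rho P\<close> carried to the
  next step, and one quarter is kept. The share of \<open>p0\<close> is paid by the weight carried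
  from before.\<close>

lemma potential_step:
  assumes step0: "good_step v0 x0 l0 p0 x1 l1" and step1: "good_step v1 x1 l1 p1 x2 l2"
  shows "AL x2 l2 + C_lambda_p P / rho P * (norm p1)\<^sup>2 + beta P / 4 * (norm p1)\<^sup>2
    \<le> AL x1 l1 + C_lambda_p P / rho P * (norm p0)\<^sup>2
       + C_e_star P * ((norm (v1 - grad f x1))\<^sup>2 + (norm (v0 - grad f x0))\<^sup>2)"
proof -
  define r where "r = C_lambda_p P / rho P"
  define s where "s = C_lambda_e P / rho P"
  define e1 where "e1 = norm (v1 - grad f x1)"
  define e0 where "e0 = norm (v0 - grad f x0)"
  have "(norm (l2 - l1))\<^sup>2 / rho P \<le> (C_lambda_p P * ((norm p1)\<^sup>2 + (norm p0)\<^sup>2) + C_lambda_e P * (e1\<^sup>2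
      + e0\<^sup>2)) / rho P"
    using good_step_increment_square[OF assms] by (intro divide_right_mono) (auto simp: e1_def e0_def)
  also have "\<dots> = r * ((norm p1)\<^sup>2 + (norm p0)\<^sup>2) + s * (e1\<^sup>2 + e0\<^sup>2)"
    by (simp add: r_def s_def add_divide_distrib)
  finally have 1: "(norm (l2 - l1))\<^sup>2 / rho P \<le> r * (norm p1)\<^sup>2 + r * (norm p0)\<^sup>2 + s * e1\<^sup>2 + s * e0\<^sup>2"
    by (simp add: algebra_simps)
  have 2: "e1 * norm p1 \<le> beta P / 8 * (norm p1)\<^sup>2 + 2 / beta P * e1\<^sup>2"
  proof -
    have "0 \<le> beta P / 8 * (norm p1 - 4 * e1 / beta P)\<^sup>2" by simp
    also have "\<dots> = beta P / 8 * (norm p1)\<^sup>2 - e1 * norm p1 + 2 / beta P * e1\<^sup>2"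
      using param_pos(6) by (simp add: power2_diff field_simps power2_eq_square)
    finally show ?thesis by simp
  qed
  have 3: "r * (norm p1)\<^sup>2 \<le> beta P / 8 * (norm p1)\<^sup>2"
    using C_lambda_p_over_rho by (intro mult_right_mono) (auto simp: r_def)
  have 4: "C_e_star P * (e1\<^sup>2 + e0\<^sup>2) = 2 / beta P * e1\<^sup>2 + 2 / beta P * e0\<^sup>2 + s * e1\<^sup>2 + s * e0\<^sup>2"
    by (simp add: C_e_star_def s_def algebra_simps)
  have 5: "0 \<le> 2 / beta P * e0\<^sup>2" by simp
  show ?thesis
    using good_step_descent[OF step1] good_step_dual_ascent[OF step1] 1 2 3 4 5
    unfolding r_def[symmetric] e1_def[symmetric] e0_def[symmetric] by linarith
qed

text \<open>An error is charged in its own step and again as the previous error of the next step,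
  hence the factor 2. The last error has been charged only once, and subtracting it makes the
  induction close exactly.\<close>

lemma good_run_potential:
  assumes "good_run (Suc n) v x l p"
  shows "AL (x (Suc n)) (l (Suc n)) + C_lambda_p P / rho P * (norm (p n))\<^sup>2 + beta P / 4 * (\<Sum>k=1..n. (norm (p k))\<^sup>2)
    \<le> Phi1_bar f (x 0) P + 2 * C_e_star P * (\<Sum>k\<le>n. (norm (v k - grad f (x k)))\<^sup>2)
      - C_e_star P * (norm (v n - grad f (x n)))\<^sup>2"
  using assms
proof (induction n)
  case 0
  then show ?case
    using AL_first[OF good_runD[OF 0, of 0]] by (simp add: add_increasing)
next
  case (Suc n)
  then have "good_run (Suc n) v x l p" by (simp add: good_run_def)
  from Suc.IH[OF this] potential_step[OF good_runD[OF Suc.prems, of n] good_runD[OF Suc.prems, of "Suc n"]]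
  show ?case by (simp add: algebra_simps)
qed

text \<open>Serves to confine the iterates: without errors the right side is the level in
  \<open>S_det\<close>; with errors, leaving a higher level set forces the accumulated error to be
  large.\<close>

lemma good_run_f_le:
  assumes run: "good_run n v x l p" and n: "0 < n"
  shows "f (x n) \<le> H_det f (x 0) P + 2 * C_e_star P * (\<Sum>k<n. (norm (v k - grad f (x k)))\<^sup>2)"
proof -
  obtain m where m: "n = Suc m" using n by (cases n) auto
  have "0 \<le> C_lambda_p P / rho P * (norm (p m))\<^sup>2" by simp
  moreover have "0 \<le> beta P / 4 * (\<Sum>k=1..m. (norm (p k))\<^sup>2)" by (simp add: sum_nonneg)
  moreover have "0 \<le> C_e_star P * (norm (v m - grad f (x m)))\<^sup>2" by simp
  moreover have "norm (l n) \<le> Lam P"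
    using good_step_next_bounds(1)[OF good_runD[OF run, of m]] by (simp add: m)
  note AL_ge[OF this, of "x n"]
  ultimately show ?thesis
    using good_run_potential[OF run[unfolded m]] unfolding H_det_def m lessThan_Suc_atMost by linarith
qed

text \<open>The potential is compared with its lower bound \<open>Phi_low\<close>. The telescoped
  sum starts at index 1, so the initial squared step is added separately and accounts for
  \<open>(Delta P)^2\<close> in \<open>D0_const\<close>.\<close>

lemma good_run_sum_le:
  assumes run: "good_run n v x l p" and n: "0 < n"
  shows "(\<Sum>k<n. (norm (p k))\<^sup>2) \<le> D0_const f (x 0) P + D1_const P * (\<Sum>k<n. (norm (v k - grad f (x k)))\<^sup>2)"
proof -
  obtain m where m: "n = Suc m" using n by (cases n) auto
  define S where "S = (\<Sum>k<n. (norm (v k - grad f (x k)))\<^sup>2)"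
  define T where "T = (\<Sum>k=1..m. (norm (p k))\<^sup>2)"
  have "0 \<le> C_lambda_p P / rho P * (norm (p m))\<^sup>2" by simp
  moreover have "0 \<le> C_e_star P * (norm (v m - grad f (x m)))\<^sup>2" by simp
  moreover have "norm (l n) \<le> Lam P"
    using good_step_next_bounds(1)[OF good_runD[OF run, of m]] by (simp add: m)
  moreover have "f_low P \<le> f (x n)"
    using good_stepD(3)[OF good_runD[OF run, of m]] by (intro f_low_le) (simp add: m)
  ultimately have "beta P / 4 * T \<le> Phi1_bar f (x 0) P - Phi_low P + 2 * C_e_star P * S"
    using AL_ge[of "l n" "x n"] good_run_potential[OF run[unfolded m]]
    unfolding Phi_low_def m lessThan_Suc_atMost S_def T_def by linarith
  from mult_left_mono[OF this, of "4 / beta P"]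
  have "T \<le> 4 * (Phi1_bar f (x 0) P - Phi_low P) / beta P + D1_const P * S"
    using param_pos(6) by (simp add: D1_const_def algebra_simps add_divide_distrib diff_divide_distrib)
  moreover have "(norm (p 0))\<^sup>2 \<le> (Delta P)\<^sup>2"
    using good_step_norm_p[OF good_runD[OF run n]] by (intro power_mono) auto
  moreover have "(\<Sum>k<n. (norm (p k))\<^sup>2) = (norm (p 0))\<^sup>2 + T"
    by (simp add: m lessThan_Suc_atMost T_def atMost_atLeast0 sum.atLeast_Suc_atMost)
  ultimately show ?thesis
    unfolding D0_const_def S_def by linarith
qed

text \<open>\<open>rho P\<close> times the new constraint value is a multiplier increment, so
  feasibility is controlled by two consecutive steps and errors.\<close>

lemma good_run_constraint:
  assumes run: "good_run n v x l p" and k: "Suc k < n"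
  shows "(norm (c (x (Suc (Suc k)))))\<^sup>2 \<le> C_lambda_p P / (rho P)\<^sup>2 * ((norm (p (Suc k)))\<^sup>2 + (norm (p k))\<^sup>2)
    + C_lambda_e P / (rho P)\<^sup>2 * ((norm (v (Suc k) - grad f (x (Suc k))))\<^sup>2 + (norm (v k - grad f (x k)))\<^sup>2)"
proof -
  note s0 = good_runD[OF run Suc_lessD[OF k]] and s1 = good_runD[OF run k]
  have "(rho P)\<^sup>2 * (norm (c (x (Suc (Suc k)))))\<^sup>2 = (norm (l (Suc (Suc k)) - l (Suc k)))\<^sup>2"
    by (simp add: good_stepD(7)[OF s1] power_mult_distrib)
  also note good_step_increment_square[OF s0 s1]
  finally have "(norm (c (x (Suc (Suc k)))))\<^sup>2 \<le> (C_lambda_p P * ((norm (p (Suc k)))\<^sup>2 + (norm (p k))\<^sup>2)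
    + C_lambda_e P * ((norm (v (Suc k) - grad f (x (Suc k))))\<^sup>2 + (norm (v k - grad f (x k)))\<^sup>2)) / (rho P)\<^sup>2"
    by (subst pos_le_divide_eq) (simp_all add: mult.commute)
  then show ?thesis by (simp add: add_divide_distrib)
qed

end

section \<open>The deterministic method\<close>

lemma cball_subset_nbhd: "x \<in> S \<Longrightarrow> cball x r \<subseteq> nbhd r S"
  by (auto simp: nbhd_def dist_commute intro: infdist_le2)

section \<open>Tools for the Kurdyka-Lojasiewicz argument\<close>

text \<open>The unbalanced weights are deliberate: \<open>X\<close> will be a sum of two consecutive
  step lengths, so a quarter of each leaves total weight one half after summation, which the left
  side can absorb.\<close>

lemma AM_GM_quarter:
  fixes a X Y :: real
  assumes "0 \<le> a" "0 \<le> X" "0 \<le> Y" "a\<^sup>2 \<le> X * Y"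
  shows "a \<le> X / 4 + Y"
proof (rule power2_le_imp_le)
  have "0 \<le> (X / 4 - Y)\<^sup>2" by simp
  then have "X * Y \<le> (X / 4 + Y)\<^sup>2" by (simp add: power2_eq_square algebra_simps)
  with assms show "a\<^sup>2 \<le> (X / 4 + Y)\<^sup>2" by linarith
qed (use assms in auto)

lemma concave_on_below_tangent:
  fixes \<phi> :: "real \<Rightarrow> real"
  assumes "concave_on {0..<\<eta>} \<phi>" "\<phi> differentiable (at s)" "0 < s" "s < \<eta>" "0 \<le> t" "t < \<eta>"
  shows "deriv \<phi> s * (s - t) \<le> \<phi> s - \<phi> t"
proof -
  have "(\<phi> has_real_derivative deriv \<phi> s) (at s)"
    using assms(2) by (simp add: DERIV_deriv_iff_real_differentiable)
  then have "((\<lambda>x. - \<phi> x) has_real_derivative - deriv \<phi> s) (at s within {0..<\<eta>})"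
    by (rule DERIV_minus[OF has_field_derivative_at_within])
  then have "- \<phi> t - - \<phi> s \<ge> - deriv \<phi> s * (t - s)"
    using assms by (intro convex_on_imp_above_tangent[of "{0..<\<eta>}"])
      (auto simp: concave_on_def interior_atLeastLessThan)
  then show ?thesis by (simp add: algebra_simps)
qed

text \<open>The trajectory is trapped near a single cluster point: once it is close enough to that point,
  summing the Kurdyka-Lojasiewicz inequality bounds the length of the rest by the distance still available.\<close>

lemma KL_finite_length:
  fixes u :: "nat \<Rightarrow> 'a::euclidean_space" and E :: "'a \<Rightarrow> real" and a :: "nat \<Rightarrow> real"
  assumes a: "\<And>k. 0 \<le> a k" and \<alpha>: "0 < \<alpha>" and Cg: "0 \<le> Cg" and Cm: "0 \<le> Cm"
    and descent: "\<And>k. E (u (Suc k)) \<le> E (u k) - \<alpha> * (a (Suc k))\<^sup>2"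
    and gradient: "\<And>k. norm (grad E (u (Suc k))) \<le> Cg * (a (Suc k) + a k)"
    and move: "\<And>k. dist (u (Suc k)) (u k) \<le> Cm * (a (Suc k) + a k)"
    and KL: "KL_property D E ub"
    and r: "strict_mono r" "(u \<circ> r) \<longlonglongrightarrow> ub" and E_lim: "(\<lambda>n. E (u (r n))) \<longlonglongrightarrow> E ub"
  shows "summable a"
proof -
  define s where "s k = E (u k) - E ub" for k
  have "decseq (\<lambda>k. E (u k))"
    using descent \<alpha> by (intro decseq_SucI) (smt (verit) mult_nonneg_nonneg zero_le_power2)
  then have dec: "decseq s" by (auto simp: s_def decseq_def)
  have s_lim_r: "(\<lambda>n. s (r n)) \<longlonglongrightarrow> 0"
    using tendsto_diff[OF E_lim tendsto_const[of "E ub"]] by (simp add: s_def)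
  have s_nonneg: "0 \<le> s k" for k
  proof (rule tendsto_le[OF _ tendsto_const s_lim_r])
    show "\<forall>\<^sub>F n in sequentially. s (r n) \<le> s k"
      using eventually_ge_at_top[of k]
      by eventually_elim (meson dec decseqD order_trans seq_suble r(1))
  qed simp
  have s_lim: "s \<longlonglongrightarrow> 0"
  proof -
    obtain L where L: "s \<longlonglongrightarrow> L"
      using decseq_convergent[OF dec, of 0] s_nonneg by metis
    then have "(s \<circ> r) \<longlonglongrightarrow> L" using r(1) by (rule LIMSEQ_subseq_LIMSEQ)
    then show ?thesis using s_lim_r L LIMSEQ_unique by (fastforce simp: o_def)
  qed
  have a_lim: "a \<longlonglongrightarrow> 0"
  proof -
    have "(\<lambda>k. (s k - s (Suc k)) / \<alpha>) \<longlonglongrightarrow> (0 - 0) / \<alpha>"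
      using s_lim \<alpha> by (intro tendsto_intros LIMSEQ_Suc) auto
    moreover have "\<forall>\<^sub>F k in sequentially. (a (Suc k))\<^sup>2 \<le> (s k - s (Suc k)) / \<alpha>"
      using descent \<alpha> by (auto simp: s_def pos_le_divide_eq algebra_simps)
    ultimately have "(\<lambda>k. (a (Suc k))\<^sup>2) \<longlonglongrightarrow> 0"
      by (intro tendsto_sandwich[of "\<lambda>_. 0" "\<lambda>k. (a (Suc k))\<^sup>2"]) auto
    then have "(\<lambda>k. sqrt ((a (Suc k))\<^sup>2)) \<longlonglongrightarrow> sqrt 0"
      by (rule tendsto_real_sqrt)
    then show ?thesis using a by (simp add: filterlim_sequentially_Suc)
  qed
  from KL obtain V \<eta> \<phi> where V: "ub \<in> interior V" and \<eta>: "0 < \<eta>"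
    and \<phi>: "continuous_on {0..<\<eta>} \<phi>" "concave_on {0..<\<eta>} \<phi>" "\<And>t. t \<in> {0..<\<eta>} \<Longrightarrow> 0 \<le> \<phi> t" "\<phi> 0 = 0"
      "\<And>t. t \<in> {0<..<\<eta>} \<Longrightarrow> \<phi> differentiable (at t)" "\<And>t. t \<in> {0<..<\<eta>} \<Longrightarrow> 0 < deriv \<phi> t"
      and ineq: "\<And>z. z \<in> V \<Longrightarrow> 0 < E z - E ub \<Longrightarrow> E z - E ub < \<eta> \<Longrightarrow> 1 \<le> deriv \<phi> (E z - E ub) * norm (grad E z)"
    unfolding KL_property_def by blast
  obtain R where R: "0 < R" "ball ub R \<subseteq> V"
    using V by (auto simp: mem_interior)
  have s_ev: "\<forall>\<^sub>F k in sequentially. s k < \<eta>"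
    using s_lim \<eta> by (rule order_tendstoD(2))
  have \<phi>_lim: "(\<lambda>k. \<phi> (s k)) \<longlonglongrightarrow> 0"
    using continuous_on_tendsto_compose[OF \<phi>(1) s_lim] \<eta> \<phi>(4) s_nonneg s_ev by simp
  define K where "K = Cg / \<alpha>"
  have K: "0 \<le> K" using Cg \<alpha> by (simp add: K_def)
  \<comment> \<open>\<open>\<tau> m\<close> will bound the sum of the step lengths beyond
    \<open>Suc m\<close> while the trajectory stays in the ball; it tends to zero because the steps
    and the values of \<open>\<phi>\<close> do.\<close>
  define \<tau> where "\<tau> m = a (Suc m) + a m + 2 * K * \<phi> (s (Suc m))" for m
  have "(\<lambda>m. a (Suc m) + a m + 2 * K * \<phi> (s (Suc m))) \<longlonglongrightarrow> 0 + 0 + 2 * K * 0"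
    by (rule tendsto_add[OF tendsto_add[OF LIMSEQ_Suc[OF a_lim] a_lim] tendsto_mult[OF tendsto_const
        LIMSEQ_Suc[OF \<phi>_lim]]])
  then have "\<tau> \<longlonglongrightarrow> 0" by (simp add: \<tau>_def[abs_def])
  then have "(\<lambda>m. 3 * Cm * \<tau> m) \<longlonglongrightarrow> 3 * Cm * 0"
    by (rule tendsto_mult[OF tendsto_const])
  then have "\<forall>\<^sub>F m in sequentially. 3 * Cm * \<tau> m < R / 2"
    using R(1) by (intro order_tendstoD(2)) auto
  then have "\<forall>\<^sub>F m in sequentially. 3 * Cm * \<tau> m < R / 2 \<and> s m < \<eta>"
    using s_ev by eventually_elim auto
  then obtain N where N: "\<And>m. N \<le> m \<Longrightarrow> 3 * Cm * \<tau> m < R / 2 \<and> s m < \<eta>"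
    by (auto simp: eventually_sequentially)
  have "\<forall>\<^sub>F n in sequentially. dist (u (r n)) ub < R / 2"
    using tendstoD[OF r(2), of "R / 2"] R(1) by (simp add: o_def)
  then obtain n where n: "Suc N \<le> n" "dist (u (r n)) ub < R / 2"
    using eventually_happens'[OF sequentially_bot eventually_conj[OF _ eventually_ge_at_top[of "Suc N"]]] by blast
  \<comment> \<open>The starting index has to be a successor, since the gradient bound at an index
    involves the preceding step length.\<close>
  have "Suc N \<le> r n" using n(1) seq_suble[OF r(1), of n] by linarith
  then obtain m where m: "r n = Suc m" "N \<le> m" by (cases "r n") auto
  define b where "b j = a (m + j)" for j
  define w where "w j = u (Suc m + j)" for j
  define \<psi> where "\<psi> j = \<phi> (s (Suc m + j))" for j
  have b: "0 \<le> b j" for j using a by (simp add: b_def)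
  have s\<eta>: "s (Suc m + j) < \<eta>" for j using N[of "Suc m + j"] m(2) by simp
  have \<psi>: "0 \<le> \<psi> j" for j using \<phi>(3) s_nonneg s\<eta> by (simp add: \<psi>_def)
  have key: "b (Suc (Suc j)) \<le> (b (Suc j) + b j) / 4 + K * (\<psi> j - \<psi> (Suc j))" if "w j \<in> ball ub R" for j
  \<comment> \<open>On the limiting level the Kurdyka-Lojasiewicz inequality is silent, but there no
    further decrease is possible and the descent condition makes the steps vanish.\<close>
  proof (cases "s (Suc m + j) = 0")
    case True
    then have s': "s (Suc (Suc m + j)) = 0"
      using s_nonneg[of "Suc (Suc m + j)"] decseqD[OF dec, of "Suc m + j" "Suc (Suc m + j)"] by simp
    have "\<alpha> * (a (Suc (Suc m + j)))\<^sup>2 \<le> 0"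
      using descent[of "Suc m + j"] True s' by (simp add: s_def)
    then have "a (Suc (Suc m + j)) = 0" using \<alpha> by (simp add: mult_le_0_iff)
    then show ?thesis using True s' b[of j] b[of "Suc j"] by (simp add: b_def \<psi>_def)
  next
    case False
    then have sj: "0 < s (Suc m + j)" using s_nonneg[of "Suc m + j"] by simp
    define d where "d = deriv \<phi> (s (Suc m + j))"
    have d: "0 < d" using \<phi>(6) sj s\<eta> by (simp add: d_def)
    have tangent: "d * (s (Suc m + j) - s (Suc (Suc m + j))) \<le> \<psi> j - \<psi> (Suc j)"
      using concave_on_below_tangent[OF \<phi>(2) \<phi>(5) sj s\<eta> s_nonneg[of "Suc (Suc m + j)"]] sj s\<eta>[of j] s\<eta>[of "Suc j"]
      by (simp add: d_def \<psi>_def)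
    have "1 \<le> d * norm (grad E (w j))"
      using ineq[of "w j"] that R(2) sj s\<eta>[of j] by (auto simp: d_def w_def s_def)
    also have "norm (grad E (w j)) \<le> Cg * (b (Suc j) + b j)"
      using gradient[of "m + j"] by (simp add: w_def b_def)
    finally have 1: "1 \<le> d * (Cg * (b (Suc j) + b j))" using d by simp
    have "\<alpha> * (b (Suc (Suc j)))\<^sup>2 \<le> s (Suc m + j) - s (Suc (Suc m + j))"
      using descent[of "Suc m + j"] by (simp add: s_def b_def)
    then have 2: "(b (Suc (Suc j)))\<^sup>2 \<le> (s (Suc m + j) - s (Suc (Suc m + j))) / \<alpha>"
      using \<alpha> by (simp add: field_simps)
    have "0 \<le> s (Suc m + j) - s (Suc (Suc m + j))"
      using decseqD[OF dec, of "Suc m + j" "Suc (Suc m + j)"] by simp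
    then have \<Delta>: "0 \<le> \<psi> j - \<psi> (Suc j)"
      using tangent d by (smt (verit) mult_nonneg_nonneg)
    have "(s (Suc m + j) - s (Suc (Suc m + j))) / \<alpha> * 1
        \<le> (s (Suc m + j) - s (Suc (Suc m + j))) / \<alpha> * (d * (Cg * (b (Suc j) + b j)))"
      using 1 \<open>0 \<le> s (Suc m + j) - s (Suc (Suc m + j))\<close> \<alpha> by (intro mult_left_mono) auto
    also have "\<dots> = (d * (s (Suc m + j) - s (Suc (Suc m + j)))) * (K * (b (Suc j) + b j))"
      by (simp add: K_def)
    also have "\<dots> \<le> (\<psi> j - \<psi> (Suc j)) * (K * (b (Suc j) + b j))"
      using tangent K b by (intro mult_right_mono) auto
    finally have "(b (Suc (Suc j)))\<^sup>2 \<le> (b (Suc j) + b j) * (K * (\<psi> j - \<psi> (Suc j)))"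
      using 2 by (simp add: mult_ac)
    then show ?thesis
      using \<Delta> K b by (intro AM_GM_quarter) auto
  qed
  have sum_bound: "(\<Sum>j<n. b (Suc (Suc j))) \<le> \<tau> m" if "\<forall>j<n. w j \<in> ball ub R" for n
  proof -
    define S where "S = (\<Sum>j<n. b (Suc (Suc j)))"
    have "(\<Sum>j<n. b (Suc j)) \<le> (\<Sum>j<Suc n. b (Suc j))" using b by simp
    also have "\<dots> = b 1 + S" unfolding S_def sum.lessThan_Suc_shift by simp
    finally have 1: "(\<Sum>j<n. b (Suc j)) \<le> b 1 + S" .
    have "(\<Sum>j<n. b j) \<le> (\<Sum>j<Suc n. b j)" using b by simp
    also have "\<dots> = b 0 + (\<Sum>j<n. b (Suc j))" unfolding sum.lessThan_Suc_shift by simp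
    finally have 2: "(\<Sum>j<n. b j) \<le> b 0 + b 1 + S" using 1 by linarith
    have "S \<le> (\<Sum>j<n. (b (Suc j) + b j) / 4 + K * (\<psi> j - \<psi> (Suc j)))"
      unfolding S_def using key that by (intro sum_mono) auto
    also have "\<dots> = ((\<Sum>j<n. b (Suc j)) + (\<Sum>j<n. b j)) / 4 + K * (\<psi> 0 - \<psi> n)"
      by (simp add: sum.distrib sum_divide_distrib[symmetric] sum_distrib_left[symmetric] sum_lessThan_telescope')
    also have "\<dots> \<le> (b 1 + S + (b 0 + b 1 + S)) / 4 + K * \<psi> 0"
      using 1 2 mult_left_mono[OF _ K, of "\<psi> 0 - \<psi> n" "\<psi> 0"] \<psi>[of n] by (intro add_mono) auto
    \<comment> \<open>The occurrences of \<open>S\<close> on the right have total weight one half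
      and move to the left.\<close>
    finally have "S \<le> b 1 + b 0 / 2 + 2 * (K * \<psi> 0)" by (simp add: field_simps)
    then show ?thesis using b[of 0] by (simp add: S_def \<tau>_def b_def \<psi>_def)
  qed
  \<comment> \<open>The sum up to \<open>n\<close> needs only \<open>w 0, ..., w n\<close> in the
    ball and controls the position of the next point. The factor 3 in the choice of \<open>N\<close>
    covers the two shifted sums of step lengths produced by \<open>move\<close>.\<close>
  have inball: "\<forall>j\<le>n. w j \<in> ball ub R" for n
  proof (induction n)
    case 0
    show ?case using n(2) m(1) R(1) by (simp add: w_def dist_commute)
  next
    case (Suc n)
    then have S: "(\<Sum>j<Suc n. b (Suc (Suc j))) \<le> \<tau> m"
      by (intro sum_bound) auto
    have "dist (w (Suc n)) (w 0) \<le> (\<Sum>j<Suc n. dist (w (Suc j)) (w j))" for n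
    proof (induction n)
      case (Suc n)
      then show ?case
        using dist_triangle[of "w (Suc (Suc n))" "w 0" "w (Suc n)"] unfolding sum.lessThan_Suc by linarith
    qed simp
    then have "dist (w (Suc n)) (w 0) \<le> (\<Sum>j<Suc n. dist (w (Suc j)) (w j))" .
    also have "(\<Sum>j<Suc n. dist (w (Suc j)) (w j)) \<le> (\<Sum>j<Suc n. Cm * (b (Suc (Suc j)) + b (Suc j)))"
      using move[of "Suc m + j" for j] by (intro sum_mono) (simp add: w_def b_def)
    also have "\<dots> = Cm * ((\<Sum>j<Suc n. b (Suc (Suc j))) + (\<Sum>j<Suc n. b (Suc j)))"
      by (simp only: sum_distrib_left[symmetric] sum.distrib)
    also have "\<dots> \<le> Cm * (3 * \<tau> m)"
    proof (intro mult_left_mono)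
      have "(\<Sum>j<Suc n. b (Suc j)) \<le> b 1 + (\<Sum>j<Suc n. b (Suc (Suc j)))"
        using sum.lessThan_Suc_shift[of "\<lambda>j. b (Suc j)" "Suc n"] b[of "Suc (Suc n)"]
        unfolding One_nat_def sum.lessThan_Suc[of _ "Suc n"] by linarith
      moreover have "b 1 \<le> \<tau> m"
        using a K \<psi>[of 0] by (simp add: \<tau>_def b_def \<psi>_def)
      ultimately show "(\<Sum>j<Suc n. b (Suc (Suc j))) + (\<Sum>j<Suc n. b (Suc j)) \<le> 3 * \<tau> m"
        using S by linarith
    qed (rule Cm)
    finally have "dist (w (Suc n)) (w 0) < R / 2"
      using N[OF m(2)] by linarith
    moreover have "dist (w 0) ub < R / 2" using n(2) m(1) by (simp add: w_def)
    ultimately have "dist (w (Suc n)) ub < R"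
      using dist_triangle[of "w (Suc n)" ub "w 0"] by linarith
    with Suc show ?case by (auto simp: le_Suc_eq dist_commute)
  qed
  have "summable (\<lambda>j. b (Suc (Suc j)))"
  proof (rule summableI_nonneg_bounded)
    show "(\<Sum>j<n. b (Suc (Suc j))) \<le> \<tau> m" for n
      using inball[of n] by (intro sum_bound) auto
  qed (use b in auto)
  then have "summable (\<lambda>j. a (j + (m + 2)))" by (simp add: b_def add.commute)
  then show ?thesis by (simp only: summable_iff_shift)
qed


lemma exists_term_le_average:
  fixes g :: "nat \<Rightarrow> real"
  assumes "0 < m" "(\<Sum>j<m. g j) \<le> T"
  obtains j where "j < m" "real m * g j \<le> T"
proof -
  have "\<exists>j<m. real m * g j \<le> T"
  proof (rule ccontr)
    assume "\<not> ?thesis"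
    then have "(\<Sum>j<m. T / real m) < (\<Sum>j<m. g j)"
      using assms(1) by (intro sum_strict_mono) (auto simp: field_simps not_le)
    then show False using assms by simp
  qed
  then show ?thesis using that by blast
qed

section \<open>Confinement of the deterministic run and the best-iterate rate\<close>

context lalm
begin

abbreviation det_init where
  "det_init x0 l0 \<equiv> norm l0 \<le> Lam P \<and> rho P * norm (c x0) \<le> Lam P \<and>
     nbhd (chi_cor P * Delta P) (S_det f c x0 P) \<subseteq> U"

lemma x0_in_S_det:
  assumes "rho P * norm (c x0) \<le> Lam P"
  shows "x0 \<in> S_det f c x0 P"
proof -
  have "rho P * norm (c x0) \<le> 2 * Lam P"
    using assms param_pos(9) by linarith
  then have "norm (c x0) \<le> 2 * Lam P / rho P"
    using param_pos(7) by (subst pos_le_divide_eq) (simp_all add: mult.commute)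
  then show ?thesis
    by (auto simp: S_det_def H_det_def Phi1_bar_def intro!: add_nonneg_nonneg mult_nonneg_nonneg)
qed

text \<open>Membership of \<open>x n\<close> in the level set puts a whole ball into
  \<open>U\<close>, so the step is good; then descent bounds the objective and the multiplier
  increment bounds the constraint, which returns membership of the next iterate. The entire past run
  is carried along because the descent is cumulative.\<close>

lemma det_run_good:
  assumes run: "det_run f c P x0 l0 x l p" and init: "det_init x0 l0"
  shows "good_run n (\<lambda>k. grad f (x k)) x l p" "x n \<in> S_det f c x0 P"
proof -
  have x0: "x 0 = x0" and l0: "l 0 = l0"
    and step: "\<And>k. soc_step c P (grad f (x k)) (x k) (l k) (p k) (x (Suc k)) (l (Suc k))"
    using run by (auto simp: det_run_def)
  have "good_run n (\<lambda>k. grad f (x k)) x l p \<and> x n \<in> S_det f c x0 P \<and>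
      norm (l n) \<le> Lam P \<and> rho P * norm (c (x n)) \<le> 2 * Lam P"
  proof (induction n)
    case 0
    have "rho P * norm (c x0) \<le> 2 * Lam P"
      using init param_pos(9) by linarith
    then show ?case
      using init x0_in_S_det[of x0] by (auto simp: good_run_def x0 l0)
  next
    case (Suc n)
    then have ball: "cball (x n) (chi_cor P * Delta P) \<subseteq> U"
      using cball_subset_nbhd init by (metis order_trans)
    then have "x n \<in> U" by (auto simp: subset_iff)
    then have good: "good_step (grad f (x n)) (x n) (l n) (p n) (x (Suc n)) (l (Suc n))"
      using Suc.IH step norm_grad_le ball by (intro good_step_ball) auto
    with Suc.IH have run': "good_run (Suc n) (\<lambda>k. grad f (x k)) x l p"
      by (auto simp: good_run_def less_Suc_eq)
    note next_b = good_step_next_bounds[OF good]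
    have "f (x (Suc n)) \<le> H_det f x0 P"
      using good_run_f_le[OF run'] by (simp add: x0)
    moreover have "norm (c (x (Suc n))) \<le> 2 * Lam P / rho P"
      using next_b(2) param_pos(7) by (subst pos_le_divide_eq) (simp_all add: mult.commute)
    ultimately show ?case
      using run' next_b by (simp add: S_det_def)
  qed
  then show "good_run n (\<lambda>k. grad f (x k)) x l p" "x n \<in> S_det f c x0 P"
    by auto
qed

text \<open>Pairs of consecutive steps are averaged because the constraint residual after the second
  step depends on both; some pair is no larger than the average.\<close>

lemma det_complexity:
  assumes run: "det_run f c P x0 l0 x l p" and init: "det_init x0 l0"
  shows "\<exists>C>0. \<forall>\<epsilon>. 0 < \<epsilon> \<and> \<epsilon> \<le> 1 \<longrightarrow>
            (\<exists>N. eps_KKT f c \<epsilon> (x N) (l N) \<and>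
                 real N \<le> C / \<epsilon>^2 \<and>
                 real (first_order_oracle_count N) \<le> C / \<epsilon>^2 \<and>
                 real (operation_count Primal_Solve N) \<le> C / \<epsilon>^2 \<and>
                 real (operation_count Correction_Solve N) \<le> C / \<epsilon>^2)"
proof -
  note good = det_run_good[OF run init]
  define T where "T = 2 * D0_const f x0 P"
  have x0: "x 0 = x0" using run by (simp add: det_run_def)
  have sum_p: "(\<Sum>k<n. (norm (p k))\<^sup>2) \<le> D0_const f x0 P" if "0 < n" for n
    using good_run_sum_le[OF good(1) that] by (simp add: x0)
  have sum_pp: "(\<Sum>j<m. (norm (p (Suc j)))\<^sup>2 + (norm (p j))\<^sup>2) \<le> T" for m
  proof -
    have "(\<Sum>j<m. (norm (p (Suc j)))\<^sup>2) \<le> (\<Sum>j<Suc m. (norm (p j))\<^sup>2)"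
      unfolding sum.lessThan_Suc_shift by simp
    moreover have "(\<Sum>j<m. (norm (p j))\<^sup>2) \<le> (\<Sum>j<Suc m. (norm (p j))\<^sup>2)" by simp
    ultimately show ?thesis
      using sum_p[of "Suc m"] unfolding T_def sum.distrib by linarith
  qed
  have T: "0 \<le> T" using sum_pp[of 0] by simp
  define \<beta> where "\<beta> = max ((B_p P)\<^sup>2) (C_lambda_p P / (rho P)\<^sup>2)"
  have \<beta>: "0 \<le> \<beta>" by (simp add: \<beta>_def le_max_iff_disj)
  \<comment> \<open>The summand 1 keeps the horizon positive even if \<open>T\<close>
    vanishes.\<close>
  define C1 where "C1 = \<beta> * T + 1"
  have C1: "0 < C1" "\<beta> * T \<le> C1" using \<beta> T by (auto simp: C1_def add_nonneg_pos)
  have "\<exists>N. eps_KKT f c \<epsilon> (x N) (l N) \<and> 5 * real N \<le> 5 * (C1 + 2) / \<epsilon>^2"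
    if \<epsilon>: "0 < \<epsilon>" "\<epsilon> \<le> 1" for \<epsilon>
  proof -
    define m where "m = nat \<lceil>C1 / \<epsilon>\<^sup>2\<rceil>"
    have C1\<epsilon>: "0 < C1 / \<epsilon>\<^sup>2" using C1 \<epsilon> by simp
    then have m: "0 < m" "C1 / \<epsilon>\<^sup>2 \<le> real m" "real m \<le> C1 / \<epsilon>\<^sup>2 + 1"
      unfolding m_def by linarith+
    obtain j where j: "j < m" "real m * ((norm (p (Suc j)))\<^sup>2 + (norm (p j))\<^sup>2) \<le> T"
      using exists_term_le_average[OF m(1) sum_pp] .
    define t where "t = (norm (p (Suc j)))\<^sup>2 + (norm (p j))\<^sup>2"
    have t: "0 \<le> t" "(norm (p (Suc j)))\<^sup>2 \<le> t" by (simp_all add: t_def)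
    have "C1 / \<epsilon>\<^sup>2 * t \<le> real m * t"
      using m(2) t by (intro mult_right_mono) auto
    then have "C1 / \<epsilon>\<^sup>2 * t \<le> T" using j(2) by (simp add: t_def)
    then have "C1 * t \<le> \<epsilon>\<^sup>2 * T" using \<epsilon> by (simp add: field_simps)
    then have "\<beta> * (C1 * t) \<le> \<beta> * (\<epsilon>\<^sup>2 * T)" using \<beta> by (rule mult_left_mono)
    also have "\<dots> \<le> \<epsilon>\<^sup>2 * C1" using mult_left_mono[OF C1(2), of "\<epsilon>\<^sup>2"] by (simp add: mult_ac)
    finally have "C1 * (\<beta> * t) \<le> C1 * \<epsilon>\<^sup>2" by (simp add: mult_ac)
    then have \<beta>t: "\<beta> * t \<le> \<epsilon>\<^sup>2" using C1 by simp
    have run': "good_run (Suc (Suc j)) (\<lambda>k. grad f (x k)) x l p" by (rule good)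
    have step: "good_step (grad f (x (Suc j))) (x (Suc j)) (l (Suc j)) (p (Suc j)) (x (Suc (Suc j))) (l (Suc
        (Suc j)))"
      using good_runD[OF run', of "Suc j"] by simp
    have "norm (kkt_residual (x (Suc (Suc j))) (l (Suc (Suc j)))) \<le> B_p P * norm (p (Suc j))"
      using good_step_residual[OF step] by simp
    also have "\<dots> \<le> \<epsilon>"
    proof (rule power2_le_imp_le)
      have "(B_p P * norm (p (Suc j)))\<^sup>2 \<le> \<beta> * t"
        using t by (auto simp: power_mult_distrib \<beta>_def le_max_iff_disj intro!: mult_mono)
      with \<beta>t show "(B_p P * norm (p (Suc j)))\<^sup>2 \<le> \<epsilon>\<^sup>2" by linarith
    qed (use \<epsilon> in auto)
    finally have 1: "norm (kkt_residual (x (Suc (Suc j))) (l (Suc (Suc j)))) \<le> \<epsilon>" .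
    have 2: "norm (c (x (Suc (Suc j)))) \<le> \<epsilon>"
    proof (rule power2_le_imp_le)
      have "(norm (c (x (Suc (Suc j)))))\<^sup>2 \<le> C_lambda_p P / (rho P)\<^sup>2 * t"
        using good_run_constraint[OF run', of j] by (simp add: t_def)
      also have "\<dots> \<le> \<beta> * t" using t by (intro mult_right_mono) (auto simp: \<beta>_def)
      finally show "(norm (c (x (Suc (Suc j)))))\<^sup>2 \<le> \<epsilon>\<^sup>2" using \<beta>t by linarith
    qed (use \<epsilon> in auto)
    \<comment> \<open>Rounding in \<open>m\<close> and the output index \<open>j + 2\<close> are
      absorbed using \<open>\<epsilon> \<le> 1\<close>. The factor 5 is the number of oracle calls
      per iteration: one gradient, two Jacobians, two constraint values.\<close>
    have "1 \<le> 1 / \<epsilon>\<^sup>2" using \<epsilon> by (simp add: power_le_one)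
    then have "real (Suc (Suc j)) \<le> (C1 + 2) / \<epsilon>^2"
      using j(1) m(3) by (simp add: add_divide_distrib)
    then have "5 * real (Suc (Suc j)) \<le> 5 * (C1 + 2) / \<epsilon>^2"
      unfolding times_divide_eq_right[symmetric] by (intro mult_left_mono) auto
    with 1 2 show ?thesis
      using f_differentiable c_differentiable good_stepD(3)[OF step]
      by (intro exI[of _ "Suc (Suc j)"]) (simp_all add: eps_KKT_def del: of_nat_Suc)
  qed
  then show ?thesis
    using C1 by (intro exI[of _ "5 * (C1 + 2)"])
      (fastforce simp: first_order_oracle_count_def operation_count_def)
qed

section \<open>Finite length and the limiting KKT pair\<close>

lemma lyapunov_GDERIV:
  assumes x: "x \<in> U"
  shows "GDERIV (lyapunov f c P) (x, l, w) :>
     (grad f x + cgrad c x *v (l + rho P *\<^sub>R c x), c x, (beta P / 2) *\<^sub>R w)"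
proof -
  have eq: "lyapunov f c P = (\<lambda>z. f (fst z) + fst (snd z) \<bullet> c (fst z) + rho P / 2 * (c (fst z) \<bullet> c (fst z))
      + beta P / 4 * (snd (snd z) \<bullet> snd (snd z)))"
    by (auto simp: lyapunov_def aug_lagrangian_def power2_norm_eq_inner)
  have [derivative_intros]: "((\<lambda>z. f (fst z)) has_derivative (\<lambda>h. fst h \<bullet> grad f x)) (at (x, l, w))"
    by (rule has_derivative_compose[of fst fst, OF has_derivative_fst[OF has_derivative_ident]])
       (use f_has_derivative[OF x] in simp)
  have [derivative_intros]: "((\<lambda>z. c (fst z)) has_derivative (\<lambda>h. transpose (cgrad c x) *v fst h)) (at (x, l, w))"
    by (rule has_derivative_compose[of fst fst, OF has_derivative_fst[OF has_derivative_ident]])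
       (use c_has_derivative[OF x] in simp)
  show ?thesis
    unfolding gderiv_def eq
    by (rule derivative_eq_intros refl)+
      (auto simp: inner_add_left inner_add_right matrix_vector_right_distrib matrix_vector_mult_scaleR
        inner_matrix_transpose[of _ "cgrad c x"] algebra_simps inner_commute)
qed

text \<open>Each new iterate and multiplier is paired with the step that produced it, so the single
  sequence \<open>norm (p k)\<close> controls decrease, gradient and motion of the triple.
  Compactness of the level set, with the bounds on multipliers and steps, provides the cluster point
  at which the inequality is invoked.\<close>

lemma det_finite_length:
  assumes run: "det_run f c P x0 l0 x l p" and init: "det_init x0 l0"
    and compact: "compact (S_det f c x0 P)"
    and KL: "\<And>zb. zb \<in> cluster_set (\<lambda>k. (x (Suc k), l (Suc k), p k)) \<Longrightarrow>
             KL_property (U \<times> UNIV \<times> UNIV) (lyapunov f c P) zb"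
  shows "summable (\<lambda>k. norm (x (Suc k) - x k) + norm (l (Suc k) - l k)) \<and>
          (\<exists>xs ls. x \<longlonglongrightarrow> xs \<and> l \<longlonglongrightarrow> ls \<and> KKT f c xs ls)"
proof -
  note good = det_run_good[OF run init]
  define u where "u k = (x (Suc k), l (Suc k), p k)" for k
  define a where "a k = norm (p k)" for k
  have step: "good_step (grad f (x k)) (x k) (l k) (p k) (x (Suc k)) (l (Suc k))" for k
    using good_runD[OF good(1)[of "Suc k"], of k] by simp
  have SU: "S_det f c x0 P \<subseteq> U"
  proof
    fix y assume "y \<in> S_det f c x0 P"
    then have "cball y (chi_cor P * Delta P) \<subseteq> U"
      using cball_subset_nbhd init by (metis order_trans)
    then show "y \<in> U" by (auto simp: subset_iff)
  qed
  have dl: "norm (l (Suc (Suc k)) - l (Suc k)) \<le> B_p P / sigma_c P * (a (Suc k) + a k)" for k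
  proof -
    have "sigma_c P * norm (l (Suc (Suc k)) - l (Suc k)) \<le> A_p P * a (Suc k) + B_p P * a k"
      using good_step_increment[OF step[of k] step[of "Suc k"]] by (simp add: a_def)
    also have "\<dots> \<le> B_p P * a (Suc k) + B_p P * a k"
      using B_p_ge_A_p by (intro add_right_mono mult_right_mono) (auto simp: a_def)
    finally show ?thesis by (simp add: field_simps)
  qed
  have Bp: "0 \<le> B_p P" using B_p_ge_A_p A_p_pos by linarith
  have dx: "norm (x (Suc k) - x k) \<le> chi_cor P * a k" for k
    using good_step_displacement(1)[OF step] by (simp add: a_def)
  \<comment> \<open>Bounds the multiplier component of the Lyapunov gradient below, and finally
    makes the limit feasible.\<close>
  have rc: "rho P * norm (c (x (Suc k))) = norm (l (Suc k) - l k)" for k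
    by (simp add: good_stepD(7)[OF step])
  have cpt: "compact (S_det f c x0 P \<times> (cball (0::real^'m) (Lam P) \<times> cball (0::real^'n) (Delta P)))"
    using compact by (intro compact_Times) auto
  have "\<forall>k. u k \<in> S_det f c x0 P \<times> (cball 0 (Lam P) \<times> cball 0 (Delta P))"
    using good(2) good_step_next_bounds(1)[OF step] good_step_norm_p[OF step] by (auto simp: u_def)
  then obtain ub r where ub: "ub \<in> S_det f c x0 P \<times> (cball 0 (Lam P) \<times> cball 0 (Delta P))"
    and r: "strict_mono r" "(u \<circ> r) \<longlonglongrightarrow> ub"
    using cpt unfolding compact_def by metis
  have KL': "KL_property (U \<times> UNIV \<times> UNIV) (lyapunov f c P) ub"
    using r by (intro KL) (auto simp: cluster_set_def u_def[abs_def])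
  have "ub \<in> U \<times> UNIV \<times> UNIV" using ub SU by auto
  then have "continuous (at ub) (lyapunov f c P)"
    using lyapunov_GDERIV by (metis gderiv_def has_derivative_continuous mem_Sigma_iff surj_pair)
  then have E_lim: "(\<lambda>n. lyapunov f c P (u (r n))) \<longlonglongrightarrow> lyapunov f c P ub"
    using continuous_at_sequentially r(2) by (fastforce simp: o_def)
  have xU: "x k \<in> U" for k using good_stepD(1)[OF step] .
  define Cg where "Cg = B_p P + (M_c P + 1 / rho P) * (B_p P / sigma_c P) + beta P / 2"
  define Cm where "Cm = chi_cor P + B_p P / sigma_c P + 1"
  have a: "0 \<le> a k" for k by (simp add: a_def)
  have sum_a: "summable a"
  proof (rule KL_finite_length[OF a _ _ _ _ _ _ KL' r E_lim, where \<alpha>="beta P / 4" and Cg=Cg and Cm=Cm])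
    show "0 \<le> Cg" using Bp by (auto simp: Cg_def intro!: add_nonneg_nonneg mult_nonneg_nonneg)
    show "0 \<le> Cm" using Bp by (auto simp: Cm_def intro!: add_nonneg_nonneg mult_nonneg_nonneg)
  next
    fix k
    have "(norm (l (Suc (Suc k)) - l (Suc k)))\<^sup>2 / rho P \<le> C_lambda_p P * ((a (Suc k))\<^sup>2 + (a k)\<^sup>2) / rho P"
      using good_step_increment_square[OF step[of k] step[of "Suc k"]] by (intro divide_right_mono) (auto simp: a_def)
    also have "\<dots> = C_lambda_p P / rho P * ((a (Suc k))\<^sup>2 + (a k)\<^sup>2)" by simp
    also have "\<dots> \<le> beta P / 8 * ((a (Suc k))\<^sup>2 + (a k)\<^sup>2)"
      using C_lambda_p_over_rho by (intro mult_right_mono) auto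
    finally have "(norm (l (Suc (Suc k)) - l (Suc k)))\<^sup>2 / rho P \<le> beta P / 8 * ((a (Suc k))\<^sup>2 + (a k)\<^sup>2)" .
    \<comment> \<open>The previous step gives back the weight \<open>beta P / 4\<close> of the
      Lyapunov function but is charged only \<open>beta P / 8\<close>; the surplus is
      discarded.\<close>
    moreover have "0 \<le> beta P / 8 * (a k)\<^sup>2" by simp
    ultimately show "lyapunov f c P (u (Suc k)) \<le> lyapunov f c P (u k) - beta P / 4 * (a (Suc k))\<^sup>2"
      using good_step_descent[OF step[of "Suc k"]] good_step_dual_ascent[OF step[of "Suc k"]]
      unfolding lyapunov_def u_def a_def prod.case by (simp only: diff_self norm_zero mult_zero_left) argo
    have "dist (u (Suc k)) (u k) \<le> norm (x (Suc (Suc k)) - x (Suc k)) + (norm (l (Suc (Suc k)) - l (Suc k))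
        + norm (p (Suc k) - p k))"
      unfolding u_def dist_norm by (simp, intro order_trans[OF norm_Pair_le] add_left_mono order_trans[OF
          norm_Pair_le]) simp
    also have "norm (p (Suc k) - p k) \<le> a (Suc k) + a k" by (simp add: a_def norm_triangle_ineq4)
    also note dl[of k]
    also note dx[of "Suc k"]
    finally show "dist (u (Suc k)) (u k) \<le> Cm * (a (Suc k) + a k)"
      using mult_nonneg_nonneg[OF kappa_chi_nonneg(3) a[of k]] by (simp add: Cm_def algebra_simps)
    \<comment> \<open>The \<open>x\<close>-component is the KKT residual plus a penalty term; that
      term and the second component are bounded by multiples of the last multiplier
      increment.\<close>
    have g: "grad (lyapunov f c P) (u (Suc k)) = (kkt_residual (x (Suc (Suc k))) (l (Suc (Suc k)))
        + rho P *\<^sub>R (cgrad c (x (Suc (Suc k))) *v c (x (Suc (Suc k)))), c (x (Suc (Suc k))), (beta P / 2) *\<^sub>R p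
            (Suc k))"
      unfolding u_def by (subst grad_eqI[OF lyapunov_GDERIV[OF xU]])
          (simp add: algebra_simps matrix_vector_right_distrib)
    have "norm (grad (lyapunov f c P) (u (Suc k))) \<le>
        norm (kkt_residual (x (Suc (Suc k))) (l (Suc (Suc k))))
        + norm (rho P *\<^sub>R (cgrad c (x (Suc (Suc k))) *v c (x (Suc (Suc k)))))
        + (norm (c (x (Suc (Suc k)))) + norm ((beta P / 2) *\<^sub>R p (Suc k)))"
      unfolding g by (intro order_trans[OF norm_Pair_le] add_mono norm_triangle_ineq norm_Pair_le)
    also have "norm (kkt_residual (x (Suc (Suc k))) (l (Suc (Suc k)))) \<le> B_p P * a (Suc k)"
      using good_step_residual[OF step[of "Suc k"]] by (simp add: a_def)
    also have "norm (rho P *\<^sub>R (cgrad c (x (Suc (Suc k))) *v c (x (Suc (Suc k))))) \<le> M_c P * norm (l (Suc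
        (Suc k)) - l (Suc k))"
      using mult_left_mono[OF cgrad_upper[OF xU[of "Suc (Suc k)"], of "c (x (Suc (Suc k)))"], of "rho P"]
      by (simp add: rc[symmetric] mult_ac)
    also have "norm (c (x (Suc (Suc k)))) = 1 / rho P * norm (l (Suc (Suc k)) - l (Suc k))"
      by (simp add: rc[symmetric])
    also have "norm ((beta P / 2) *\<^sub>R p (Suc k)) = beta P / 2 * a (Suc k)"
      by (simp add: a_def)
    finally have "norm (grad (lyapunov f c P) (u (Suc k))) \<le> B_p P * a (Suc k) + beta P / 2 * a (Suc k)
       + (M_c P + 1 / rho P) * norm (l (Suc (Suc k)) - l (Suc k))"
      by (simp add: algebra_simps)
    also have "(M_c P + 1 / rho P) * norm (l (Suc (Suc k)) - l (Suc k))
       \<le> (M_c P + 1 / rho P) * (B_p P / sigma_c P * (a (Suc k) + a k))"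
      by (intro mult_left_mono dl) (auto intro: add_nonneg_nonneg)
    also have "B_p P * a (Suc k) \<le> B_p P * (a (Suc k) + a k)" using Bp a by (intro mult_left_mono) auto
    also have "beta P / 2 * a (Suc k) \<le> beta P / 2 * (a (Suc k) + a k)" using a by (intro mult_left_mono) auto
    finally show "norm (grad (lyapunov f c P) (u (Suc k))) \<le> Cg * (a (Suc k) + a k)"
      unfolding Cg_def distrib_right[of _ _ "a (Suc k) + a k"] mult.assoc by linarith
  qed simp
  have sx: "summable (\<lambda>k. norm (x (Suc k) - x k))"
    by (rule summable_comparison_test'[OF summable_mult[OF sum_a], of 0 _ "chi_cor P"]) (use dx in auto)
  have "summable (\<lambda>k. norm (l (Suc (Suc k)) - l (Suc k)))"
    by (rule summable_comparison_test'[of "\<lambda>k. B_p P / sigma_c P * (a (Suc k) + a k)" 0])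
      (use dl sum_a in \<open>auto intro!: summable_mult summable_add simp: summable_Suc_iff\<close>)
  then have sl: "summable (\<lambda>k. norm (l (Suc k) - l k))"
    by (subst (asm) summable_Suc_iff)
  have conv: "convergent y" if "summable (\<lambda>k. norm (y (Suc k) - y k))" for y :: "nat \<Rightarrow> 'e::banach"
  proof -
    have "(\<lambda>n. \<Sum>k<n. y (Suc k) - y k) \<longlonglongrightarrow> (\<Sum>k. y (Suc k) - y k)"
      using summable_LIMSEQ[OF summable_norm_cancel[OF that]] .
    then have "(\<lambda>n. (y n - y 0) + y 0) \<longlonglongrightarrow> (\<Sum>k. y (Suc k) - y k) + y 0"
      unfolding sum_lessThan_telescope by (intro tendsto_add tendsto_const)
    then show ?thesis by (auto simp: convergent_def)
  qed
  obtain xs where xs: "x \<longlonglongrightarrow> xs" using conv[OF sx] by (auto simp: convergent_def)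
  obtain ls where ls: "l \<longlonglongrightarrow> ls" using conv[OF sl] by (auto simp: convergent_def)
  have xsU: "xs \<in> U"
    using closed_sequentially[OF compact_imp_closed[OF compact] _ xs] good(2) SU by blast
  have a_lim: "a \<longlonglongrightarrow> 0" using sum_a by (rule summable_LIMSEQ_zero)
  have cont: "(\<lambda>k. h (x k)) \<longlonglongrightarrow> h xs" if "continuous_on U h" for h :: "real^'n \<Rightarrow> 'e::topological_space"
    using continuous_on_tendsto_compose[OF that xs xsU] xU by simp
  have "(\<lambda>k. norm (kkt_residual (x k) (l k))) \<longlonglongrightarrow> norm (kkt_residual xs ls)"
    by (intro tendsto_norm tendsto_add tendsto_matrix_vector_mult cont continuous_on_grad continuous_on_cgrad ls)
  then have "(\<lambda>k. norm (kkt_residual (x (Suc k)) (l (Suc k)))) \<longlonglongrightarrow> norm (kkt_residual xs ls)"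
    by (rule LIMSEQ_Suc)
  moreover have "(\<lambda>k. norm (kkt_residual (x (Suc k)) (l (Suc k)))) \<longlonglongrightarrow> 0"
  proof (rule tendsto_sandwich[OF _ _ tendsto_const])
    show "(\<lambda>k. B_p P * a k) \<longlonglongrightarrow> 0" using tendsto_mult[OF tendsto_const a_lim, of "B_p P"] by simp
    show "\<forall>\<^sub>F k in sequentially. norm (kkt_residual (x (Suc k)) (l (Suc k))) \<le> B_p P * a k"
      using good_step_residual[OF step] by (intro always_eventually) (simp add: a_def)
  qed auto
  ultimately have K1: "norm (kkt_residual xs ls) = 0" by (rule LIMSEQ_unique)
  have "(\<lambda>k. rho P * norm (c (x (Suc k)))) \<longlonglongrightarrow> rho P * norm (c xs)"
    by (intro tendsto_intros LIMSEQ_Suc[of "\<lambda>k. c (x k)"] cont continuous_on_c)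
  moreover have "(\<lambda>k. rho P * norm (c (x (Suc k)))) \<longlonglongrightarrow> norm (ls - ls)"
    unfolding rc by (intro tendsto_intros LIMSEQ_Suc ls)
  ultimately have "rho P * norm (c xs) = norm (ls - ls)" by (rule LIMSEQ_unique)
  then have "norm (c xs) = 0" by simp
  with K1 have "KKT f c xs ls"
    using f_differentiable[OF xsU] c_differentiable[OF xsU] by (simp add: eps_KKT_def)
  with xs ls sx sl show ?thesis by (auto intro: summable_add)
qed

end

section \<open>Mean-square estimates for minibatches\<close>

text \<open>The argument \<open>x\<close> is replaced by the first member of a countable dense
  sequence within distance \<open>1 / (n + 1)\<close>. For fixed \<open>n\<close> this is a
  measurable selection from countably many sections, and continuity in \<open>x\<close> recovers
  \<open>F\<close> in the limit.\<close>

lemma borel_measurable_Caratheodory: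
  fixes F :: "'a::euclidean_space \<Rightarrow> 's \<Rightarrow> real"
  assumes U: "U \<in> sets borel"
    and meas: "\<And>x. x \<in> U \<Longrightarrow> F x \<in> borel_measurable D"
    and cont: "\<And>s. s \<in> space D \<Longrightarrow> continuous_on U (\<lambda>x. F x s)"
  shows "(\<lambda>(x, s). if x \<in> U then F x s else 0) \<in> borel_measurable (borel \<Otimes>\<^sub>M D)"
proof (cases "U = {}")
  case False
  obtain T where T: "countable T" "T \<subseteq> U" "U \<subseteq> closure T"
    using separable by blast
  with False have "T \<noteq> {}" by auto
  define e where "e = from_nat_into T"
  have eU: "e i \<in> U" for i
    using T(2) from_nat_into[OF \<open>T \<noteq> {}\<close>] by (auto simp: e_def)
  have dense: "\<exists>i. dist (e i) x < \<epsilon>" if "x \<in> U" "0 < \<epsilon>" for x \<epsilon>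
  proof -
    have "x \<in> closure T" using T(3) \<open>x \<in> U\<close> by blast
    then obtain t where "t \<in> T" "dist t x < \<epsilon>"
      using \<open>0 < \<epsilon>\<close> unfolding closure_approachable by blast
    then show ?thesis
      using from_nat_into_surj[OF T(1)] by (metis e_def)
  qed
  define N where "N n x = (LEAST i. dist (e i) x < 1 / real (Suc n))" for n x
  have N: "dist (e (N n x)) x < 1 / real (Suc n)" if "x \<in> U" for n x
    unfolding N_def by (rule LeastI_ex) (use dense that in auto)
  have [measurable]: "N n \<in> borel \<rightarrow>\<^sub>M count_space UNIV" for n
    unfolding N_def by measurable
  have [measurable]: "U \<in> sets borel" by fact
  have [measurable]: "F (e i) \<in> borel_measurable D" for i
    using meas eU by auto
  show ?thesis
  proof (rule borel_measurable_LIMSEQ_real)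
    fix n
    have "(\<lambda>z. F (e (N n (fst z))) (snd z)) \<in> borel_measurable (borel \<Otimes>\<^sub>M D)"
      by (rule measurable_compose_countable[where f="\<lambda>i z. F (e i) (snd z)" and g="\<lambda>z. N n (fst z)"]) measurable
    then show "(\<lambda>z. if fst z \<in> U then F (e (N n (fst z))) (snd z) else 0) \<in> borel_measurable (borel \<Otimes>\<^sub>M D)"
      by measurable
  next
    fix z assume "z \<in> space (borel \<Otimes>\<^sub>M D :: ('a \<times> 's) measure)"
    then obtain x s where z: "z = (x, s)" "s \<in> space D"
      by (auto simp: space_pair_measure)
    have "(\<lambda>n. F (e (N n x)) s) \<longlonglongrightarrow> F x s" if x: "x \<in> U"
    proof -
      have "(\<lambda>n. e (N n x)) \<longlonglongrightarrow> x"
      proof (rule metric_tendsto_imp_tendsto[of "\<lambda>n. 1 / real (Suc n)" 0])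
        show "(\<lambda>n. 1 / real (Suc n)) \<longlonglongrightarrow> 0"
          using LIMSEQ_inverse_real_of_nat by (simp add: inverse_eq_divide)
        show "\<forall>\<^sub>F n in sequentially. dist (e (N n x)) x \<le> dist (1 / real (Suc n)) 0"
          using less_imp_le[OF N[OF x]] by (intro always_eventually) auto
      qed
      then show ?thesis
        by (rule continuous_on_tendsto_compose[OF cont[OF z(2)] _ x]) (use eU in simp)
    qed
    then show "(\<lambda>n. if fst z \<in> U then F (e (N n (fst z))) (snd z) else 0)
        \<longlonglongrightarrow> (case z of (x, s) \<Rightarrow> if x \<in> U then F x s else 0)"
      by (auto simp: z)
  qed
qed simp

text \<open>Each coordinate of the gradient is a limit of difference quotients of a jointly
  measurable function. Extension by zero outside \<open>U\<close> makes the quotients total, and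
  openness of \<open>U\<close> makes them genuine for large \<open>n\<close>.\<close>

lemma borel_measurable_parametric_grad:
  fixes F :: "'a::euclidean_space \<Rightarrow> 's \<Rightarrow> real"
  assumes U: "open U"
    and meas: "\<And>x. x \<in> U \<Longrightarrow> F x \<in> borel_measurable D"
    and diff: "\<And>x s. x \<in> U \<Longrightarrow> s \<in> space D \<Longrightarrow> (\<lambda>y. F y s) differentiable (at x)"
  shows "(\<lambda>(x, s). if x \<in> U then grad (\<lambda>y. F y s) x else 0) \<in> borel_measurable (borel \<Otimes>\<^sub>M D)"
proof -
  have [measurable]: "U \<in> sets borel" using U by simp
  define F0 where "F0 = (\<lambda>(x, s). if x \<in> U then F x s else 0)"
  have [measurable]: "F0 \<in> borel_measurable (borel \<Otimes>\<^sub>M D)"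
    unfolding F0_def using diff
    by (intro borel_measurable_Caratheodory meas)
      (auto intro!: continuous_at_imp_continuous_on differentiable_imp_continuous_within)
  show ?thesis
  proof (rule borel_measurable_euclidean_space[THEN iffD2], rule ballI)
    fix b :: 'a assume b: "b \<in> Basis"
    show "(\<lambda>z. (case z of (x, s) \<Rightarrow> if x \<in> U then grad (\<lambda>y. F y s) x else 0) \<bullet> b) \<in> borel_measurable (borel \<Otimes>\<^sub>M D)"
    proof (rule borel_measurable_LIMSEQ_real)
      fix n :: nat
      have "(\<lambda>z. F0 (fst z + (1 / real (Suc n)) *\<^sub>R b, snd z)) \<in> borel_measurable (borel \<Otimes>\<^sub>M D)"
        by measurable
      then show "(\<lambda>z. if fst z \<in> U then real (Suc n) * (F0 (fst z + (1 / real (Suc n)) *\<^sub>R b, snd z) - F0 z) else 0)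
          \<in> borel_measurable (borel \<Otimes>\<^sub>M D)"
        by measurable
    next
      fix z assume "z \<in> space (borel \<Otimes>\<^sub>M D :: ('a \<times> 's) measure)"
      then obtain x s where z: "z = (x, s)" "s \<in> space D"
        by (auto simp: space_pair_measure)
      have "(\<lambda>n. real (Suc n) * (F0 (x + (1 / real (Suc n)) *\<^sub>R b, s) - F0 (x, s))) \<longlonglongrightarrow> grad (\<lambda>y. F y s) x \<bullet> b"
        if x: "x \<in> U"
      proof -
        have tb: "((\<lambda>t. x + t *\<^sub>R b) has_derivative (\<lambda>t. t *\<^sub>R b)) (at 0)"
          by (auto intro!: derivative_eq_intros)
        have "((\<lambda>t. F (x + t *\<^sub>R b) s) has_derivative (\<lambda>t. (t *\<^sub>R b) \<bullet> grad (\<lambda>y. F y s) x)) (at 0)"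
          by (rule has_derivative_compose[OF tb, of "\<lambda>y. F y s"])
            (use GDERIV_grad[OF diff[OF x z(2)]] in \<open>simp add: gderiv_def\<close>)
        then have "((\<lambda>t. F (x + t *\<^sub>R b) s) has_real_derivative (grad (\<lambda>y. F y s) x \<bullet> b)) (at 0)"
          by (simp add: has_field_derivative_def mult_commute_abs inner_commute)
        then have "((\<lambda>t. (F (x + t *\<^sub>R b) s - F x s) / t) \<longlongrightarrow> grad (\<lambda>y. F y s) x \<bullet> b) (at 0)"
          by (simp add: has_field_derivative_iff)
        moreover have lim: "(\<lambda>n. 1 / real (Suc n)) \<longlonglongrightarrow> 0"
          using LIMSEQ_inverse_real_of_nat by (simp add: inverse_eq_divide)
        then have "filterlim (\<lambda>n. 1 / real (Suc n)) (at 0) sequentially"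
          by (auto simp: filterlim_at)
        ultimately have "(\<lambda>n. (F (x + (1 / real (Suc n)) *\<^sub>R b) s - F x s) / (1 / real (Suc n))) \<longlonglongrightarrow> grad
            (\<lambda>y. F y s) x \<bullet> b"
          by (rule filterlim_compose)
        moreover have "(\<lambda>n. x + (1 / real (Suc n)) *\<^sub>R b) \<longlonglongrightarrow> x + 0 *\<^sub>R b"
          by (intro tendsto_intros lim)
        then have "\<forall>\<^sub>F n in sequentially. x + (1 / real (Suc n)) *\<^sub>R b \<in> U"
          using topological_tendstoD[OF _ U] x by auto
        then have "\<forall>\<^sub>F n in sequentially. (F (x + (1 / real (Suc n)) *\<^sub>R b) s - F x s) / (1 / real (Suc n))
            = real (Suc n) * (F0 (x + (1 / real (Suc n)) *\<^sub>R b, s) - F0 (x, s))"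
          by eventually_elim (use x in \<open>simp add: F0_def mult.commute\<close>)
        ultimately show ?thesis
          by (rule Lim_transform_eventually)
      qed
      then show "(\<lambda>n. if fst z \<in> U then real (Suc n) * (F0 (fst z + (1 / real (Suc n)) *\<^sub>R b, snd z) - F0 z) else 0)
          \<longlonglongrightarrow> (case z of (x, s) \<Rightarrow> if x \<in> U then grad (\<lambda>y. F y s) x else 0) \<bullet> b"
        by (auto simp: z)
    qed
  qed
qed

lemma measurable_completion_AE_eq:
  assumes g: "g \<in> M \<rightarrow>\<^sub>M N" and eq: "AE \<omega> in M. f \<omega> = g \<omega>" and f: "f \<in> space M \<rightarrow> space N"
  shows "f \<in> completion M \<rightarrow>\<^sub>M N"
proof (rule measurableI)
  fix A assume A: "A \<in> sets N"
  have [measurable]: "Measurable.pred (completion M) (\<lambda>\<omega>. g \<omega> \<in> A)"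
    using measurable_completion[OF g] A by measurable
  have [measurable]: "Measurable.pred (completion M) (\<lambda>\<omega>. f \<omega> \<noteq> g \<omega>)"
    "Measurable.pred (completion M) (\<lambda>\<omega>. f \<omega> \<noteq> g \<omega> \<and> f \<omega> \<in> A)"
    using eq by (auto intro!: sets_completion_AE)
  have "Measurable.pred (completion M) (\<lambda>\<omega>. (g \<omega> \<in> A \<and> \<not> f \<omega> \<noteq> g \<omega>) \<or> (f \<omega> \<noteq> g \<omega> \<and> f \<omega> \<in> A))"
    by measurable
  moreover have "f -` A \<inter> space (completion M)
      = {\<omega> \<in> space (completion M). (g \<omega> \<in> A \<and> \<not> f \<omega> \<noteq> g \<omega>) \<or> (f \<omega> \<noteq> g \<omega> \<and> f \<omega> \<in> A)}"
    by auto
  ultimately show "f -` A \<inter> space (completion M) \<in> sets (completion M)"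
    by (simp only: pred_def)
qed (use f in auto)

section \<open>Second moments and independence\<close>

lemma mean_square_leI:
  fixes X :: "'w \<Rightarrow> 'a::euclidean_space"
  assumes Y: "Y \<in> borel_measurable M" and eq: "AE \<omega> in M. X \<omega> = Y \<omega>"
    and bound: "(\<integral>\<^sup>+ \<omega>. ennreal ((norm (Y \<omega>))\<^sup>2) \<partial>M) \<le> ennreal v" and v: "0 \<le> v"
  shows "mean_square_le M X v"
proof -
  have X: "X \<in> borel_measurable (completion M)"
    by (rule measurable_completion_AE_eq[OF Y eq]) simp
  have "(\<integral>\<^sup>+ \<omega>. ennreal ((norm (X \<omega>))\<^sup>2) \<partial>completion M) = (\<integral>\<^sup>+ \<omega>. ennreal ((norm (Y \<omega>))\<^sup>2) \<partial>completion M)"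
    by (rule nn_integral_cong_AE) (use AE_completion[OF eq] in auto)
  also have "\<dots> \<le> ennreal v"
    using bound Y by (subst nn_integral_completion) auto
  finally have le: "(\<integral>\<^sup>+ \<omega>. ennreal ((norm (X \<omega>))\<^sup>2) \<partial>completion M) \<le> ennreal v" .
  then have int: "integrable (completion M) (\<lambda>\<omega>. (norm (X \<omega>))\<^sup>2)"
    using X by (intro integrableI_bounded) (auto intro: le_less_trans)
  then have "ennreal (\<integral>\<omega>. (norm (X \<omega>))\<^sup>2 \<partial>completion M) \<le> ennreal v"
    using le by (subst (asm) nn_integral_eq_integral) auto
  then show ?thesis
    using X int v by (simp add: mean_square_le_def)
qed

text \<open>On the sets of \<open>H\<close>, the part of \<open>M\<close> inside \<open>E\<close> is
  just \<open>M\<close> scaled by the probability of \<open>E\<close>, and \<open>g\<close> is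
  integrated against this restriction. The event of interest is that the random output index takes a
  given value.\<close>

lemma nn_integral_indep_event:
  assumes M: "prob_space M" and H: "subalgebra M H" and E: "E \<in> sets M" and g: "g \<in> borel_measurable H"
    and indep: "\<And>A. A \<in> sets H \<Longrightarrow> measure M (E \<inter> A) = measure M E * measure M A"
  shows "(\<integral>\<^sup>+ \<omega>. indicator E \<omega> * g \<omega> \<partial>M) = ennreal (measure M E) * (\<integral>\<^sup>+ \<omega>. g \<omega> \<partial>M)"
proof -
  interpret prob_space M by fact
  define ME where "ME = density M (indicator E)"
  have sub: "subalgebra ME H" using H by (simp add: ME_def subalgebra_def)
  have gM: "g \<in> borel_measurable M" using measurable_from_subalg[OF H g] .
  have "(\<integral>\<^sup>+ \<omega>. indicator E \<omega> * g \<omega> \<partial>M) = (\<integral>\<^sup>+ \<omega>. g \<omega> \<partial>ME)"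
    unfolding ME_def using E gM by (subst nn_integral_density) auto
  also have "\<dots> = (\<integral>\<^sup>+ \<omega>. g \<omega> \<partial>restr_to_subalg ME H)"
    using nn_integral_subalgebra2[OF sub g] by simp
  also have "restr_to_subalg ME H = scale_measure (ennreal (measure M E)) (restr_to_subalg M H)"
  proof (rule measure_eqI)
    fix A assume "A \<in> sets (restr_to_subalg ME H)"
    then have A: "A \<in> sets H" by (simp add: sets_restr_to_subalg[OF sub])
    then have AM: "A \<in> sets M" using H by (auto simp: subalgebra_def)
    have "emeasure ME A = emeasure M (E \<inter> A)"
      using E AM by (simp add: ME_def emeasure_density indicator_inter_arith[symmetric])
    also have "\<dots> = ennreal (measure M E) * emeasure M A"
      by (simp add: emeasure_eq_measure indep[OF A] ennreal_mult)
    finally show "emeasure (restr_to_subalg ME H) A = emeasure (scale_measure (ennreal (measure M E))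
        (restr_to_subalg M H)) A"
      using A by (simp add: emeasure_restr_to_subalg[OF sub] emeasure_restr_to_subalg[OF H])
  qed (simp add: sets_restr_to_subalg[OF sub] sets_restr_to_subalg[OF H])
  also have "(\<integral>\<^sup>+ \<omega>. g \<omega> \<partial>\<dots>) = ennreal (measure M E) * (\<integral>\<^sup>+ \<omega>. g \<omega> \<partial>restr_to_subalg M H)"
    using measurable_in_subalg[OF H g] by (subst nn_integral_scale_measure) auto
  also have "(\<integral>\<^sup>+ \<omega>. g \<omega> \<partial>restr_to_subalg M H) = (\<integral>\<^sup>+ \<omega>. g \<omega> \<partial>M)"
    using nn_integral_subalgebra2[OF H g] .
  finally show ?thesis .
qed

text \<open>The oracle assumption bounds uncentred gradient differences, while the recursion needs
  their deviation from the mean; centring does not increase the second moment.\<close>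

lemma second_moment_centered_le:
  fixes Y :: "'s \<Rightarrow> 'e::euclidean_space"
  assumes D: "prob_space D" and Y: "integrable D Y" and Y2: "integrable D (\<lambda>s. (norm (Y s))\<^sup>2)" and m: "m =
      (\<integral>s. Y s \<partial>D)"
  shows "(\<integral>\<^sup>+ s. ennreal ((norm (Y s - m))\<^sup>2) \<partial>D) \<le> ennreal (\<integral>s. (norm (Y s))\<^sup>2 \<partial>D)"
proof -
  interpret prob_space D by fact
  have eq: "(norm (Y s - m))\<^sup>2 = (norm (Y s))\<^sup>2 - 2 * (Y s \<bullet> m) + (norm m)\<^sup>2" for s
    by (simp add: power2_norm_eq_inner inner_diff_left inner_diff_right inner_commute)
  have int: "integrable D (\<lambda>s. (norm (Y s - m))\<^sup>2)"
    unfolding eq using Y Y2 by simp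
  have "(\<integral>s. (norm (Y s - m))\<^sup>2 \<partial>D) = (\<integral>s. (norm (Y s))\<^sup>2 \<partial>D) - 2 * (m \<bullet> m) + (norm m)\<^sup>2"
    unfolding eq using Y Y2 by (simp add: m prob_space)
  also have "\<dots> \<le> (\<integral>s. (norm (Y s))\<^sup>2 \<partial>D)"
    by (simp add: power2_norm_eq_inner)
  finally show ?thesis
    using int by (subst nn_integral_eq_integral) (auto intro: ennreal_leI)
qed

text \<open>Orthogonality: a fixed vector and independent centred summands have vanishing cross
  terms, so averaging divides the variance by the batch size. For distinct indices the inner product
  is split into coordinates, which reduces it to products of real functions.\<close>

lemma sample_mean_second_moment:
  fixes h :: "'s \<Rightarrow> 'e::euclidean_space"
  assumes D: "prob_space D" and I: "finite I" "I \<noteq> {}"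
    and h: "integrable D h" "(\<integral>s. h s \<partial>D) = 0" and v: "(\<integral>\<^sup>+ s. ennreal ((norm (h s))\<^sup>2) \<partial>D) \<le> ennreal v" "0 \<le> v"
  shows "(\<integral>\<^sup>+ y. ennreal ((norm (z + (1 / real (card I)) *\<^sub>R (\<Sum>i\<in>I. h (y i))))\<^sup>2) \<partial>PiM I (\<lambda>_. D))
    \<le> ennreal ((norm z)\<^sup>2 + v / real (card I))"
proof -
  interpret D: prob_space D by fact
  interpret P: product_prob_space "\<lambda>_. D" I ..
  define n where "n = real (card I)"
  have n: "0 < n" using I by (simp add: n_def card_gt_0_iff)
  have hm[measurable]: "h \<in> borel_measurable D" using h(1) by auto
  have h2: "integrable D (\<lambda>s. (norm (h s))\<^sup>2)"
    using v(1) by (intro integrableI_bounded) (auto intro: le_less_trans)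
  then have v': "(\<integral>s. (norm (h s))\<^sup>2 \<partial>D) \<le> v"
    using v by (subst (asm) nn_integral_eq_integral) auto
  have comp: "distr (PiM I (\<lambda>_. D)) D (\<lambda>y. y i) = D" if "i \<in> I" for i
    using distr_PiM_component[of I "\<lambda>_. D" i] D that by auto
  have int1: "integrable (PiM I (\<lambda>_. D)) (\<lambda>y. h (y i))" "(\<integral>y. h (y i) \<partial>PiM I (\<lambda>_. D)) = 0" if "i \<in> I" for i
    using integrable_distr_eq[of "\<lambda>y. y i" "PiM I (\<lambda>_. D)" D h] integral_distr[of "\<lambda>y. y i" "PiM I (\<lambda>_. D)" D h]
      that h by (auto simp: comp)
  have int2: "integrable (PiM I (\<lambda>_. D)) (\<lambda>y. (norm (h (y i)))\<^sup>2)"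
    "(\<integral>y. (norm (h (y i)))\<^sup>2 \<partial>PiM I (\<lambda>_. D)) \<le> v" if "i \<in> I" for i
    using integrable_distr_eq[of "\<lambda>y. y i" "PiM I (\<lambda>_. D)" D "\<lambda>s. (norm (h s))\<^sup>2"]
      integral_distr[of "\<lambda>y. y i" "PiM I (\<lambda>_. D)" D "\<lambda>s. (norm (h s))\<^sup>2"]
      that h2 v' by (auto simp: comp)
  have cross: "integrable (PiM I (\<lambda>_. D)) (\<lambda>y. h (y i) \<bullet> h (y j))" "(\<integral>y. h (y i) \<bullet> h (y j) \<partial>PiM I (\<lambda>_. D)) = 0"
    if ij: "i \<in> I" "j \<in> I" "i \<noteq> j" for i j
  proof -
    have c: "integrable (PiM I (\<lambda>_. D)) (\<lambda>y. (h (y i) \<bullet> b) * (h (y j) \<bullet> b)) \<and>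
        (\<integral>y. (h (y i) \<bullet> b) * (h (y j) \<bullet> b) \<partial>PiM I (\<lambda>_. D)) = 0" for b
    proof -
      \<comment> \<open>Trivial factors at the remaining indices turn the product of two coordinates
        into a product over all of \<open>I\<close>, as the product integral formula
        demands.\<close>
      define g where "g k = (if k = i \<or> k = j then (\<lambda>s. h s \<bullet> b) else (\<lambda>_. 1))" for k
      have "(\<Prod>k\<in>I. g k (y k)) = (\<Prod>k\<in>{i, j}. g k (y k))" for y
        using ij I by (intro prod.mono_neutral_right) (auto simp: g_def)
      then have eq: "(\<Prod>k\<in>I. g k (y k)) = (h (y i) \<bullet> b) * (h (y j) \<bullet> b)" for y
        using ij by (simp add: g_def)
      have gi: "integrable D (g k)" for k using h by (simp add: g_def)
      have "integral\<^sup>L D (g i) = 0" using h by (simp add: g_def)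
      then have "(\<Prod>k\<in>I. integral\<^sup>L D (g k)) = 0"
        using ij I by (intro prod_zero) auto
      then show ?thesis
        using P.product_integrable_prod[OF I(1), of g] P.product_integral_prod[OF I(1), of g] gi by (simp add: eq)
    qed
    have e: "h (y i) \<bullet> h (y j) = (\<Sum>b\<in>Basis. (h (y i) \<bullet> b) * (h (y j) \<bullet> b))" for y
      by (rule euclidean_inner)
    show "integrable (PiM I (\<lambda>_. D)) (\<lambda>y. h (y i) \<bullet> h (y j))"
      unfolding e using c by auto
    show "(\<integral>y. h (y i) \<bullet> h (y j) \<partial>PiM I (\<lambda>_. D)) = 0"
      unfolding e using c by (subst Bochner_Integration.integral_sum) auto
  qed
  have expand: "(norm (z + (1 / n) *\<^sub>R (\<Sum>i\<in>I. h (y i))))\<^sup>2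
    = (norm z)\<^sup>2 + 2 / n * (\<Sum>i\<in>I. z \<bullet> h (y i)) + (1 / n)\<^sup>2 * (\<Sum>i\<in>I. \<Sum>j\<in>I. h (y i) \<bullet> h (y j))" for y
  proof -
    have "(norm (z + (1 / n) *\<^sub>R S))\<^sup>2 = (norm z)\<^sup>2 + 2 / n * (z \<bullet> S) + (1 / n)\<^sup>2 * (S \<bullet> S)" for S
      unfolding power2_norm_eq_inner
      by (simp add: inner_add_left inner_add_right inner_commute power2_eq_square)
    moreover have "(\<Sum>i\<in>I. h (y i)) \<bullet> (\<Sum>i\<in>I. h (y i)) = (\<Sum>i\<in>I. \<Sum>j\<in>I. h (y i) \<bullet> h (y j))"
      by (simp only: inner_sum_left) (simp only: inner_sum_right)
    ultimately show ?thesis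
      by (simp only: inner_sum_right)
  qed
  have int_ij: "integrable (PiM I (\<lambda>_. D)) (\<lambda>y. h (y i) \<bullet> h (y j))" if "i \<in> I" "j \<in> I" for i j
    using cross(1)[OF that] int2(1)[OF that(1)] by (cases "i = j") (auto simp: power2_norm_eq_inner)
  have int: "integrable (PiM I (\<lambda>_. D)) (\<lambda>y. (norm (z + (1 / n) *\<^sub>R (\<Sum>i\<in>I. h (y i))))\<^sup>2)"
    unfolding expand using int1(1) int_ij by (intro Bochner_Integration.integrable_add integrable_mult_right
        Bochner_Integration.integrable_sum) auto
  have zz: "(\<integral>y. (\<Sum>i\<in>I. z \<bullet> h (y i)) \<partial>PiM I (\<lambda>_. D)) = 0"
    using int1 by (subst Bochner_Integration.integral_sum) auto
  have "(\<integral>y. (\<Sum>i\<in>I. \<Sum>j\<in>I. h (y i) \<bullet> h (y j)) \<partial>PiM I (\<lambda>_. D))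
      = (\<Sum>i\<in>I. \<Sum>j\<in>I. \<integral>y. h (y i) \<bullet> h (y j) \<partial>PiM I (\<lambda>_. D))"
    using int_ij by (subst Bochner_Integration.integral_sum, auto intro!: Bochner_Integration.integrable_sum
        sum.cong Bochner_Integration.integral_sum)
  also have "\<dots> = (\<Sum>i\<in>I. \<Sum>j\<in>I. if j = i then \<integral>y. (norm (h (y i)))\<^sup>2 \<partial>PiM I (\<lambda>_. D) else 0)"
    using cross(2) by (intro sum.cong) (auto simp: power2_norm_eq_inner)
  also have "\<dots> = (\<Sum>i\<in>I. \<integral>y. (norm (h (y i)))\<^sup>2 \<partial>PiM I (\<lambda>_. D))"
    using I by simp
  also have "\<dots> \<le> (\<Sum>i\<in>I. v)" by (intro sum_mono int2)
  finally have hh: "(\<integral>y. (\<Sum>i\<in>I. \<Sum>j\<in>I. h (y i) \<bullet> h (y j)) \<partial>PiM I (\<lambda>_. D)) \<le> n * v"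
    by (simp add: n_def)
  have "(\<integral>y. (norm (z + (1 / n) *\<^sub>R (\<Sum>i\<in>I. h (y i))))\<^sup>2 \<partial>PiM I (\<lambda>_. D))
    = (norm z)\<^sup>2 + 2 / n * (\<integral>y. (\<Sum>i\<in>I. z \<bullet> h (y i)) \<partial>PiM I (\<lambda>_. D))
       + (1 / n)\<^sup>2 * (\<integral>y. (\<Sum>i\<in>I. \<Sum>j\<in>I. h (y i) \<bullet> h (y j)) \<partial>PiM I (\<lambda>_. D))"
    unfolding expand using int1(1) int_ij
    by (subst Bochner_Integration.integral_add Bochner_Integration.integral_mult_right;
        (intro Bochner_Integration.integrable_add integrable_mult_right Bochner_Integration.integrable_sum)?;
            auto simp: prob_space.prob_space[OF prob_space_PiM[OF D]])+
  also have "\<dots> \<le> (norm z)\<^sup>2 + (1 / n)\<^sup>2 * (n * v)"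
    using mult_left_mono[OF hh, of "(1 / n)\<^sup>2"] by (simp add: zz)
  also have "(1 / n)\<^sup>2 * (n * v) = v / n" using n by (simp add: power2_eq_square)
  finally show ?thesis
    using int unfolding n_def by (subst nn_integral_eq_integral) (auto intro: ennreal_leI)
qed


text \<open>Conditioning is replaced by a joint law: the outcome seen through \<open>H\<close>,
  paired with the batch, is distributed as a product. Fubini then freezes the history, and the
  estimate for a fixed vector and a fixed centred integrand applies pointwise.\<close>

lemma minibatch_second_moment:
  fixes g :: "'w \<Rightarrow> 's \<Rightarrow> 'e::euclidean_space" and \<xi> :: "'i \<Rightarrow> 'w \<Rightarrow> 's"
  assumes M: "prob_space M" and H: "subalgebra M H" and I: "finite I" "I \<noteq> {}"
    and \<xi>: "\<And>i. i \<in> I \<Longrightarrow> \<xi> i \<in> M \<rightarrow>\<^sub>M D" "\<And>i. i \<in> I \<Longrightarrow> distr M D (\<xi> i) = D"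
    and indep: "prob_space.indep_vars M (\<lambda>_. D) \<xi> I"
    and indepH: "prob_space.indep_set M (sets H) (sigma_sets (space M) {\<xi> i -` A \<inter> space M | i A. i \<in> I \<and> A
        \<in> sets D})"
    and g: "(\<lambda>(\<omega>, s). g \<omega> s) \<in> borel_measurable (H \<Otimes>\<^sub>M D)" and z: "z \<in> borel_measurable H"
    and mean: "\<And>\<omega>. \<omega> \<in> space M \<Longrightarrow> integrable D (g \<omega>)" "\<And>\<omega>. \<omega> \<in> space M \<Longrightarrow> (\<integral>s. g \<omega> s \<partial>D) = 0"
    and V: "\<And>\<omega>. \<omega> \<in> space M \<Longrightarrow> (\<integral>\<^sup>+ s. ennreal ((norm (g \<omega> s))\<^sup>2) \<partial>D) \<le> ennreal (V \<omega>)" "\<And>\<omega>. 0 \<le> V \<omega>"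
  shows "(\<integral>\<^sup>+ \<omega>. ennreal ((norm (z \<omega> + (1 / real (card I)) *\<^sub>R (\<Sum>i\<in>I. g \<omega> (\<xi> i \<omega>))))\<^sup>2) \<partial>M)
    \<le> (\<integral>\<^sup>+ \<omega>. ennreal ((norm (z \<omega>))\<^sup>2 + V \<omega> / real (card I)) \<partial>M)"
proof -
  interpret prob_space M by fact
  have D: "prob_space D"
    using \<xi> I prob_space_distr by (metis ex_in_conv)
  interpret D: prob_space D by fact
  \<comment> \<open>The identity into the coarser space plays the role of the random history; its
    law is \<open>M\<close> restricted to \<open>H\<close>.\<close>
  have idH: "id \<in> M \<rightarrow>\<^sub>M H" using H by (auto simp: subalgebra_def measurable_def sets.sets_into_space Int_absorb2)
  have spH: "space H = space M" using H by (simp add: subalgebra_def)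
  define \<Omega> where "\<Omega> = PiM I (\<lambda>_. D)"
  interpret Pi: prob_space \<Omega> unfolding \<Omega>_def by (intro prob_space_PiM D)
  define \<Xi> where "\<Xi> \<omega> = (\<lambda>i\<in>I. \<xi> i \<omega>)" for \<omega>
  define \<G> where "\<G> = {\<xi> i -` A \<inter> space M | i A. i \<in> I \<and> A \<in> sets D}"
  have \<Xi>M: "\<Xi> \<in> M \<rightarrow>\<^sub>M \<Omega>"
    unfolding \<Xi>_def \<Omega>_def using \<xi>(1) by (rule measurable_restrict)
  have distr_\<Xi>: "distr M \<Omega> \<Xi> = \<Omega>"
  proof -
    have "distr M (PiM I (\<lambda>_. D)) (\<lambda>x. \<lambda>i\<in>I. \<xi> i x) = PiM I (\<lambda>i. distr M D (\<xi> i))"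
      using indep_vars_iff_distr_eq_PiM'[OF I(2), where M'="\<lambda>_. D" and X=\<xi>] \<xi>(1) indep by auto
    also have "\<dots> = PiM I (\<lambda>i. D)"
      using \<xi>(2) by (intro PiM_cong) auto
    finally show ?thesis by (simp add: \<Xi>_def[abs_def] \<Omega>_def)
  qed
  have \<G>: "\<G> \<subseteq> Pow (space M)" by (auto simp: \<G>_def)
  have \<Xi>\<G>: "\<Xi> \<in> sigma (space M) \<G> \<rightarrow>\<^sub>M \<Omega>"
    unfolding \<Xi>_def \<Omega>_def
  proof (rule measurable_restrict, rule measurableI)
    fix i A assume "i \<in> I" "A \<in> sets D"
    then have "\<xi> i -` A \<inter> space M \<in> \<G>" by (auto simp: \<G>_def)
    then show "\<xi> i -` A \<inter> space (sigma (space M) \<G>) \<in> sets (sigma (space M) \<G>)"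
      using \<G> by auto
  next
    fix i \<omega> assume "i \<in> I" "\<omega> \<in> space (sigma (space M) \<G>)"
    then show "\<xi> i \<omega> \<in> space D"
      using \<G> measurable_space[OF \<xi>(1)] by (simp add: space_measure_of)
  qed
  have joint: "distr M H id \<Otimes>\<^sub>M \<Omega> = distr M (H \<Otimes>\<^sub>M \<Omega>) (\<lambda>x. (id x, \<Xi> x))"
  proof (rule pair_measure_eqI)
    show "sigma_finite_measure (distr M H id)"
      using prob_space_distr[OF idH] by (simp add: prob_space_imp_sigma_finite)
    show "sigma_finite_measure \<Omega>" ..
    show "sets (distr M H id \<Otimes>\<^sub>M \<Omega>) = sets (distr M (H \<Otimes>\<^sub>M \<Omega>) (\<lambda>x. (id x, \<Xi> x)))"
      by (simp cong: sets_pair_measure_cong)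
    fix A B assume "A \<in> sets (distr M H id)" and B: "B \<in> sets \<Omega>"
    then have A: "A \<in> sets H" by simp
    have "\<Xi> -` B \<inter> space M \<in> sigma_sets (space M) \<G>"
      using measurable_sets[OF \<Xi>\<G> B] \<G> by (simp add: space_measure_of sets_measure_of)
    then have AB: "prob (A \<inter> (\<Xi> -` B \<inter> space M)) = prob A * prob (\<Xi> -` B \<inter> space M)"
      using indep_setD[OF indepH A] by (simp add: \<G>_def)
    have "emeasure (distr M (H \<Otimes>\<^sub>M \<Omega>) (\<lambda>x. (id x, \<Xi> x))) (A \<times> B)
        = emeasure M ((\<lambda>x. (id x, \<Xi> x)) -` (A \<times> B) \<inter> space M)"
      using A B idH \<Xi>M by (intro emeasure_distr measurable_Pair) (auto simp: id_def)
    also have "(\<lambda>x. (id x, \<Xi> x)) -` (A \<times> B) \<inter> space M = A \<inter> (\<Xi> -` B \<inter> space M)"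
      by auto
    finally have 1: "emeasure (distr M (H \<Otimes>\<^sub>M \<Omega>) (\<lambda>x. (id x, \<Xi> x))) (A \<times> B)
        = ennreal (prob A * prob (\<Xi> -` B \<inter> space M))"
      by (simp add: emeasure_eq_measure AB)
    have 2: "emeasure (distr M H id) A = ennreal (prob A)"
      using A idH sets.sets_into_space[OF A] spH by (simp add: emeasure_distr emeasure_eq_measure Int_absorb2)
    have "emeasure \<Omega> B = emeasure (distr M \<Omega> \<Xi>) B" by (simp add: distr_\<Xi>)
    also have "\<dots> = ennreal (prob (\<Xi> -` B \<inter> space M))"
      using \<Xi>M B by (simp add: emeasure_distr emeasure_eq_measure)
    finally show "emeasure (distr M H id) A * emeasure \<Omega> B
        = emeasure (distr M (H \<Otimes>\<^sub>M \<Omega>) (\<lambda>x. (id x, \<Xi> x))) (A \<times> B)"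
      unfolding 1 2 by (simp add: ennreal_mult)
  qed
  define \<Phi> where "\<Phi> = (\<lambda>(\<omega>, y). ennreal ((norm (z \<omega> + (1 / real (card I)) *\<^sub>R (\<Sum>i\<in>I. g \<omega> (y i))))\<^sup>2))"
  have gi: "(\<lambda>x. g (fst x) (snd x i)) \<in> borel_measurable (H \<Otimes>\<^sub>M \<Omega>)" if "i \<in> I" for i
  proof -
    have "(\<lambda>x. (fst x, snd x i)) \<in> H \<Otimes>\<^sub>M \<Omega> \<rightarrow>\<^sub>M H \<Otimes>\<^sub>M D"
      using that unfolding \<Omega>_def by measurable
    from measurable_compose[OF this g] show ?thesis by simp
  qed
  have \<Phi>: "\<Phi> \<in> borel_measurable (H \<Otimes>\<^sub>M \<Omega>)"
    unfolding \<Phi>_def split_beta' using gi z by measurable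
  have "(\<integral>\<^sup>+ \<omega>. ennreal ((norm (z \<omega> + (1 / real (card I)) *\<^sub>R (\<Sum>i\<in>I. g \<omega> (\<xi> i \<omega>))))\<^sup>2) \<partial>M)
     = (\<integral>\<^sup>+ \<omega>. \<Phi> (id \<omega>, \<Xi> \<omega>) \<partial>M)"
    by (simp add: \<Phi>_def \<Xi>_def)
  also have "\<dots> = (\<integral>\<^sup>+ x. \<Phi> x \<partial>distr M (H \<Otimes>\<^sub>M \<Omega>) (\<lambda>x. (id x, \<Xi> x)))"
    by (rule nn_integral_distr[OF measurable_Pair[OF idH \<Xi>M], symmetric]) (simp add: \<Phi>)
  also have "\<dots> = (\<integral>\<^sup>+ \<omega>. \<integral>\<^sup>+ y. \<Phi> (\<omega>, y) \<partial>\<Omega> \<partial>distr M H id)"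
    unfolding joint[symmetric]
  proof (subst Pi.nn_integral_fst[symmetric])
    show "\<Phi> \<in> borel_measurable (distr M H id \<Otimes>\<^sub>M \<Omega>)"
      using \<Phi> by (simp cong: measurable_cong_sets sets_pair_measure_cong)
  qed simp
  also have "\<dots> \<le> (\<integral>\<^sup>+ \<omega>. ennreal ((norm (z \<omega>))\<^sup>2 + V \<omega> / real (card I)) \<partial>M)"
  proof -
    have "(\<lambda>\<omega>. \<integral>\<^sup>+ y. \<Phi> (\<omega>, y) \<partial>\<Omega>) \<in> borel_measurable H"
      using \<Phi> by measurable
    then have "(\<integral>\<^sup>+ \<omega>. \<integral>\<^sup>+ y. \<Phi> (\<omega>, y) \<partial>\<Omega> \<partial>distr M H id) = (\<integral>\<^sup>+ \<omega>. \<integral>\<^sup>+ y. \<Phi> (\<omega>, y) \<partial>\<Omega> \<partial>M)"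
      using idH by (subst nn_integral_distr) auto
    also have "\<dots> \<le> (\<integral>\<^sup>+ \<omega>. ennreal ((norm (z \<omega>))\<^sup>2 + V \<omega> / real (card I)) \<partial>M)"
      unfolding \<Phi>_def \<Omega>_def prod.case
      by (intro nn_integral_mono sample_mean_second_moment D I mean V)
    finally show ?thesis .
  qed
  finally show ?thesis .
qed

section \<open>The SPIDER recursion\<close>

text \<open>Unrolling back to the last refresh meets fewer than \<open>Q\<close> increments, and
  after exchanging the sums every \<open>d j\<close> is counted at most \<open>Q\<close>
  times.\<close>

lemma spider_recursion_sum:
  fixes a d :: "nat \<Rightarrow> real"
  assumes Q: "0 < Q" and d: "\<And>j. 0 \<le> d j" and t: "0 \<le> t"
    and refresh: "\<And>k. k < K \<Longrightarrow> k mod Q = 0 \<Longrightarrow> a k \<le> s"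
    and update: "\<And>k. k < K \<Longrightarrow> k mod Q \<noteq> 0 \<Longrightarrow> a k \<le> a (k - 1) + t * d (k - 1)"
  shows "(\<Sum>k<K. a k) \<le> real K * s + t * real Q * (\<Sum>k<K. d k)"
proof -
  have a: "a k \<le> s + t * (\<Sum>j\<in>{k - k mod Q..<k}. d j)" if "k < K" for k
    using that
  proof (induction k)
    case 0
    then show ?case using refresh[of 0] by simp
  next
    case (Suc m)
    show ?case
    proof (cases "Suc m mod Q = 0")
      case True
      then show ?thesis using refresh[OF Suc.prems] by simp
    next
      case False
      then have "Suc m mod Q = Suc (m mod Q)" by (simp add: mod_Suc split: if_splits)
      then have "Suc m - Suc m mod Q = m - m mod Q" by simp
      moreover have "m - m mod Q \<le> m" by simp
      ultimately have "(\<Sum>j\<in>{Suc m - Suc m mod Q..<Suc m}. d j) = (\<Sum>j\<in>{m - m mod Q..<m}. d j) + d m"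
        by simp
      then show ?thesis
        using update[OF Suc.prems False] Suc.IH Suc.prems by (simp add: algebra_simps)
    qed
  qed
  \<comment> \<open>The window back to the last refresh is enlarged to \<open>j < k < j + Q\<close>,
    a condition whose solutions \<open>k\<close> can be counted for fixed \<open>j\<close>.\<close>
  have b: "(\<Sum>j\<in>{k - k mod Q..<k}. d j) \<le> (\<Sum>j<K. if j < k \<and> k < j + Q then d j else 0)" if "k < K" for k
  proof -
    have "k mod Q < Q" using Q by simp
    then have "(\<Sum>j\<in>{k - k mod Q..<k}. d j) \<le> (\<Sum>j\<in>{j\<in>{..<K}. j < k \<and> k < j + Q}. d j)"
      using that d by (intro sum_mono2) auto
    then show ?thesis by (subst (asm) sum.inter_filter) auto
  qed
  have "(\<Sum>k<K. a k) \<le> (\<Sum>k<K. s + t * (\<Sum>j<K. if j < k \<and> k < j + Q then d j else 0))"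
    using a b t by (intro sum_mono order_trans[OF a] add_left_mono mult_left_mono) auto
  also have "\<dots> = real K * s + t * (\<Sum>k<K. \<Sum>j<K. if j < k \<and> k < j + Q then d j else 0)"
    by (simp add: sum.distrib sum_distrib_left)
  also have "(\<Sum>k<K. \<Sum>j<K. if j < k \<and> k < j + Q then d j else 0) = (\<Sum>j<K. \<Sum>k<K. if j < k \<and> k < j + Q then d j else 0)"
    by (rule sum.swap)
  also have "\<dots> \<le> (\<Sum>j<K. real Q * d j)"
  proof (intro sum_mono)
    fix j
    have "(\<Sum>k<K. if j < k \<and> k < j + Q then d j else 0) = real (card {k\<in>{..<K}. j < k \<and> k < j + Q}) * d j"
      by (simp add: sum.inter_filter[symmetric])
    also have "card {k\<in>{..<K}. j < k \<and> k < j + Q} \<le> card {j..<j + Q}"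
      by (intro card_mono) auto
    then have "real (card {k\<in>{..<K}. j < k \<and> k < j + Q}) * d j \<le> real Q * d j"
      using d by (intro mult_right_mono) auto
    finally show "(\<Sum>k<K. if j < k \<and> k < j + Q then d j else 0) \<le> real Q * d j" .
  qed
  finally show ?thesis
    using t by (simp add: sum_distrib_left mult.assoc mult_left_mono)
qed

lemma initial_segment_nat:
  fixes A :: "nat \<Rightarrow> bool"
  assumes "\<And>j k. A k \<Longrightarrow> j \<le> k \<Longrightarrow> A j"
  obtains n where "n \<le> K" "\<And>k. k < K \<Longrightarrow> A k \<longleftrightarrow> k < n"
proof (cases "\<forall>k<K. A k")
  case True
  then show ?thesis using that[of K] by auto
next
  case False
  then obtain m where m: "m < K" "\<not> A m" by auto
  define n where "n = (LEAST k. \<not> A k)"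
  have n: "\<not> A n" unfolding n_def using m(2) by (rule LeastI)
  have lt: "A k" if "k < n" for k using not_less_Least[of k "\<lambda>k. \<not> A k"] that by (simp add: n_def)
  have "n \<le> K" using Least_le[of "\<lambda>k. \<not> A k" m] m by (simp add: n_def)
  moreover have "A k \<longleftrightarrow> k < n" for k
    using n lt assms[of k n] by (cases "k < n") auto
  ultimately show ?thesis using that[of n] by blast
qed

section \<open>A measurable version of the oracle\<close>

locale lalm_oracle = lalm f c U P
  for f :: "real^'n \<Rightarrow> real" and c :: "real^'n \<Rightarrow> real^'m" and U P +
  fixes F :: "real^'n \<Rightarrow> 'xi \<Rightarrow> real" and D :: "'xi measure" and \<sigma>f Ls :: real
  assumes sampling: "oracle_assumption f F D U \<sigma>f Ls"
begin

lemma oracle_prob_space: "prob_space D" and Ls_nonneg: "0 \<le> Ls"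
  using sampling by (auto simp: oracle_assumption_def)

text \<open>The exceptional null set does not depend on the point, since the oracle will be
  evaluated at random iterates. The last clause is the mean-square Lipschitz bound in centred form,
  as an update of the estimate requires.\<close>

definition sampling_kernel :: "(real^'n \<Rightarrow> 'xi \<Rightarrow> real^'n) \<Rightarrow> bool" where
  "sampling_kernel \<G> \<longleftrightarrow>
    (\<lambda>(x, s). \<G> x s) \<in> borel_measurable (borel \<Otimes>\<^sub>M D) \<and>
    (AE s in D. \<forall>x\<in>U. \<G> x s = oracle_grad F x s) \<and>
    (\<forall>x\<in>U. integrable D (\<G> x) \<and> (\<integral>s. \<G> x s \<partial>D) = grad f x \<and>
       (\<integral>\<^sup>+ s. ennreal ((norm (\<G> x s - grad f x))\<^sup>2) \<partial>D) \<le> ennreal (\<sigma>f\<^sup>2)) \<and>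
    (\<forall>x\<in>U. \<forall>y\<in>U. (\<integral>\<^sup>+ s. ennreal ((norm (\<G> x s - \<G> y s - (grad f x - grad f y)))\<^sup>2) \<partial>D)
       \<le> ennreal (Ls\<^sup>2 * (norm (x - y))\<^sup>2))"

lemma sampling_kernelD:
  assumes "sampling_kernel \<G>"
  shows "(\<lambda>(x, s). \<G> x s) \<in> borel_measurable (borel \<Otimes>\<^sub>M D)"
    "AE s in D. \<forall>x\<in>U. \<G> x s = oracle_grad F x s"
    "\<And>x. x \<in> U \<Longrightarrow> integrable D (\<G> x)" "\<And>x. x \<in> U \<Longrightarrow> (\<integral>s. \<G> x s \<partial>D) = grad f x"
    "\<And>x. x \<in> U \<Longrightarrow> (\<integral>\<^sup>+ s. ennreal ((norm (\<G> x s - grad f x))\<^sup>2) \<partial>D) \<le> ennreal (\<sigma>f\<^sup>2)"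
    "\<And>x y. x \<in> U \<Longrightarrow> y \<in> U \<Longrightarrow>
      (\<integral>\<^sup>+ s. ennreal ((norm (\<G> x s - \<G> y s - (grad f x - grad f y)))\<^sup>2) \<partial>D) \<le> ennreal (Ls\<^sup>2 * (norm (x - y))\<^sup>2)"
  using assms by (auto simp: sampling_kernel_def)

text \<open>The oracle gradient itself need not be jointly measurable; the kernel differs from it on a null set of
    samples only.\<close>

lemma sampling_kernel_exists: "\<exists>\<G>. sampling_kernel \<G>"
proof -
  interpret D: prob_space D by (rule oracle_prob_space)
  have o1: "\<And>x. x \<in> U \<Longrightarrow> integrable D (F x)"
    and o2: "AE s in D. \<forall>x\<in>U. (\<lambda>y. F y s) differentiable (at x)"
    and o3: "\<And>x. x \<in> U \<Longrightarrow> integrable D (oracle_grad F x)" "\<And>x. x \<in> U \<Longrightarrow> (\<integral>s. oracle_grad F x s \<partial>D) = grad f x"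
    and o4: "\<And>x. x \<in> U \<Longrightarrow> integrable D (\<lambda>s. (norm (oracle_grad F x s - grad f x))\<^sup>2)"
      "\<And>x. x \<in> U \<Longrightarrow> (\<integral>s. (norm (oracle_grad F x s - grad f x))\<^sup>2 \<partial>D) \<le> \<sigma>f\<^sup>2"
    and o5: "\<And>x y. x \<in> U \<Longrightarrow> y \<in> U \<Longrightarrow> integrable D (\<lambda>s. (norm (oracle_grad F x s - oracle_grad F y s))\<^sup>2)"
      "\<And>x y. x \<in> U \<Longrightarrow> y \<in> U \<Longrightarrow> (\<integral>s. (norm (oracle_grad F x s - oracle_grad F y s))\<^sup>2 \<partial>D) \<le> Ls\<^sup>2 * (norm (x - y))\<^sup>2"
    using sampling unfolding oracle_assumption_def by blast+
  obtain N where N: "N \<in> null_sets D" "{s \<in> space D. \<not> (\<forall>x\<in>U. (\<lambda>y. F y s) differentiable (at x))} \<subseteq> N"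
    using o2 unfolding eventually_ae_filter by blast
  \<comment> \<open>Setting \<open>F\<close> to zero on the null set makes it differentiable on
    \<open>U\<close> for every sample, as \<open>borel_measurable_parametric_grad\<close>
    demands.\<close>
  define F' where "F' x s = (if s \<in> N then 0 else F x s)" for x s
  define \<G> where "\<G> x s = (if x \<in> U then grad (\<lambda>y. F' y s) x else 0)" for x s
  have [measurable]: "N \<in> sets D" using N by auto
  have m: "(\<lambda>(x, s). \<G> x s) \<in> borel_measurable (borel \<Otimes>\<^sub>M D)"
    unfolding \<G>_def
  proof (rule borel_measurable_parametric_grad[OF open_U])
    fix x assume x: "x \<in> U"
    have [measurable]: "F x \<in> borel_measurable D" using o1[OF x] by auto
    show "F' x \<in> borel_measurable D" unfolding F'_def[abs_def] by measurable
    fix s assume "s \<in> space D"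
    then show "(\<lambda>y. F' y s) differentiable (at x)"
      using N x by (cases "s \<in> N") (auto simp: F'_def)
  qed
  have eqs: "\<G> x s = oracle_grad F x s" if "x \<in> U" "s \<notin> N" for x s
    using that by (simp add: \<G>_def F'_def)
  have NAE: "AE s in D. s \<notin> N" using N AE_not_in by blast
  then have AE: "AE s in D. \<forall>x\<in>U. \<G> x s = oracle_grad F x s"
    using eqs by (auto elim: eventually_mono)
  have \<G>m[measurable]: "\<G> x \<in> borel_measurable D" for x
    using measurable_compose[OF measurable_Pair1' m, of x] by simp
  have AEx: "AE s in D. \<G> x s = oracle_grad F x s" if "x \<in> U" for x
    using AE that by auto
  have i: "integrable D (\<G> x)" if "x \<in> U" for x
    by (subst integrable_cong_AE[OF _ _ AEx[OF that]]) (use o3(1)[OF that] in auto)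
  have ii: "(\<integral>s. \<G> x s \<partial>D) = grad f x" if "x \<in> U" for x
    by (subst integral_cong_AE[OF _ _ AEx[OF that]]) (use o3[OF that] in auto)
  have iii: "(\<integral>\<^sup>+ s. ennreal ((norm (\<G> x s - grad f x))\<^sup>2) \<partial>D) \<le> ennreal (\<sigma>f\<^sup>2)" if "x \<in> U" for x
  proof -
    have "(\<integral>\<^sup>+ s. ennreal ((norm (\<G> x s - grad f x))\<^sup>2) \<partial>D) = (\<integral>\<^sup>+ s. ennreal ((norm (oracle_grad F x s
        - grad f x))\<^sup>2) \<partial>D)"
      by (rule nn_integral_cong_AE) (use AEx[OF that] in auto)
    also have "\<dots> \<le> ennreal (\<sigma>f\<^sup>2)"
      using o4[OF that] by (subst nn_integral_eq_integral) (auto intro: ennreal_leI)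
    finally show ?thesis .
  qed
  have iv: "(\<integral>\<^sup>+ s. ennreal ((norm (\<G> x s - \<G> y s - (grad f x - grad f y)))\<^sup>2) \<partial>D) \<le> ennreal (Ls\<^sup>2 * (norm (x
      - y))\<^sup>2)"
    if xy: "x \<in> U" "y \<in> U" for x y
  proof -
    have ae: "AE s in D. (norm (\<G> x s - \<G> y s))\<^sup>2 = (norm (oracle_grad F x s - oracle_grad F y s))\<^sup>2"
      using AEx[OF xy(1)] AEx[OF xy(2)] by eventually_elim simp
    have "(\<lambda>s. (norm (oracle_grad F x s - oracle_grad F y s))\<^sup>2) \<in> borel_measurable D"
      using o5(1)[OF xy] by auto
    then have int: "integrable D (\<lambda>s. (norm (\<G> x s - \<G> y s))\<^sup>2)"
      and le: "(\<integral>s. (norm (\<G> x s - \<G> y s))\<^sup>2 \<partial>D) \<le> Ls\<^sup>2 * (norm (x - y))\<^sup>2"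
      using o5[OF xy] integrable_cong_AE[OF _ _ ae] integral_cong_AE[OF _ _ ae] by auto
    have "(\<integral>\<^sup>+ s. ennreal ((norm (\<G> x s - \<G> y s - (grad f x - grad f y)))\<^sup>2) \<partial>D)
        \<le> ennreal (\<integral>s. (norm (\<G> x s - \<G> y s))\<^sup>2 \<partial>D)"
      using i ii xy int by (intro second_moment_centered_le) (auto simp: D.prob_space_axioms)
    also have "\<dots> \<le> ennreal (Ls\<^sup>2 * (norm (x - y))\<^sup>2)"
      using le by (rule ennreal_leI)
    finally show ?thesis .
  qed
  have "sampling_kernel \<G>"
    unfolding sampling_kernel_def using m AE i ii iii iv by blast
  then show ?thesis by blast
qed

end

section \<open>The stopped stochastic process\<close>

text \<open>The assumption \<open>good\<close> abstracts from how steps are kept in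
  \<open>U\<close>. Almost-sure admissibility is the case \<open>X = UNIV\<close>; for the
  safeguarded method \<open>good\<close> will follow from the neighbourhood of \<open>X\<close>.
  Both regimes thus share the estimates of steps and errors.\<close>

locale lalm_process = lalm_oracle f c U P F D \<sigma>f Ls + prob_space M
  for f :: "real^'n \<Rightarrow> real" and c :: "real^'n \<Rightarrow> real^'m" and U P
    and F :: "real^'n \<Rightarrow> 'xi \<Rightarrow> real" and D \<sigma>f Ls and M :: "'w measure" +
  fixes x0 :: "real^'n" and l0 :: "real^'m" and X :: "(real^'n) set" and K :: nat
    and H :: "nat \<Rightarrow> 'w measure" and \<xi> :: "nat \<Rightarrow> nat \<Rightarrow> 'w \<Rightarrow> 'xi"
    and x :: "nat \<Rightarrow> 'w \<Rightarrow> real^'n" and l :: "nat \<Rightarrow> 'w \<Rightarrow> real^'m"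
    and h p :: "nat \<Rightarrow> 'w \<Rightarrow> real^'n"
  assumes K: "2 \<le> K"
    and X: "X \<in> sets borel" "x0 \<in> X"
    and proc: "spider_process M D F c P (Q_of K) K (b_of P Ls K) x0 l0 X K H \<xi> x l h p"
    and good: "AE \<omega> in M. \<forall>k<K. (\<forall>j\<le>k. x j \<omega> \<in> X) \<longrightarrow>
      good_step (closest_point (cball 0 (G P)) (h k \<omega>)) (x k \<omega>) (l k \<omega>) (p k \<omega>) (x (Suc k) \<omega>) (l (Suc k) \<omega>)"
begin

abbreviation v where "v k \<omega> \<equiv> closest_point (cball 0 (G P)) (h k \<omega>)"

abbreviation good_at where
  "good_at k \<omega> \<equiv> good_step (v k \<omega>) (x k \<omega>) (l k \<omega>) (p k \<omega>) (x (Suc k) \<omega>) (l (Suc k) \<omega>)"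

text \<open>After an exit from \<open>X\<close> the sequences carry no information, so squared steps and errors are
  counted only while the run is active.\<close>

definition active where "active k \<omega> \<longleftrightarrow> (\<forall>j\<le>k. x j \<omega> \<in> X)"

text \<open>A Borel function on the whole space, whereas \<open>grad f\<close> is uncontrolled
  outside \<open>U\<close>.\<close>

definition gradU where "gradU y = (if y \<in> U then grad f y else 0)"

definition step_sq where "step_sq k \<omega> = (if active k \<omega> then (norm (p k \<omega>))\<^sup>2 else 0)"

text \<open>Tracks the unprojected \<open>h\<close>, because that is what the recursion propagates;
  the projected estimate used in the step is compared with it in
  \<open>active_good_run\<close>.\<close>

definition err_sq where "err_sq k \<omega> = (if active k \<omega> then (norm (h k \<omega> - gradU (x k \<omega>)))\<^sup>2 else 0)"

lemma step_sq_nonneg [simp]: "0 \<le> step_sq k \<omega>" and err_sq_nonneg [simp]: "0 \<le> err_sq k \<omega>"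
  by (auto simp: step_sq_def err_sq_def)

lemma active_mono: "active k \<omega> \<Longrightarrow> j \<le> k \<Longrightarrow> active j \<omega>"
  by (auto simp: active_def)

lemma H_subalgebra: "k \<le> K \<Longrightarrow> subalgebra M (H k)"
  using proc by (auto simp: spider_process_def)

lemma H_mono: "j \<le> k \<Longrightarrow> k \<le> K \<Longrightarrow> subalgebra (H k) (H j)"
proof (induction k rule: dec_induct)
  case base
  then show ?case by (simp add: subalgebra_def)
next
  case (step k)
  then have "subalgebra (H (Suc k)) (H k)" "subalgebra (H k) (H j)"
    using proc by (auto simp: spider_process_def)
  then show ?case by (auto simp: subalgebra_def)
qed

lemma measurable_H_mono: "g \<in> measurable (H j) N \<Longrightarrow> j \<le> k \<Longrightarrow> k \<le> K \<Longrightarrow> g \<in> measurable (H k) N"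
  using measurable_from_subalg[OF H_mono] by blast

lemma x_measurable: "j \<le> k \<Longrightarrow> k \<le> K \<Longrightarrow> x j \<in> borel_measurable (H k)"
  and l_measurable: "j \<le> k \<Longrightarrow> k \<le> K \<Longrightarrow> l j \<in> borel_measurable (H k)"
  by (rule measurable_H_mono[of _ j]; use proc in \<open>auto simp: spider_process_def\<close>)+

lemma h_measurable: "j < k \<Longrightarrow> k \<le> K \<Longrightarrow> h j \<in> borel_measurable (H k)"
  and p_measurable: "j < k \<Longrightarrow> k \<le> K \<Longrightarrow> p j \<in> borel_measurable (H k)"
  by (rule measurable_H_mono[of _ "Suc j"]; use proc in \<open>auto simp: spider_process_def\<close>)+

lemma gradU_measurable [measurable]: "gradU \<in> borel_measurable borel"
  unfolding gradU_def[abs_def] using continuous_on_grad open_U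
  by (intro borel_measurable_continuous_on_if) auto

lemma active_measurable: "j \<le> k \<Longrightarrow> k \<le> K \<Longrightarrow> Measurable.pred (H k) (active j)"
proof -
  assume jk: "j \<le> k" "k \<le> K"
  have "Measurable.pred (H k) (\<lambda>\<omega>. x i \<omega> \<in> X)" if "i \<in> {..j}" for i
    using measurable_sets[OF x_measurable[of i k] X(1)] that jk
    by (simp add: pred_def vimage_def Int_def conj_commute)
  then have "Measurable.pred (H k) (\<lambda>\<omega>. \<forall>i\<in>{..j}. x i \<omega> \<in> X)"
    by (rule pred_intros_finite(3)[OF finite_atMost])
  then show ?thesis
    unfolding active_def[abs_def] by (simp only: Ball_def atMost_iff)
qed

lemma step_sq_measurable: "j < k \<Longrightarrow> k \<le> K \<Longrightarrow> step_sq j \<in> borel_measurable (H k)"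
  and err_sq_measurable: "j < k \<Longrightarrow> k \<le> K \<Longrightarrow> err_sq j \<in> borel_measurable (H k)"
proof -
  assume jk: "j < k" "k \<le> K"
  have jk': "j \<le> k" using jk by simp
  note [measurable] = active_measurable[OF jk' jk(2)] x_measurable[OF jk' jk(2)] h_measurable[OF jk]
      p_measurable[OF jk]
  show "step_sq j \<in> borel_measurable (H k)" unfolding step_sq_def[abs_def] by measurable
  show "err_sq j \<in> borel_measurable (H k)" unfolding err_sq_def[abs_def] by measurable
qed

lemma step_sq_measurable_M [measurable]: "j < K \<Longrightarrow> step_sq j \<in> borel_measurable M"
  and err_sq_measurable_M [measurable]: "j < K \<Longrightarrow> err_sq j \<in> borel_measurable M"
  using step_sq_measurable[of j K] err_sq_measurable[of j K] measurable_from_subalg[OF H_subalgebra[of K]] by auto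

lemma Q_pos: "0 < Q_of K"
  using K by (simp add: Q_of_def)

lemma batch_pos: "0 < batch_size (Q_of K) K (b_of P Ls K) k"
  using K by (auto simp: batch_size_def b_of_def)

lemma AE_run:
  "AE \<omega> in M. \<forall>k<K. active k \<omega> \<longrightarrow>
     good_at k \<omega> \<and>
     h k \<omega> = spider_estimate F (Q_of K) K (b_of P Ls K) (\<lambda>k i. \<xi> k i \<omega>) (\<lambda>k. x k \<omega>) (\<lambda>k. h k \<omega>) k"
  and AE_init: "AE \<omega> in M. x 0 \<omega> = x0"
proof -
  have "AE \<omega> in M. spider_run F c P (Q_of K) K (b_of P Ls K) x0 l0 X K (\<lambda>k i. \<xi> k i \<omega>)
        (\<lambda>k. x k \<omega>) (\<lambda>k. l k \<omega>) (\<lambda>k. h k \<omega>) (\<lambda>k. p k \<omega>)"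
    using proc by (auto simp: spider_process_def)
  then show "AE \<omega> in M. x 0 \<omega> = x0"
    by eventually_elim (simp add: spider_run_def)
  show "AE \<omega> in M. \<forall>k<K. active k \<omega> \<longrightarrow>
     good_at k \<omega> \<and>
     h k \<omega> = spider_estimate F (Q_of K) K (b_of P Ls K) (\<lambda>k i. \<xi> k i \<omega>) (\<lambda>k. x k \<omega>) (\<lambda>k. h k \<omega>) k"
    using good \<open>AE \<omega> in M. spider_run _ _ _ _ _ _ _ _ _ _ _ _ _ _ _\<close>
    by eventually_elim (auto simp: spider_run_def active_def)
qed

lemma AE_step:
  assumes "k < K"
  shows "AE \<omega> in M. active k \<omega> \<longrightarrow>
     good_at k \<omega> \<and>
     h k \<omega> = spider_estimate F (Q_of K) K (b_of P Ls K) (\<lambda>k i. \<xi> k i \<omega>) (\<lambda>k. x k \<omega>) (\<lambda>k. h k \<omega>) k"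
  using AE_run by eventually_elim (use assms in auto)

lemma step_sq_le: "k < K \<Longrightarrow> AE \<omega> in M. step_sq k \<omega> \<le> (Delta P)\<^sup>2"
  by (drule AE_step, erule eventually_mono)
    (auto simp: step_sq_def dest: good_step_norm_p intro: power_mono)

lemma integrable_step_sq: "k < K \<Longrightarrow> integrable M (step_sq k)"
  using step_sq_le by (intro integrable_const_bound[where B="(Delta P)\<^sup>2"]) auto

lemma batch_facts:
  assumes k: "k < K"
  defines "I \<equiv> {1..batch_size (Q_of K) K (b_of P Ls K) k}"
  shows "\<And>i. i \<in> I \<Longrightarrow> \<xi> k i \<in> M \<rightarrow>\<^sub>M D" "\<And>i. i \<in> I \<Longrightarrow> distr M D (\<xi> k i) = D"
    "indep_vars (\<lambda>_. D) (\<xi> k) I"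
    "indep_set (sets (H k)) (sigma_sets (space M) {\<xi> k i -` A \<inter> space M | i A. i \<in> I \<and> A \<in> sets D})"
proof -
  show "\<xi> k i \<in> M \<rightarrow>\<^sub>M D" if "i \<in> I" for i
  proof -
    have "\<xi> k i \<in> H (Suc k) \<rightarrow>\<^sub>M D"
      using proc k that unfolding spider_process_def I_def by blast
    then show ?thesis
      using measurable_from_subalg[OF H_subalgebra[of "Suc k"]] k by auto
  qed
qed (use proc k in \<open>auto simp: spider_process_def I_def\<close>)

lemma AE_kernel:
  assumes k: "k < K" and ae: "AE s in D. Q s"
  shows "AE \<omega> in M. \<forall>i\<in>{1..batch_size (Q_of K) K (b_of P Ls K) k}. Q (\<xi> k i \<omega>)"
proof (rule AE_finite_allI)
  fix i assume i: "i \<in> {1..batch_size (Q_of K) K (b_of P Ls K) k}"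
  have "AE s in distr M D (\<xi> k i). Q s"
    unfolding batch_facts(2)[OF k i] by (rule ae)
  then show "AE \<omega> in M. Q (\<xi> k i \<omega>)"
    using batch_facts(1)[OF k i] AE_distrD by blast
qed simp

text \<open>At a refresh the error is a mean of centred samples at a point fixed by the history.
  Batch size \<open>K\<close> divides the variance by \<open>K\<close>, so that this level, present
  in all \<open>K\<close> iterations, adds up to \<open>\<sigma>f^2\<close>.\<close>

lemma err_sq_refresh:
  assumes k: "k < K" "k mod Q_of K = 0"
  shows "(\<integral>\<^sup>+ \<omega>. ennreal (err_sq k \<omega>) \<partial>M) \<le> ennreal (\<sigma>f\<^sup>2 / real K)"
proof -
  obtain \<G> where "sampling_kernel \<G>" using sampling_kernel_exists by blast
  note \<G> = sampling_kernelD[OF this]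
  interpret D: prob_space D by (rule oracle_prob_space)
  define n where "n = batch_size (Q_of K) K (b_of P Ls K) k"
  have n: "n = K" using k by (simp add: n_def batch_size_def)
  \<comment> \<open>Cut off by an event known before the batch; \<open>g\<close> vanishes off that
    event, so that centring and the variance bound hold at every outcome.\<close>
  define g where "g \<omega> s = (if active k \<omega> \<and> x k \<omega> \<in> U then \<G> (x k \<omega>) s - gradU (x k \<omega>) else 0)" for \<omega> s
  have [measurable]: "U \<in> sets borel" using open_U by simp
  have [measurable]: "active k \<in> measurable (H k) (count_space UNIV)" "x k \<in> borel_measurable (H k)"
    using active_measurable[of k k] x_measurable[of k k] k by auto
  have "(\<lambda>z. (x k (fst z), snd z)) \<in> H k \<Otimes>\<^sub>M D \<rightarrow>\<^sub>M borel \<Otimes>\<^sub>M D"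
    by measurable
  from measurable_compose[OF this \<G>(1)]
  have [measurable]: "(\<lambda>z. \<G> (x k (fst z)) (snd z)) \<in> borel_measurable (H k \<Otimes>\<^sub>M D)" by simp
  have gm: "(\<lambda>(\<omega>, s). g \<omega> s) \<in> borel_measurable (H k \<Otimes>\<^sub>M D)"
    unfolding g_def split_beta' by measurable
  have "(\<integral>\<^sup>+ \<omega>. ennreal (err_sq k \<omega>) \<partial>M)
    \<le> (\<integral>\<^sup>+ \<omega>. ennreal ((norm (0 + (1 / real (card {1..n})) *\<^sub>R (\<Sum>i\<in>{1..n}. g \<omega> (\<xi> k i \<omega>))))\<^sup>2) \<partial>M)"
  proof (rule nn_integral_mono_AE)
    show "AE \<omega> in M. ennreal (err_sq k \<omega>) \<le> ennreal ((norm (0 + (1 / real (card {1..n})) *\<^sub>R (\<Sum>i\<in>{1..n}. g \<omega>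
        (\<xi> k i \<omega>))))\<^sup>2)"
      using AE_step[OF k(1)] AE_kernel[OF k(1) \<G>(2)]
    proof eventually_elim
      case (elim \<omega>)
      show ?case
      proof (cases "active k \<omega>")
        case True
        with elim have xU: "x k \<omega> \<in> U" and h: "h k \<omega> = (1 / real K) *\<^sub>R (\<Sum>i=1..K. oracle_grad F (x k \<omega>) (\<xi> k i \<omega>))"
          using good_stepD(1) k by (auto simp: spider_estimate_def)
        have "(\<Sum>i\<in>{1..n}. g \<omega> (\<xi> k i \<omega>)) = (\<Sum>i=1..K. oracle_grad F (x k \<omega>) (\<xi> k i \<omega>)) - real K *\<^sub>R gradU (x k \<omega>)"
          using elim(2) True xU
          by (simp add: g_def n[unfolded n_def] n sum_subtractf sum_constant_scaleR del: sum_constant)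
        then have "0 + (1 / real (card {1..n})) *\<^sub>R (\<Sum>i\<in>{1..n}. g \<omega> (\<xi> k i \<omega>)) = h k \<omega> - gradU (x k \<omega>)"
          using K by (simp add: h n scaleR_diff_right)
        then show ?thesis using True by (simp add: err_sq_def)
      qed (simp add: err_sq_def)
    qed
  qed
  also have "\<dots> \<le> (\<integral>\<^sup>+ \<omega>. ennreal ((norm (0::real^'n))\<^sup>2 + \<sigma>f\<^sup>2 / real (card {1..n})) \<partial>M)"
  proof (rule minibatch_second_moment[OF prob_space_axioms H_subalgebra[of k] _ _ _ _ _ _ gm])
    show "{1..n} \<noteq> {}" using batch_pos[of k] by (simp add: n_def)
    fix \<omega> assume "\<omega> \<in> space M"
    have "g \<omega> = (if active k \<omega> \<and> x k \<omega> \<in> U then (\<lambda>s. \<G> (x k \<omega>) s - gradU (x k \<omega>)) else (\<lambda>_. 0))"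
      by (auto simp: g_def)
    then show "integrable D (g \<omega>)" "(\<integral>s. g \<omega> s \<partial>D) = 0"
      using \<G>(3,4)[of "x k \<omega>"] by (auto simp: gradU_def D.prob_space)
    show "(\<integral>\<^sup>+ s. ennreal ((norm (g \<omega> s))\<^sup>2) \<partial>D) \<le> ennreal (\<sigma>f\<^sup>2)"
      using \<G>(5)[of "x k \<omega>"] by (cases "active k \<omega> \<and> x k \<omega> \<in> U") (auto simp: g_def gradU_def)
  qed (use batch_facts[OF k(1)] k in \<open>auto simp: n_def\<close>)
  finally show ?thesis
    by (simp add: n emeasure_space_1)
qed


text \<open>The new error is the old one plus a mean of centred gradient differences, orthogonal to
  the past; their variance is controlled by the displacement and hence by the squared step.\<close>

lemma err_sq_update:
  assumes k: "k < K" "k mod Q_of K \<noteq> 0"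
  shows "(\<integral>\<^sup>+ \<omega>. ennreal (err_sq k \<omega>) \<partial>M)
    \<le> (\<integral>\<^sup>+ \<omega>. ennreal (err_sq (k - 1) \<omega> + Ls\<^sup>2 * (chi_cor P)\<^sup>2 / real (b_of P Ls K) * step_sq (k - 1) \<omega>) \<partial>M)"
proof -
  obtain \<G> where "sampling_kernel \<G>" using sampling_kernel_exists by blast
  note \<G> = sampling_kernelD[OF this]
  interpret D: prob_space D by (rule oracle_prob_space)
  obtain j where kj: "k = Suc j" using k(2) by (cases k) auto
  define n where "n = batch_size (Q_of K) K (b_of P Ls K) k"
  have n: "n = b_of P Ls K" using k by (simp add: n_def batch_size_def)
  have n0: "0 < n" using batch_pos[of k] by (simp add: n_def)
  define in_U where "in_U \<omega> \<longleftrightarrow> active k \<omega> \<and> x k \<omega> \<in> U \<and> x j \<omega> \<in> U" for \<omega>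
  define g where "g \<omega> s = (if in_U \<omega> then (\<G> (x k \<omega>) s - \<G> (x j \<omega>) s) - (gradU (x k \<omega>) - gradU (x j \<omega>)) else 0)"
      for \<omega> s
  \<comment> \<open>Cut off by activity at the new index, where the update takes place; this event
    lies inside the one that cuts off \<open>err_sq j\<close>.\<close>
  define z where "z \<omega> = (if active k \<omega> then h j \<omega> - gradU (x j \<omega>) else 0)" for \<omega>
  define V where "V \<omega> = (if in_U \<omega> then Ls\<^sup>2 * (norm (x k \<omega> - x j \<omega>))\<^sup>2 else 0)" for \<omega>
  have [measurable]: "U \<in> sets borel" using open_U by simp
  have [measurable]: "active k \<in> measurable (H k) (count_space UNIV)" "x k \<in> borel_measurable (H k)"
    "x j \<in> borel_measurable (H k)" "h j \<in> borel_measurable (H k)"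
    using active_measurable[of k k] x_measurable[of k k] x_measurable[of j k] h_measurable[of j k] k kj by auto
  have kernel_meas: "(\<lambda>z. \<G> (y (fst z)) (snd z)) \<in> borel_measurable (H k \<Otimes>\<^sub>M D)" if [measurable]: "y
      \<in> borel_measurable (H k)" for y
  proof -
    have "(\<lambda>z. (y (fst z), snd z)) \<in> H k \<Otimes>\<^sub>M D \<rightarrow>\<^sub>M borel \<Otimes>\<^sub>M D"
      by measurable
    from measurable_compose[OF this \<G>(1)] show ?thesis by simp
  qed
  have [measurable]: "(\<lambda>z. \<G> (x k (fst z)) (snd z)) \<in> borel_measurable (H k \<Otimes>\<^sub>M D)"
    "(\<lambda>z. \<G> (x j (fst z)) (snd z)) \<in> borel_measurable (H k \<Otimes>\<^sub>M D)"
    by (rule kernel_meas; measurable)+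
  have gm: "(\<lambda>(\<omega>, s). g \<omega> s) \<in> borel_measurable (H k \<Otimes>\<^sub>M D)"
    unfolding g_def split_beta' in_U_def by measurable
  have zm: "z \<in> borel_measurable (H k)"
    unfolding z_def[abs_def] by measurable
  have "(\<integral>\<^sup>+ \<omega>. ennreal (err_sq k \<omega>) \<partial>M)
    \<le> (\<integral>\<^sup>+ \<omega>. ennreal ((norm (z \<omega> + (1 / real (card {1..n})) *\<^sub>R (\<Sum>i\<in>{1..n}. g \<omega> (\<xi> k i \<omega>))))\<^sup>2) \<partial>M)"
  proof (rule nn_integral_mono_AE)
    have jK: "j < K" using k kj by simp
    show "AE \<omega> in M. ennreal (err_sq k \<omega>) \<le> ennreal ((norm (z \<omega> + (1 / real (card {1..n})) *\<^sub>R (\<Sum>i\<in>{1..n}. g \<omega>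
        (\<xi> k i \<omega>))))\<^sup>2)"
      using AE_step[OF k(1)] AE_step[OF jK] AE_kernel[OF k(1) \<G>(2)]
    proof eventually_elim
      case (elim \<omega>)
      show ?case
      proof (cases "active k \<omega>")
        case True
        then have "active j \<omega>" using active_mono kj by auto
        with True elim have xU: "x k \<omega> \<in> U" "x j \<omega> \<in> U"
          and h: "h k \<omega> = h j \<omega> + (1 / real n) *\<^sub>R (\<Sum>i=1..n. oracle_grad F (x k \<omega>) (\<xi> k i \<omega>) - oracle_grad F
              (x j \<omega>) (\<xi> k i \<omega>))"
          using good_stepD(1) k by (auto simp: spider_estimate_def n kj)
        then have iU: "in_U \<omega>" using True by (simp add: in_U_def)
        have "(\<Sum>i\<in>{1..n}. g \<omega> (\<xi> k i \<omega>))
          = (\<Sum>i\<in>{1..n}. oracle_grad F (x k \<omega>) (\<xi> k i \<omega>) - oracle_grad F (x j \<omega>) (\<xi> k i \<omega>) - (gradU (x k \<omega>)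
              - gradU (x j \<omega>)))"
          using elim(3) xU iU by (intro sum.cong) (auto simp: g_def n_def)
        also have "\<dots> = (\<Sum>i=1..n. oracle_grad F (x k \<omega>) (\<xi> k i \<omega>) - oracle_grad F (x j \<omega>) (\<xi> k i \<omega>)) - real n *\<^sub>R
            (gradU (x k \<omega>) - gradU (x j \<omega>))"
          by (subst sum_subtractf) (simp add: sum_constant_scaleR del: sum_constant)
        finally have "z \<omega> + (1 / real (card {1..n})) *\<^sub>R (\<Sum>i\<in>{1..n}. g \<omega> (\<xi> k i \<omega>)) = h k \<omega> - gradU (x k \<omega>)"
          using n0 True by (simp add: h z_def scaleR_diff_right[of "1 / real n" _ "real n *\<^sub>R _"])
        then show ?thesis using True by (simp add: err_sq_def)
      qed (simp add: err_sq_def)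
    qed
  qed
  also have "\<dots> \<le> (\<integral>\<^sup>+ \<omega>. ennreal ((norm (z \<omega>))\<^sup>2 + V \<omega> / real (card {1..n})) \<partial>M)"
  proof (rule minibatch_second_moment[OF prob_space_axioms H_subalgebra[of k] _ _ _ _ _ _ gm zm])
    show "{1..n} \<noteq> {}" using n0 by simp
    fix \<omega> assume "\<omega> \<in> space M"
    have "g \<omega> = (if in_U \<omega> then (\<lambda>s. (\<G> (x k \<omega>) s - \<G> (x j \<omega>) s) - (gradU (x k \<omega>) - gradU (x j \<omega>))) else (\<lambda>_. 0))"
      by (auto simp: g_def)
    then show "integrable D (g \<omega>)" "(\<integral>s. g \<omega> s \<partial>D) = 0"
      using \<G>(3,4)[of "x k \<omega>"] \<G>(3,4)[of "x j \<omega>"] by (auto simp: in_U_def gradU_def D.prob_space)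
    show "(\<integral>\<^sup>+ s. ennreal ((norm (g \<omega> s))\<^sup>2) \<partial>D) \<le> ennreal (V \<omega>)"
      using \<G>(6)[of "x k \<omega>" "x j \<omega>"] by (auto simp: g_def V_def in_U_def gradU_def)
  next
    show "0 \<le> V \<omega>" for \<omega> by (simp add: V_def)
  qed (use batch_facts[OF k(1)] k in \<open>auto simp: n_def\<close>)
  also have "\<dots> \<le> (\<integral>\<^sup>+ \<omega>. ennreal (err_sq (k - 1) \<omega> + Ls\<^sup>2 * (chi_cor P)\<^sup>2 / real (b_of P Ls K) * step_sq (k
      - 1) \<omega>) \<partial>M)"
  proof (rule nn_integral_mono_AE)
    have jK: "j < K" using k kj by simp
    show "AE \<omega> in M. ennreal ((norm (z \<omega>))\<^sup>2 + V \<omega> / real (card {1..n}))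
        \<le> ennreal (err_sq (k - 1) \<omega> + Ls\<^sup>2 * (chi_cor P)\<^sup>2 / real (b_of P Ls K) * step_sq (k - 1) \<omega>)"
      using AE_step[OF jK]
    proof eventually_elim
      case (elim \<omega>)
      have 1: "(norm (z \<omega>))\<^sup>2 \<le> err_sq j \<omega>"
        using active_mono[of k \<omega> j] kj by (auto simp: z_def err_sq_def)
      have 2: "V \<omega> \<le> Ls\<^sup>2 * (chi_cor P)\<^sup>2 * step_sq j \<omega>"
      proof (cases "in_U \<omega>")
        case True
        then have "active j \<omega>" using active_mono[of k \<omega> j] kj by (auto simp: in_U_def)
        then have "(norm (x k \<omega> - x j \<omega>))\<^sup>2 \<le> (chi_cor P * norm (p j \<omega>))\<^sup>2"
          using elim good_step_displacement(1) unfolding kj by (intro power_mono) auto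
        then show ?thesis
          using True \<open>active j \<omega>\<close> by (simp add: V_def step_sq_def power_mult_distrib mult.assoc mult_left_mono)
      qed (simp add: V_def)
      have "V \<omega> / real n \<le> Ls\<^sup>2 * (chi_cor P)\<^sup>2 * step_sq j \<omega> / real n"
        using 2 by (rule divide_right_mono) simp
      with 1 show ?case
        by (intro ennreal_leI) (simp add: kj n)
    qed
  qed
  finally show ?thesis .
qed

text \<open>Unlike the steps, the errors come with no almost sure bound, so finiteness of their
  second moments is handed on from each refresh through the updates. Without it, an expectation
  taken as a real number would carry no information.\<close>

lemma integrable_err_sq: "k < K \<Longrightarrow> integrable M (err_sq k)"
proof (induction k)
  case 0
  show ?case
    using err_sq_refresh[of 0] 0 by (intro integrableI_nonneg) (auto intro: le_less_trans)
next
  case (Suc k)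
  show ?case
  proof (cases "Suc k mod Q_of K = 0")
    case True
    then show ?thesis
      using err_sq_refresh[of "Suc k"] Suc.prems by (intro integrableI_nonneg) (auto intro: le_less_trans)
  next
    case False
    have "integrable M (\<lambda>\<omega>. err_sq k \<omega> + Ls\<^sup>2 * (chi_cor P)\<^sup>2 / real (b_of P Ls K) * step_sq k \<omega>)"
      using Suc integrable_step_sq[of k] by (intro Bochner_Integration.integrable_add integrable_mult_right) auto
    then have "(\<integral>\<^sup>+ \<omega>. ennreal (err_sq k \<omega> + Ls\<^sup>2 * (chi_cor P)\<^sup>2 / real (b_of P Ls K) * step_sq k \<omega>) \<partial>M) < \<infinity>"
      by (subst nn_integral_eq_integral) auto
    then show ?thesis
      using err_sq_update[of "Suc k"] False Suc.prems by (intro integrableI_nonneg) (auto intro: le_less_trans)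
  qed
qed

lemma expectation_err_sq:
  assumes "k < K"
  shows "k mod Q_of K = 0 \<Longrightarrow> expectation (err_sq k) \<le> \<sigma>f\<^sup>2 / real K"
    "k mod Q_of K \<noteq> 0 \<Longrightarrow> expectation (err_sq k)
      \<le> expectation (err_sq (k - 1)) + Ls\<^sup>2 * (chi_cor P)\<^sup>2 / real (b_of P Ls K) * expectation (step_sq (k - 1))"
proof -
  have nn: "(\<integral>\<^sup>+ \<omega>. ennreal (err_sq k \<omega>) \<partial>M) = ennreal (expectation (err_sq k))"
    using integrable_err_sq[OF assms] by (intro nn_integral_eq_integral) auto
  show "expectation (err_sq k) \<le> \<sigma>f\<^sup>2 / real K" if "k mod Q_of K = 0"
    using err_sq_refresh[OF assms that] unfolding nn by (subst (asm) ennreal_le_iff) auto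
  assume *: "k mod Q_of K \<noteq> 0"
  have k1: "k - 1 < K" using assms by simp
  have int: "integrable M (\<lambda>\<omega>. err_sq (k - 1) \<omega> + Ls\<^sup>2 * (chi_cor P)\<^sup>2 / real (b_of P Ls K) * step_sq (k - 1) \<omega>)"
    using integrable_err_sq[OF k1] integrable_step_sq[OF k1] by auto
  have "expectation (err_sq k) \<le> expectation (\<lambda>\<omega>. err_sq (k - 1) \<omega> + Ls\<^sup>2 * (chi_cor P)\<^sup>2 / real
      (b_of P Ls K) * step_sq (k - 1) \<omega>)"
    using err_sq_update[OF assms *] unfolding nn
    by (subst (asm) nn_integral_eq_integral[OF int]) (auto simp: ennreal_le_iff intro!:
        Bochner_Integration.integral_nonneg)
  also have "\<dots> = expectation (err_sq (k - 1)) + Ls\<^sup>2 * (chi_cor P)\<^sup>2 / real (b_of P Ls K) * expectation (step_sq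
      (k - 1))"
    using integrable_err_sq[OF k1] integrable_step_sq[OF k1] by simp
  finally show "expectation (err_sq k)
      \<le> expectation (err_sq (k - 1)) + Ls\<^sup>2 * (chi_cor P)\<^sup>2 / real (b_of P Ls K) * expectation (step_sq (k - 1))" .
qed

section \<open>Coupling steps and gradient errors\<close>

text \<open>The true gradient lies in the ball of radius \<open>G P\<close> and is fixed by the
  projection; nonexpansiveness then shows that projecting the estimate does not increase its
  error.\<close>

lemma active_good_run:
  assumes run: "\<forall>k<K. active k \<omega> \<longrightarrow> good_at k \<omega>"
    and n: "n \<le> K" "\<And>k. k < n \<Longrightarrow> active k \<omega>"
  shows "good_run n (\<lambda>k. v k \<omega>) (\<lambda>k. x k \<omega>) (\<lambda>k. l k \<omega>) (\<lambda>k. p k \<omega>)"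
    "\<And>k. k < n \<Longrightarrow> (norm (v k \<omega> - grad f (x k \<omega>)))\<^sup>2 \<le> err_sq k \<omega>"
    "\<And>k. k < n \<Longrightarrow> (norm (p k \<omega>))\<^sup>2 = step_sq k \<omega>"
proof -
  show "good_run n (\<lambda>k. v k \<omega>) (\<lambda>k. x k \<omega>) (\<lambda>k. l k \<omega>) (\<lambda>k. p k \<omega>)"
    using assms by (auto simp: good_run_def)
  fix k assume k: "k < n"
  then have step: "good_at k \<omega>" using assms by auto
  show "(norm (p k \<omega>))\<^sup>2 = step_sq k \<omega>" using k n by (simp add: step_sq_def)
  have U: "x k \<omega> \<in> U" using good_stepD(1)[OF step] .
  have "dist (v k \<omega>) (closest_point (cball 0 (G P)) (grad f (x k \<omega>))) \<le> dist (h k \<omega>) (grad f (x k \<omega>))"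
    using less_imp_le[OF param_pos(1)] by (intro closest_point_lipschitz) (auto simp: cball_eq_empty not_less)
  moreover have "closest_point (cball 0 (G P)) (grad f (x k \<omega>)) = grad f (x k \<omega>)"
    using norm_grad_le[OF U] by (intro closest_point_self) auto
  ultimately have "norm (v k \<omega> - grad f (x k \<omega>)) \<le> norm (h k \<omega> - grad f (x k \<omega>))"
    by (simp add: dist_norm)
  then show "(norm (v k \<omega> - grad f (x k \<omega>)))\<^sup>2 \<le> err_sq k \<omega>"
    using k n U by (simp add: err_sq_def gradU_def power_mono)
qed

text \<open>Along each path the active indices below \<open>K\<close> form an initial segment, on
  which the run estimate applies; all later terms are zero.\<close>

lemma AE_sum_step_sq: "AE \<omega> in M. (\<Sum>k<K. step_sq k \<omega>) \<le> D0_const f x0 P + D1_const P * (\<Sum>k<K. err_sq k \<omega>)"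
  using AE_run AE_init
proof eventually_elim
  case (elim \<omega>)
  obtain n where n: "n \<le> K" "\<And>k. k < K \<Longrightarrow> active k \<omega> \<longleftrightarrow> k < n"
    using initial_segment_nat[of "\<lambda>k. active k \<omega>" K] active_mono by blast
  have act: "active k \<omega>" if "k < n" for k using n that by auto
  have n0: "0 < n" using n(2)[of 0] K elim X(2) by (auto simp: active_def)
  note run = active_good_run[OF _ n(1) act]
  have "\<forall>k<K. active k \<omega> \<longrightarrow> good_at k \<omega>"
    using elim by auto
  note run = run[OF this]
  have "(\<Sum>k<K. step_sq k \<omega>) = (\<Sum>k<n. step_sq k \<omega>)"
    using n by (intro sum.mono_neutral_right) (auto simp: step_sq_def)
  also have "\<dots> = (\<Sum>k<n. (norm (p k \<omega>))\<^sup>2)"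
    using run(3) by simp
  also have "\<dots> \<le> D0_const f (x 0 \<omega>) P + D1_const P * (\<Sum>k<n. (norm (v k \<omega> - grad f (x k \<omega>)))\<^sup>2)"
    by (rule good_run_sum_le[OF run(1) n0]) auto
  also have "\<dots> \<le> D0_const f (x 0 \<omega>) P + D1_const P * (\<Sum>k<n. err_sq k \<omega>)"
    using run(2) by (intro add_left_mono mult_left_mono sum_mono) (auto intro: less_imp_le)
  also have "\<dots> \<le> D0_const f (x 0 \<omega>) P + D1_const P * (\<Sum>k<K. err_sq k \<omega>)"
    using n(1) by (intro add_left_mono mult_left_mono sum_mono2) (auto intro: less_imp_le)
  finally show ?case using elim by simp
qed

text \<open>The batch size \<open>b_of\<close> makes the coefficient of the step sum at most
  \<open>1 / (2 * D1_const P)\<close>, so inserting one inequality into the other returns half of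
  the error sum. Solving for that sum gives precisely \<open>Gamma_e\<close>.\<close>

lemma expected_sums:
  shows "(\<Sum>k<K. expectation (err_sq k)) \<le> Gamma_e f x0 P \<sigma>f"
    "(\<Sum>k<K. expectation (step_sq k)) \<le> D0_const f x0 P + D1_const P * Gamma_e f x0 P \<sigma>f"
proof -
  define Se where "Se = (\<Sum>k<K. expectation (err_sq k))"
  define Sp where "Sp = (\<Sum>k<K. expectation (step_sq k))"
  define b where "b = real (b_of P Ls K)"
  define t where "t = Ls\<^sup>2 * (chi_cor P)\<^sup>2 / b"
  have b: "0 < b" "2 * D1_const P * Ls\<^sup>2 * (chi_cor P)\<^sup>2 * real (Q_of K) \<le> b"
    unfolding b_def b_of_def by linarith+
  have "Sp = expectation (\<lambda>\<omega>. \<Sum>k<K. step_sq k \<omega>)"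
    unfolding Sp_def using integrable_step_sq by (subst Bochner_Integration.integral_sum) auto
  also have "\<dots> \<le> expectation (\<lambda>\<omega>. D0_const f x0 P + D1_const P * (\<Sum>k<K. err_sq k \<omega>))"
    using AE_sum_step_sq integrable_step_sq integrable_err_sq
    by (intro integral_mono_AE Bochner_Integration.integrable_add integrable_mult_right
        Bochner_Integration.integrable_sum) auto
  also have "\<dots> = D0_const f x0 P + D1_const P * expectation (\<lambda>\<omega>. \<Sum>k<K. err_sq k \<omega>)"
    using integrable_err_sq by (subst Bochner_Integration.integral_add) (auto simp: prob_space)
  also have "expectation (\<lambda>\<omega>. \<Sum>k<K. err_sq k \<omega>) = Se"
    unfolding Se_def using integrable_err_sq by (subst Bochner_Integration.integral_sum) auto
  finally have Sp: "Sp \<le> D0_const f x0 P + D1_const P * Se" .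
  have "Se \<le> real K * (\<sigma>f\<^sup>2 / real K) + t * real (Q_of K) * Sp"
    unfolding Se_def Sp_def
    using expectation_err_sq b by (intro spider_recursion_sum Q_pos)
        (auto simp: t_def b_def intro!: Bochner_Integration.integral_nonneg)
  also have "real K * (\<sigma>f\<^sup>2 / real K) = \<sigma>f\<^sup>2" using K by simp
  also have "t * real (Q_of K) \<le> 1 / (2 * D1_const P)"
    using b D1_pos by (simp add: t_def field_simps)
  finally have "Se \<le> \<sigma>f\<^sup>2 + 1 / (2 * D1_const P) * Sp"
    by (simp add: Sp_def mult_right_mono Bochner_Integration.integral_nonneg sum_nonneg)
  also have "1 / (2 * D1_const P) * Sp \<le> 1 / (2 * D1_const P) * (D0_const f x0 P + D1_const P * Se)"
    using Sp D1_pos by (intro mult_left_mono) (auto intro: less_imp_le)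
  also have "\<dots> = D0_const f x0 P / D1_const P / 2 + Se / 2"
    using less_imp_neq[OF D1_pos] by (simp add: field_simps)
  finally have Se: "Se \<le> Gamma_e f x0 P \<sigma>f"
    by (simp add: Gamma_e_def)
  then show "(\<Sum>k<K. expectation (err_sq k)) \<le> Gamma_e f x0 P \<sigma>f" by (simp add: Se_def)
  have "D1_const P * Se \<le> D1_const P * Gamma_e f x0 P \<sigma>f"
    using Se D1_pos by (intro mult_left_mono) (auto intro: less_imp_le)
  then show "(\<Sum>k<K. expectation (step_sq k)) \<le> D0_const f x0 P + D1_const P * Gamma_e f x0 P \<sigma>f"
    using Sp unfolding Sp_def by linarith
qed

end

section \<open>Output bounds and exit probability\<close>

lemma accepted_iff: "accepted K X x \<longleftrightarrow> (\<forall>k\<in>{1..K}. x k \<in> X)"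
proof
  assume acc: "accepted K X x"
  show "\<forall>k\<in>{1..K}. x k \<in> X"
  proof (intro ballI, rule ccontr)
    fix k assume k: "k \<in> {1..K}" "x k \<notin> X"
    then have "exit_time X x \<le> enat k"
      unfolding exit_time_def by (intro INF_lower) auto
    also have "\<dots> \<le> enat K" using k by simp
    finally show False using acc by (simp add: accepted_def)
  qed
next
  assume "\<forall>k\<in>{1..K}. x k \<in> X"
  then have "enat (Suc K) \<le> exit_time X x"
    unfolding exit_time_def by (intro INF_greatest) (auto simp: not_less_eq_eq[symmetric])
  then show "accepted K X x"
    unfolding accepted_def by (metis Suc_ile_eq)
qed

lemma attempt_length_le: "attempt_length K X x \<le> K"
  unfolding attempt_length_def by (cases "min (exit_time X x) (enat K)") (auto simp: min_def split: if_splits)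

lemma (in prob_space) uniform_indexD:
  assumes khat: "uniform_index M K \<A> khat" and K: "2 \<le> K"
  shows "khat \<in> M \<rightarrow>\<^sub>M count_space UNIV" "AE \<omega> in M. khat \<omega> \<in> {1..<K}"
    "\<And>k. k \<in> {1..<K} \<Longrightarrow> prob (khat -` {k} \<inter> space M) = 1 / real (K - 1)"
    "\<And>k A. A \<in> \<A> \<Longrightarrow> prob ((khat -` {k} \<inter> space M) \<inter> A) = prob (khat -` {k} \<inter> space M) * prob A"
proof -
  have S: "finite {1..K - 1}" "{1..K - 1} \<noteq> {}" "{1..K - 1} = {1..<K}" using K by auto
  show m: "khat \<in> M \<rightarrow>\<^sub>M count_space UNIV"
    using khat by (simp add: uniform_index_def)
  have d: "distr M (count_space UNIV) khat = measure_pmf (pmf_of_set {1..K - 1})"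
    using khat by (simp add: uniform_index_def)
  have "AE k in measure_pmf (pmf_of_set {1..K - 1}). k \<in> {1..<K}"
    using S by (simp add: AE_measure_pmf_iff)
  then show "AE \<omega> in M. khat \<omega> \<in> {1..<K}"
    unfolding d[symmetric] using AE_distrD[OF m] by blast
  show "prob (khat -` {k} \<inter> space M) = 1 / real (K - 1)" if k: "k \<in> {1..<K}" for k
  proof -
    have "prob (khat -` {k} \<inter> space M) = measure (distr M (count_space UNIV) khat) {k}"
      using m by (subst measure_distr) auto
    also have "\<dots> = 1 / real (K - 1)"
      unfolding d using k S by (simp add: measure_pmf_single)
    finally show ?thesis .
  qed
  show "prob ((khat -` {k} \<inter> space M) \<inter> A) = prob (khat -` {k} \<inter> space M) * prob A" if "A \<in> \<A>" for k A
  proof (rule indep_setD)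
    show "indep_set {khat -` S \<inter> space M | S. True} \<A>"
      using khat by (simp add: uniform_index_def)
  qed (use that in auto)
qed

section \<open>Measurable residuals and a common bound for them\<close>

context lalm
begin

text \<open>Makes \<open>Gamma_e\<close> positive even for \<open>\<sigma>f = 0\<close>, as Markov's
  inequality at the threshold \<open>Gamma_e / \<delta>\<close> requires.\<close>

lemma D0_pos:
  assumes "x0 \<in> U"
  shows "0 < D0_const f x0 P"
proof -
  have "f_low P \<le> f x0" using assms by (rule f_low_le)
  moreover have "0 \<le> G P * chi_cor P * Delta P" "0 \<le> 4 * (Lam P)\<^sup>2 / rho P"
    "0 \<le> C_lambda_p P / rho P * (Delta P)\<^sup>2" "0 \<le> (Lam P)\<^sup>2 / (2 * rho P)"
    by auto
  ultimately have "0 \<le> Phi1_bar f x0 P - Phi_low P"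
    unfolding Phi1_bar_def Phi_low_def by linarith
  then show ?thesis
    unfolding D0_const_def by (intro add_pos_nonneg zero_less_power) auto
qed

text \<open>Extension by zero outside \<open>U\<close> yields Borel functions here and in
  \<open>cU\<close>; the output lies in \<open>U\<close> almost surely, where they are the true
  residuals.\<close>

definition kkt_grad where
  "kkt_grad y m = (if y \<in> U then grad f y + cgrad c y *v m else 0)"

definition cU where
  "cU y = (if y \<in> U then c y else 0)"

lemma measurable_kkt_grad:
  assumes [measurable]: "X \<in> borel_measurable M" "L \<in> borel_measurable M"
  shows "(\<lambda>\<omega>. kkt_grad (X \<omega>) (L \<omega>)) \<in> borel_measurable M"
proof -
  have U [measurable]: "U \<in> sets borel" using open_U by simp
  have "(\<lambda>y. if y \<in> U then grad f y else 0) \<in> borel_measurable borel"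
    and "(\<lambda>y. if y \<in> U then cgrad c y else 0) \<in> borel_measurable borel"
    using continuous_on_grad continuous_on_cgrad by (auto intro!: borel_measurable_continuous_on_if)
  from this[THEN measurable_compose[OF assms(1)]]
  have g: "(\<lambda>\<omega>. if X \<omega> \<in> U then grad f (X \<omega>) else 0) \<in> borel_measurable M"
    and A: "(\<lambda>\<omega>. if X \<omega> \<in> U then cgrad c (X \<omega>) else 0) \<in> borel_measurable M" .
  have "continuous_on UNIV (\<lambda>z :: (real^'m^'n) \<times> (real^'m). fst z *v snd z)"
    unfolding continuous_on_def
    by (intro ballI tendsto_matrix_vector_mult tendsto_fst tendsto_snd tendsto_ident_at)
  then have "(\<lambda>\<omega>. (if X \<omega> \<in> U then cgrad c (X \<omega>) else 0) *v L \<omega>) \<in> borel_measurable M"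
    by (rule borel_measurable_continuous_Pair[OF A assms(2)])
  with g have "(\<lambda>\<omega>. (if X \<omega> \<in> U then grad f (X \<omega>) else 0) + (if X \<omega> \<in> U then cgrad c (X \<omega>) else 0) *v L \<omega>)
      \<in> borel_measurable M"
    by (rule borel_measurable_add)
  moreover have "(\<lambda>\<omega>. kkt_grad (X \<omega>) (L \<omega>))
      = (\<lambda>\<omega>. (if X \<omega> \<in> U then grad f (X \<omega>) else 0) + (if X \<omega> \<in> U then cgrad c (X \<omega>) else 0) *v L \<omega>)"
    by (auto simp: kkt_grad_def)
  ultimately show ?thesis by simp
qed

lemma measurable_cU [measurable]: "cU \<in> borel_measurable borel"
  unfolding cU_def[abs_def] using continuous_on_c open_U by (intro borel_measurable_continuous_on_if) auto

text \<open>Iterates are known to be measurable only up to the horizon, so a randomly indexed output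
  is compared with measurable versions \<open>X'\<close> and \<open>L'\<close> that agree with it
  almost surely. One bound \<open>W\<close> serves both residuals.\<close>

lemma stochastic_KKT_dominated:
  assumes X': "X' \<in> borel_measurable M" "AE \<omega> in M. X \<omega> = X' \<omega>" and L': "L'
      \<in> borel_measurable M" "AE \<omega> in M. L \<omega> = L' \<omega>"
    and U: "AE \<omega> in M. X' \<omega> \<in> U"
    and W: "AE \<omega> in M. ennreal ((norm (kkt_residual (X' \<omega>) (L' \<omega>)))\<^sup>2) \<le> W \<omega> \<and> ennreal ((norm (c (X' \<omega>)))\<^sup>2) \<le> W \<omega>"
    and bound: "(\<integral>\<^sup>+ \<omega>. W \<omega> \<partial>M) \<le> ennreal (\<epsilon>\<^sup>2)"
  shows "stochastic_eps_KKT M f c \<epsilon> X L"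
  unfolding stochastic_eps_KKT_def
proof (intro conjI)
  show "X \<in> borel_measurable (completion M)" "L \<in> borel_measurable (completion M)"
    using measurable_completion_AE_eq[OF X'] measurable_completion_AE_eq[OF L'] by auto
  show "AE \<omega> in M. f differentiable at (X \<omega>) \<and> c differentiable at (X \<omega>)"
    using X'(2) U by eventually_elim (auto intro: f_differentiable c_differentiable)
  show "mean_square_le M (\<lambda>\<omega>. kkt_residual (X \<omega>) (L \<omega>)) (\<epsilon>\<^sup>2)"
  proof (rule mean_square_leI[OF measurable_kkt_grad[OF X'(1) L'(1)]])
    show "AE \<omega> in M. kkt_residual (X \<omega>) (L \<omega>) = kkt_grad (X' \<omega>) (L' \<omega>)"
      using X'(2) L'(2) U by eventually_elim (simp add: kkt_grad_def)
    have "(\<integral>\<^sup>+ \<omega>. ennreal ((norm (kkt_grad (X' \<omega>) (L' \<omega>)))\<^sup>2) \<partial>M) \<le> (\<integral>\<^sup>+ \<omega>. W \<omega> \<partial>M)"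
      by (rule nn_integral_mono_AE, use U W in eventually_elim) (simp add: kkt_grad_def)
    with bound show "(\<integral>\<^sup>+ \<omega>. ennreal ((norm (kkt_grad (X' \<omega>) (L' \<omega>)))\<^sup>2) \<partial>M) \<le> ennreal (\<epsilon>\<^sup>2)"
      by (rule order_trans[rotated])
  qed simp
  show "mean_square_le M (\<lambda>\<omega>. c (X \<omega>)) (\<epsilon>\<^sup>2)"
  proof (rule mean_square_leI[of "\<lambda>\<omega>. cU (X' \<omega>)"])
    show "(\<lambda>\<omega>. cU (X' \<omega>)) \<in> borel_measurable M" using X'(1) by measurable
    show "AE \<omega> in M. c (X \<omega>) = cU (X' \<omega>)"
      using X'(2) U by eventually_elim (simp add: cU_def)
    have "(\<integral>\<^sup>+ \<omega>. ennreal ((norm (cU (X' \<omega>)))\<^sup>2) \<partial>M) \<le> (\<integral>\<^sup>+ \<omega>. W \<omega> \<partial>M)"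
      by (rule nn_integral_mono_AE, use U W in eventually_elim) (simp add: cU_def)
    with bound show "(\<integral>\<^sup>+ \<omega>. ennreal ((norm (cU (X' \<omega>)))\<^sup>2) \<partial>M) \<le> ennreal (\<epsilon>\<^sup>2)"
      by (rule order_trans[rotated])
  qed simp
qed

definition out_coef where
  "out_coef = max (max (2 * (B_p P)\<^sup>2) 2) (max (C_lambda_p P / (rho P)\<^sup>2) (C_lambda_e P / (rho P)\<^sup>2))"

lemma out_coef_ge: "2 * (B_p P)\<^sup>2 \<le> out_coef" "2 \<le> out_coef" "C_lambda_p P / (rho P)\<^sup>2
    \<le> out_coef" "C_lambda_e P / (rho P)\<^sup>2 \<le> out_coef"
  by (auto simp: out_coef_def)

lemma out_coef_nonneg: "0 \<le> out_coef"
  using out_coef_ge(2) by linarith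

lemma good_run_output:
  assumes run: "good_run n v x l p" and k: "Suc j < n"
  defines "T \<equiv> out_coef * ((norm (p (Suc j)))\<^sup>2 + (norm (p j))\<^sup>2
      + (norm (v (Suc j) - grad f (x (Suc j))))\<^sup>2 + (norm (v j - grad f (x j)))\<^sup>2)"
  shows "(norm (kkt_residual (x (Suc (Suc j))) (l (Suc (Suc j)))))\<^sup>2 \<le> T"
    "(norm (c (x (Suc (Suc j)))))\<^sup>2 \<le> T"
proof -
  define a b e d where "a = (norm (p (Suc j)))\<^sup>2" and "b = (norm (p j))\<^sup>2"
    and "e = (norm (v (Suc j) - grad f (x (Suc j))))\<^sup>2" and "d = (norm (v j - grad f (x j)))\<^sup>2"
  have nn: "0 \<le> a" "0 \<le> b" "0 \<le> e" "0 \<le> d" by (simp_all add: a_def b_def e_def d_def)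
  have T: "T = out_coef * a + out_coef * b + out_coef * e + out_coef * d"
    by (simp add: T_def a_def b_def e_def d_def algebra_simps)
  have ob: "0 \<le> out_coef * b" "0 \<le> out_coef * d" using nn out_coef_nonneg by auto
  have "(norm (kkt_residual (x (Suc (Suc j))) (l (Suc (Suc j)))))\<^sup>2
      \<le> (B_p P * norm (p (Suc j)) + norm (v (Suc j) - grad f (x (Suc j))))\<^sup>2"
    using good_step_residual[OF good_runD[OF run k]] by (intro power_mono) auto
  also have "\<dots> \<le> 2 * (B_p P)\<^sup>2 * a + 2 * e"
    using sum_squares_bound[of "B_p P * norm (p (Suc j))" "norm (v (Suc j) - grad f (x (Suc j)))"]
    by (simp add: a_def e_def power2_sum power_mult_distrib)
  also have "\<dots> \<le> out_coef * a + out_coef * e"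
    using out_coef_ge nn by (intro add_mono mult_right_mono) auto
  finally show "(norm (kkt_residual (x (Suc (Suc j))) (l (Suc (Suc j)))))\<^sup>2 \<le> T"
    using T ob by linarith
  have "(norm (c (x (Suc (Suc j)))))\<^sup>2 \<le> C_lambda_p P / (rho P)\<^sup>2 * (a + b) + C_lambda_e P / (rho P)\<^sup>2 * (e + d)"
    using good_run_constraint[OF run k] by (simp add: a_def b_def e_def d_def)
  also have "\<dots> \<le> out_coef * (a + b) + out_coef * (e + d)"
    using out_coef_ge nn by (intro add_mono mult_right_mono) auto
  finally show "(norm (c (x (Suc (Suc j)))))\<^sup>2 \<le> T"
    by (simp add: T algebra_simps)
qed

end

text \<open>The factor 2 arises because each squared step and error enters the bounds of two
  consecutive outputs; the bracket bounds the two expected sums together.\<close>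

definition (in lalm_oracle) out_const where
  "out_const x0 = 2 * out_coef * (D0_const f x0 P + D1_const P * Gamma_e f x0 P \<sigma>f + Gamma_e f x0 P \<sigma>f)"

context lalm_process
begin

definition err_bound where "err_bound k \<omega> = out_coef * (step_sq k \<omega> + step_sq (k - 1) \<omega> + err_sq k \<omega> + err_sq (k
    - 1) \<omega>)"

lemma err_bound_nonneg [simp]: "0 \<le> err_bound k \<omega>"
  using out_coef_nonneg by (simp add: err_bound_def)

lemma err_bound_measurable: "k < K \<Longrightarrow> err_bound k \<in> borel_measurable (H K)"
  unfolding err_bound_def[abs_def] using step_sq_measurable[of _ K] err_sq_measurable[of _ K]
  by (intro borel_measurable_times borel_measurable_add borel_measurable_const) auto

lemma AE_output:
  "AE \<omega> in M. \<forall>k\<in>{1..<K}. active k \<omega> \<longrightarrow> x (Suc k) \<omega> \<in> U \<and>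
     (norm (kkt_residual (x (Suc k) \<omega>) (l (Suc k) \<omega>)))\<^sup>2 \<le> err_bound k \<omega> \<and>
     (norm (c (x (Suc k) \<omega>)))\<^sup>2 \<le> err_bound k \<omega>"
  using AE_run
proof eventually_elim
  case (elim \<omega>)
  show ?case
  proof (intro ballI impI)
    fix k assume k: "k \<in> {1..<K}" and act: "active k \<omega>"
    then obtain j where j: "k = Suc j" by (cases k) auto
    have steps: "\<forall>k<K. active k \<omega> \<longrightarrow> good_at k \<omega>"
      using elim by auto
    have kK: "Suc k \<le> K" using k by simp
    have ac: "active i \<omega>" if "i < Suc k" for i using active_mono[OF act] that by simp
    note run = active_good_run[OF steps kK ac]
    have "x (Suc k) \<omega> \<in> U" using good_stepD(3)[OF good_runD[OF run(1), of k]] by simp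
    have T: "out_coef * ((norm (p (Suc j) \<omega>))\<^sup>2 + (norm (p j \<omega>))\<^sup>2
      + (norm (v (Suc j) \<omega> - grad f (x (Suc j) \<omega>)))\<^sup>2 + (norm (v j \<omega> - grad f (x j \<omega>)))\<^sup>2) \<le> err_bound k \<omega>"
      using run(2)[of k] run(2)[of j] run(3)[of k] run(3)[of j] out_coef_nonneg
      unfolding err_bound_def by (intro mult_left_mono) (auto simp: j)
    show "x (Suc k) \<omega> \<in> U \<and>
     (norm (kkt_residual (x (Suc k) \<omega>) (l (Suc k) \<omega>)))\<^sup>2 \<le> err_bound k \<omega> \<and>
     (norm (c (x (Suc k) \<omega>)))\<^sup>2 \<le> err_bound k \<omega>"
      using \<open>x (Suc k) \<omega> \<in> U\<close> good_run_output[OF run(1), of j] T by (auto simp: j)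
  qed
qed

lemma sum_err_bound: "(\<Sum>k\<in>{1..<K}. \<integral>\<^sup>+ \<omega>. ennreal (err_bound k \<omega>) \<partial>M) \<le> ennreal (out_const x0)"
proof -
  define E where "E k = expectation (step_sq k) + expectation (err_sq k)" for k
  have E: "0 \<le> E k" for k by (auto simp: E_def intro!: add_nonneg_nonneg Bochner_Integration.integral_nonneg)
  have int: "integrable M (err_bound k)" if "k < K" for k
    unfolding err_bound_def[abs_def] using that integrable_step_sq integrable_err_sq by auto
  have exp: "expectation (err_bound k) = out_coef * (E k + E (k - 1))" if "k < K" for k
    unfolding err_bound_def[abs_def] E_def using that integrable_step_sq[of k] integrable_err_sq[of k]
      integrable_step_sq[of "k - 1"] integrable_err_sq[of "k - 1"] by simp
  have "(\<Sum>k\<in>{1..<K}. \<integral>\<^sup>+ \<omega>. ennreal (err_bound k \<omega>) \<partial>M) = (\<Sum>k\<in>{1..<K}. ennreal (out_coef * (E k + E (k - 1))))"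
    using int exp by (intro sum.cong refl, subst nn_integral_eq_integral) auto
  also have "\<dots> = ennreal (\<Sum>k\<in>{1..<K}. out_coef * (E k + E (k - 1)))"
    using E out_coef_nonneg by (intro sum_ennreal) auto
  also have "(\<Sum>k\<in>{1..<K}. out_coef * (E k + E (k - 1))) \<le> out_const x0"
  proof -
    have "(\<Sum>k\<in>{1..<K}. E k) \<le> (\<Sum>k<K. E k)"
      using E by (intro sum_mono2) auto
    moreover have "(\<Sum>k\<in>{1..<K}. E (k - 1)) \<le> (\<Sum>k<K. E k)"
    proof -
      have "(\<Sum>k\<in>{1..<K}. E (k - 1)) = (\<Sum>k\<in>(\<lambda>k. k - 1) ` {1..<K}. E k)"
        by (subst sum.reindex) (auto simp: inj_on_def)
      also have "\<dots> \<le> (\<Sum>k<K. E k)" using E by (intro sum_mono2) auto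
      finally show ?thesis .
    qed
    ultimately have "(\<Sum>k\<in>{1..<K}. E k + E (k - 1)) \<le> 2 * (\<Sum>k<K. E k)"
      by (simp add: sum.distrib)
    also have "(\<Sum>k<K. E k) \<le> D0_const f x0 P + D1_const P * Gamma_e f x0 P \<sigma>f + Gamma_e f x0 P \<sigma>f"
      using expected_sums by (simp add: E_def sum.distrib)
    finally show ?thesis
      using out_coef_nonneg by (simp add: out_const_def sum_distrib_left[symmetric] mult.assoc
          mult.left_commute[of 2] mult_left_mono)
  qed
  finally show ?thesis by (simp add: ennreal_leI)
qed

text \<open>The first good step supplies it almost surely, and an almost sure statement about a
  constant holds outright on a probability space.\<close>

lemma x0_in_U: "x0 \<in> U"
proof -
  have "AE \<omega> in M. x0 \<in> U"
    using AE_run AE_init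
  proof eventually_elim
    case (elim \<omega>)
    then have "active 0 \<omega>" using X by (simp add: active_def)
    then show ?case using elim good_stepD(1) K by fastforce
  qed
  then show ?thesis by simp
qed

lemma Gamma_pos: "0 < Gamma_e f x0 P \<sigma>f"
  unfolding Gamma_e_def using D0_pos[OF x0_in_U] D1_pos by (intro add_nonneg_pos divide_pos_pos) auto

text \<open>All steps before the first exit are good, so the constraint part of \<open>S_st\<close>
  still holds at the exit point and only the objective level can have been exceeded. The slack of
  \<open>H_st\<close> over \<open>H_det\<close> is the threshold for Markov's inequality, multiplied
  by \<open>2 * C_e_star P\<close>.\<close>

lemma prob_exit_le:
  assumes \<delta>: "0 < \<delta>" and S: "S_st f c x0 P \<sigma>f \<delta> \<subseteq> X"
  shows "prob {\<omega> \<in> space M. \<not> accepted K X (\<lambda>k. x k \<omega>)} \<le> \<delta>"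
proof -
  define \<Gamma> where "\<Gamma> = Gamma_e f x0 P \<sigma>f"
  have \<Gamma>: "0 < \<Gamma>" using Gamma_pos by (simp add: \<Gamma>_def)
  define Z where "Z \<omega> = (\<Sum>k<K. err_sq k \<omega>)" for \<omega>
  have Z: "0 \<le> Z \<omega>" for \<omega> by (simp add: Z_def sum_nonneg)
  have int: "integrable M Z" unfolding Z_def[abs_def] using integrable_err_sq by auto
  have "prob {\<omega> \<in> space M. \<not> accepted K X (\<lambda>k. x k \<omega>)} \<le> prob {\<omega> \<in> space M. \<Gamma> / \<delta> \<le> Z \<omega>}"
  proof (rule finite_measure_mono_AE)
    show "AE \<omega> in M. \<omega> \<in> {\<omega> \<in> space M. \<not> accepted K X (\<lambda>k. x k \<omega>)} \<longrightarrow> \<omega> \<in> {\<omega> \<in> space M. \<Gamma> / \<delta> \<le> Z \<omega>}"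
      using AE_run AE_init
    proof eventually_elim
      case (elim \<omega>)
      show ?case
      proof
        assume "\<omega> \<in> {\<omega> \<in> space M. \<not> accepted K X (\<lambda>k. x k \<omega>)}"
        then obtain k0 where sp: "\<omega> \<in> space M" and "k0 \<in> {1..K}" "x k0 \<omega> \<notin> X"
          by (auto simp: accepted_iff)
        define k where "k = (LEAST k. x k \<omega> \<notin> X)"
        have k: "x k \<omega> \<notin> X" unfolding k_def using \<open>x k0 \<omega> \<notin> X\<close> by (rule LeastI)
        have "k \<le> k0" unfolding k_def using \<open>x k0 \<omega> \<notin> X\<close> by (rule Least_le)
        with \<open>k0 \<in> {1..K}\<close> have kK: "k \<le> K" by simp
        have before: "x j \<omega> \<in> X" if "j < k" for j
          using not_less_Least[of j "\<lambda>k. x k \<omega> \<notin> X"] that by (simp add: k_def)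
        have k0: "0 < k" using k elim X(2) by (cases k) auto
        have act: "active j \<omega>" if "j < k" for j using before that by (auto simp: active_def)
        have steps: "\<forall>k<K. active k \<omega> \<longrightarrow> good_at k \<omega>"
          using elim by auto
        note run = active_good_run[OF steps kK act]
        obtain m where m: "k = Suc m" using k0 by (cases k) auto
        have "rho P * norm (c (x k \<omega>)) \<le> 2 * Lam P"
          using good_step_next_bounds(2)[OF good_runD[OF run(1), of m]] by (simp add: m)
        then have "norm (c (x k \<omega>)) \<le> 2 * Lam P / rho P"
          by (subst pos_le_divide_eq) (simp_all add: mult.commute)
        moreover have "x k \<omega> \<notin> S_st f c x0 P \<sigma>f \<delta>" using k S by blast
        ultimately have "H_st f x0 P \<sigma>f \<delta> < f (x k \<omega>)"
          by (simp add: S_st_def)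
        also have "f (x k \<omega>) \<le> H_det f (x 0 \<omega>) P + 2 * C_e_star P * (\<Sum>k<k. (norm (v k \<omega> - grad f (x k \<omega>)))\<^sup>2)"
          by (rule good_run_f_le[OF run(1) k0])
        also have "(\<Sum>k<k. (norm (v k \<omega> - grad f (x k \<omega>)))\<^sup>2) \<le> (\<Sum>k<k. err_sq k \<omega>)"
          using run(2) by (intro sum_mono) auto
        also have "\<dots> \<le> Z \<omega>"
          unfolding Z_def using kK by (intro sum_mono2) auto
        finally have "2 * C_e_star P * \<Gamma> / \<delta> < 2 * C_e_star P * Z \<omega>"
          using elim by (simp add: H_st_def \<Gamma>_def)
        then have "2 * C_e_star P * (\<Gamma> / \<delta>) < 2 * C_e_star P * Z \<omega>" by simp
        then show "\<omega> \<in> {\<omega> \<in> space M. \<Gamma> / \<delta> \<le> Z \<omega>}"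
          using C_e_star_pos sp by (simp add: mult_less_cancel_left_pos del: times_divide_eq_right)
      qed
    qed
    show "{\<omega> \<in> space M. \<Gamma> / \<delta> \<le> Z \<omega>} \<in> events" using int by measurable
  qed
  also have "\<dots> \<le> expectation Z / (\<Gamma> / \<delta>)"
    using int \<Gamma> \<delta> by (intro integral_Markov_inequality_measure[where A="{}"]) (auto simp: Z)
  also have "\<dots> \<le> \<Gamma> / (\<Gamma> / \<delta>)"
  proof (intro divide_right_mono)
    have "expectation Z = (\<Sum>k<K. expectation (err_sq k))"
      unfolding Z_def[abs_def] using integrable_err_sq by (subst Bochner_Integration.integral_sum) auto
    then show "expectation Z \<le> \<Gamma>" using expected_sums(1) by (simp add: \<Gamma>_def)
  qed (use \<Gamma> \<delta> in auto)
  also have "\<dots> = \<delta>" using \<Gamma> by simp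
  finally show ?thesis .
qed

end

section \<open>Operation counts for horizons of order \<open>1 / \<epsilon>^2\<close>\<close>

context lalm
begin

text \<open>There are about \<open>sqrt K\<close> refreshes of cost \<open>K\<close>, and at most
  \<open>K\<close> updates whose cost is of order \<open>sqrt K\<close>. The total grows like the
  cube of \<open>sqrt K\<close>, and \<open>sqrt K\<close> is of order
  \<open>1 / \<epsilon>\<close>.\<close>

lemma cost_orders:
  assumes D': "0 \<le> D'" and a: "0 \<le> a" and b: "\<And>K. 2 \<le> K \<Longrightarrow> real (b_of P Ls K) \<le> D' * real (Q_of K) + 2"
  obtains C' where "0 \<le> C'"
    "\<And>\<epsilon> K. 0 < \<epsilon> \<Longrightarrow> 2 \<le> K \<Longrightarrow> real K \<le> a / \<epsilon>^2 \<Longrightarrow> real (spider_cost (Q_of K) K (b_of P Ls K) K) \<le> C' / \<epsilon>^3"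
    "\<And>\<epsilon> K op. 0 < \<epsilon> \<Longrightarrow> real K \<le> a / \<epsilon>^2 \<Longrightarrow> real (operation_count op K) \<le> C' / \<epsilon>^2"
proof
  define C1 where "C1 = (6 + 4 * D') * (sqrt a)^3"
  have C1: "0 \<le> C1" using D' a by (simp add: C1_def)
  show "0 \<le> C1 + 2 * a" using C1 a by simp
  fix \<epsilon> :: real and K :: nat assume \<epsilon>: "0 < \<epsilon>" and Ka: "real K \<le> a / \<epsilon>^2"
  have "real (operation_count op K) \<le> 2 * real K" for op
    by (cases op) (auto simp: operation_count_def)
  then have "real (operation_count op K) \<le> 2 * (a / \<epsilon>^2)" for op
    using Ka by (meson mult_left_mono order_trans zero_le_numeral)
  moreover have "2 * (a / \<epsilon>^2) \<le> (C1 + 2 * a) / \<epsilon>^2"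
    using C1 \<epsilon> by (simp add: divide_right_mono)
  ultimately show "real (operation_count op K) \<le> (C1 + 2 * a) / \<epsilon>^2" for op
    by (meson order_trans)
  assume K: "2 \<le> K"
  define s where "s = sqrt (real K)"
  define Q where "Q = Q_of K"
  have s1: "1 \<le> s" using K by (simp add: s_def)
  have ss: "s * s = real K" by (simp add: s_def)
  have Q: "s \<le> real Q" "real Q \<le> s + 1"
    using s1 unfolding Q_def Q_of_def s_def by linarith+
  have Q0: "0 < Q" using Q(1) s1 by (cases Q) auto
  have card: "real (card {k. k < K \<and> k mod Q = 0}) \<le> s + 1"
  proof -
    have "card {k. k < K \<and> k mod Q = 0} \<le> card {..K div Q}"
    proof (rule card_inj_on_le[where f="\<lambda>k. k div Q"])
      show "inj_on (\<lambda>k. k div Q) {k. k < K \<and> k mod Q = 0}"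
        by (rule inj_onI) (metis (mono_tags, lifting) add.right_neutral div_mult_mod_eq mem_Collect_eq)
      show "(\<lambda>k. k div Q) ` {k. k < K \<and> k mod Q = 0} \<subseteq> {..K div Q}"
        by (auto intro: div_le_mono)
    qed simp
    then have "real (card {k. k < K \<and> k mod Q = 0}) \<le> real (K div Q) + 1" by simp
    also have "real (K div Q) \<le> real K / real Q" by (rule of_nat_div_le_of_nat)
    also have "real K / real Q \<le> real K / s"
      using Q s1 by (intro divide_left_mono) auto
    also have "real K / s = s" using s1 by (simp add: ss[symmetric])
    finally show ?thesis by simp
  qed
  define bK where "bK = real (b_of P Ls K)"
  have bK: "0 \<le> bK" "bK \<le> D' * (s + 1) + 2"
    using b[OF K] mult_left_mono[OF Q(2) D'] by (auto simp: bK_def Q_def)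
  have "real (spider_cost Q K (b_of P Ls K) K) = (\<Sum>k<K. if k mod Q = 0 then real K else 2 * bK)"
    by (auto simp: spider_cost_def bK_def intro!: sum.cong)
  also have "\<dots> \<le> (\<Sum>k<K. (if k mod Q = 0 then real K else 0) + 2 * bK)"
    using bK by (intro sum_mono) auto
  also have "\<dots> = real (card {k. k < K \<and> k mod Q = 0}) * real K + real K * (2 * bK)"
    by (simp add: sum.distrib sum.inter_filter[symmetric])
  also have "\<dots> \<le> (s + 1) * real K + real K * (2 * (D' * (s + 1) + 2))"
    using card bK by (intro add_mono mult_right_mono mult_left_mono) auto
  also have "\<dots> = real K * ((s + 1) + 2 * (D' * (s + 1) + 2))" by (simp add: algebra_simps)
  also have "\<dots> \<le> real K * ((6 + 4 * D') * s)"
  proof (intro mult_left_mono)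
    have "D' * (s + 1) \<le> D' * (2 * s)" using s1 D' by (intro mult_left_mono) auto
    then show "(s + 1) + 2 * (D' * (s + 1) + 2) \<le> (6 + 4 * D') * s"
      using s1 by (simp add: algebra_simps)
  qed simp
  also have "\<dots> = (6 + 4 * D') * s^3"
    by (simp add: ss[symmetric] power3_eq_cube)
  also have "\<dots> \<le> (6 + 4 * D') * (sqrt a / \<epsilon>)^3"
  proof (intro mult_left_mono power_mono)
    have "s \<le> sqrt (a / \<epsilon>^2)" unfolding s_def using Ka by (rule real_sqrt_le_mono)
    then show "s \<le> sqrt a / \<epsilon>" using \<epsilon> by (simp add: real_sqrt_divide)
  qed (use s1 D' in auto)
  also have "\<dots> = C1 / \<epsilon>^3" by (simp add: C1_def power_divide)
  also have "\<dots> \<le> (C1 + 2 * a) / \<epsilon>^3" using a \<epsilon> by (simp add: divide_right_mono)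
  finally show "real (spider_cost (Q_of K) K (b_of P Ls K) K) \<le> (C1 + 2 * a) / \<epsilon>^3"
    by (simp add: Q_def)
qed

lemma run_costs:
  assumes a: "0 \<le> a"
  shows "\<exists>C'\<ge>0. \<forall>\<epsilon> K. 0 < \<epsilon> \<and> horizon_of_order C a \<epsilon> K \<longrightarrow>
    real (spider_cost (Q_of K) K (b_of P Ls K) K) \<le> C' / \<epsilon>^3 \<and> (\<forall>op. real (operation_count op K) \<le> C' / \<epsilon>^2)"
proof -
  define D' where "D' = 2 * D1_const P * Ls\<^sup>2 * (chi_cor P)\<^sup>2"
  have D': "0 \<le> D'" using less_imp_le[OF D1_pos] by (simp add: D'_def)
  have b: "real (b_of P Ls K) \<le> D' * real (Q_of K) + 2" for K
    using mult_nonneg_nonneg[OF D', of "real (Q_of K)"] unfolding b_of_def D'_def by linarith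
  obtain C' where "0 \<le> C'"
    "\<And>\<epsilon> K. 0 < \<epsilon> \<Longrightarrow> 2 \<le> K \<Longrightarrow> real K \<le> a / \<epsilon>^2 \<Longrightarrow> real (spider_cost (Q_of K) K (b_of P Ls K) K) \<le> C' / \<epsilon>^3"
    "\<And>\<epsilon> K op. 0 < \<epsilon> \<Longrightarrow> real K \<le> a / \<epsilon>^2 \<Longrightarrow> real (operation_count op K) \<le> C' / \<epsilon>^2"
    using cost_orders[OF D' a b] by metis
  then show ?thesis by (intro exI[of _ C']) (auto simp: horizon_of_order_def)
qed

text \<open>One unit of the 2 pays for rounding up, the other for the shift in
  \<open>K - 1\<close>.\<close>

lemma horizon_exists:
  assumes C: "0 < C" and a: "C + 2 \<le> a" and \<epsilon>: "0 < \<epsilon>" "\<epsilon> \<le> 1"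
  shows "\<exists>K. horizon_of_order C a \<epsilon> K"
proof -
  define m where "m = nat \<lceil>C / \<epsilon>\<^sup>2\<rceil>"
  have "0 < C / \<epsilon>\<^sup>2" using C \<epsilon> by simp
  then have m: "0 < m" "C / \<epsilon>\<^sup>2 \<le> real m" "real m \<le> C / \<epsilon>\<^sup>2 + 1"
    unfolding m_def by linarith+
  have "1 \<le> 1 / \<epsilon>\<^sup>2" using \<epsilon> by (simp add: power_le_one)
  then have "real (Suc m) \<le> (C + 2) / \<epsilon>\<^sup>2"
    using m by (simp add: add_divide_distrib)
  also have "\<dots> \<le> a / \<epsilon>\<^sup>2" using a by (intro divide_right_mono) auto
  finally show ?thesis
    using m by (intro exI[of _ "Suc m"]) (simp add: horizon_of_order_def)
qed

end

section \<open>The safeguarded restart procedure\<close>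

lemma le_square_mult: "0 < \<epsilon> \<Longrightarrow> C / \<epsilon>\<^sup>2 \<le> r \<Longrightarrow> C \<le> \<epsilon>\<^sup>2 * r" for C :: real
  by (simp add: field_simps)

context lalm
begin

text \<open>The alternatives in \<open>region\<close> serve the two regimes: segments for admissible
  runs, balls for safeguarded ones. The invariants are propagated first, and then every active step
  is good.\<close>

lemma spider_run_good:
  assumes run: "spider_run F c P Q B b x0 l0 X N s x l h p"
    and init: "norm l0 \<le> Lam P" "rho P * norm (c x0) \<le> Lam P"
    and region: "\<And>k. k < N \<Longrightarrow> \<forall>j\<le>k. x j \<in> X \<Longrightarrow>
      closed_segment (x k) (x k + p k) \<union> closed_segment (x k + p k) (x (Suc k)) \<subseteq> U \<or> cball (x k)
          (chi_cor P * Delta P) \<subseteq> U"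
    and k: "k < N" "\<forall>j\<le>k. x j \<in> X"
  shows "good_step (closest_point (cball 0 (G P)) (h k)) (x k) (l k) (p k) (x (Suc k)) (l (Suc k))"
proof -
  have step: "good_step (closest_point (cball 0 (G P)) (h k)) (x k) (l k) (p k) (x (Suc k)) (l (Suc k))"
    if "k < N" "\<forall>j\<le>k. x j \<in> X" "norm (l k) \<le> Lam P" "rho P * norm (c (x k)) \<le> 2 * Lam P" for k
  proof -
    have s: "soc_step c P (closest_point (cball 0 (G P)) (h k)) (x k) (l k) (p k) (x (Suc k)) (l (Suc k))"
      using run that by (auto simp: spider_run_def)
    have "closest_point (cball 0 (G P)) (h k) \<in> cball 0 (G P)"
      using less_imp_le[OF param_pos(1)] by (intro closest_point_in_set) (auto simp: cball_eq_empty not_less)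
    then have v: "norm (closest_point (cball 0 (G P)) (h k)) \<le> G P" by simp
    show ?thesis
      using region[OF that(1,2)]
    proof
      assume "cball (x k) (chi_cor P * Delta P) \<subseteq> U"
      then show ?thesis using good_step_ball[OF s v that(3,4)] by blast
    next
      assume "closed_segment (x k) (x k + p k) \<union> closed_segment (x k + p k) (x (Suc k)) \<subseteq> U"
      then show ?thesis using s v that by (simp add: good_step_def)
    qed
  qed
  have "rho P * norm (c x0) \<le> 2 * Lam P"
    using init(2) param_pos(9) by linarith
  then have "norm (l k) \<le> Lam P \<and> rho P * norm (c (x k)) \<le> 2 * Lam P" if "k \<le> N" "\<forall>j<k. x j \<in> X" for k
    using that
  proof (induction k)
    case 0
    then show ?case using run init by (simp add: spider_run_def)
  next
    case (Suc k)
    then have "good_step (closest_point (cball 0 (G P)) (h k)) (x k) (l k) (p k) (x (Suc k)) (l (Suc k))"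
      by (intro step) (auto simp: less_Suc_eq_le)
    then show ?case using good_step_next_bounds by blast
  qed
  with step k show ?thesis by simp
qed

end

context lalm_process
begin

lemma output_select:
  assumes "khat \<omega> \<in> {1..<K}"
  shows "(\<Sum>k\<in>{1..<K}. if khat \<omega> = k then y (Suc k) \<omega> else 0) = y (Suc (khat \<omega>)) \<omega>"
  using assms by simp

text \<open>The error bounds depend only on the history up to \<open>K\<close>, from which the index
  is independent; the expectation of the selected bound is therefore the plain average over
  \<open>1, ..., K - 1\<close>.\<close>

lemma single_run_output:
  assumes khat: "uniform_index M K (sets (H K)) khat"
    and active: "AE \<omega> in M. \<forall>k<K. active k \<omega>"
    and bound: "out_const x0 \<le> \<epsilon>\<^sup>2 * real (K - 1)"
  shows "stochastic_eps_KKT M f c \<epsilon> (\<lambda>\<omega>. x (Suc (khat \<omega>)) \<omega>) (\<lambda>\<omega>. l (Suc (khat \<omega>)) \<omega>)"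
proof -
  note kh = uniform_indexD[OF khat K]
  note [measurable] = kh(1)
  have K1: "0 < real (K - 1)" using K by simp
  define E where "E k = khat -` {k} \<inter> space M" for k
  have E: "E k \<in> events" for k unfolding E_def using kh(1) by measurable
  define X' where "X' \<omega> = (\<Sum>k\<in>{1..<K}. if khat \<omega> = k then x (Suc k) \<omega> else 0)" for \<omega>
  define L' where "L' \<omega> = (\<Sum>k\<in>{1..<K}. if khat \<omega> = k then l (Suc k) \<omega> else 0)" for \<omega>
  define W where "W \<omega> = (\<Sum>k\<in>{1..<K}. indicator (E k) \<omega> * ennreal (err_bound k \<omega>))" for \<omega>
  have meas: "x (Suc k) \<in> borel_measurable M" "l (Suc k) \<in> borel_measurable M" if "k \<in> {1..<K}" for k
    using that x_measurable[of "Suc k" K] l_measurable[of "Suc k" K] measurable_from_subalg[OF H_subalgebra[of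
        K]] by auto
  have X'm: "X' \<in> borel_measurable M" "L' \<in> borel_measurable M"
    unfolding X'_def[abs_def] L'_def[abs_def]
    by (intro borel_measurable_sum measurable_If meas; measurable)+
  have err: "(\<lambda>\<omega>. ennreal (err_bound k \<omega>)) \<in> borel_measurable (H K)" if "k \<in> {1..<K}" for k
    using err_bound_measurable[of k] that by simp
  have sel: "AE \<omega> in M. \<omega> \<in> space M \<and> khat \<omega> \<in> {1..<K} \<and> X' \<omega> = x (Suc (khat \<omega>)) \<omega> \<and> L' \<omega> = l (Suc (khat \<omega>)) \<omega>"
    using kh(2) AE_space by eventually_elim (simp only: X'_def L'_def output_select simp_thms)
  have le: "AE \<omega> in M. X' \<omega> \<in> U \<and>
      ennreal ((norm (kkt_residual (X' \<omega>) (L' \<omega>)))\<^sup>2) \<le> W \<omega> \<and> ennreal ((norm (c (X' \<omega>)))\<^sup>2) \<le> W \<omega>"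
    using sel AE_output active
  proof eventually_elim
    case (elim \<omega>)
    have "ennreal (err_bound (khat \<omega>) \<omega>) = indicator (E (khat \<omega>)) \<omega> * ennreal (err_bound (khat \<omega>) \<omega>)"
      using elim by (simp add: E_def)
    also have "\<dots> \<le> W \<omega>"
      unfolding W_def using elim by (intro member_le_sum) auto
    finally have "ennreal (err_bound (khat \<omega>) \<omega>) \<le> W \<omega>" .
    moreover have "active (khat \<omega>) \<omega>" using elim by auto
    ultimately show ?case
      using elim by (auto intro: order_trans[OF ennreal_leI])
  qed
  have "(\<integral>\<^sup>+ \<omega>. W \<omega> \<partial>M) = (\<Sum>k\<in>{1..<K}. \<integral>\<^sup>+ \<omega>. indicator (E k) \<omega> * ennreal (err_bound k \<omega>) \<partial>M)"
    unfolding W_def using err E measurable_from_subalg[OF H_subalgebra[of K]]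
    by (intro nn_integral_sum borel_measurable_times_ennreal borel_measurable_indicator) auto
  also have "\<dots> = (\<Sum>k\<in>{1..<K}. ennreal (1 / real (K - 1)) * (\<integral>\<^sup>+ \<omega>. ennreal (err_bound k \<omega>) \<partial>M))"
  proof (intro sum.cong refl)
    fix k assume k: "k \<in> {1..<K}"
    show "(\<integral>\<^sup>+ \<omega>. indicator (E k) \<omega> * ennreal (err_bound k \<omega>) \<partial>M) = ennreal (1 / real (K - 1)) * (\<integral>\<^sup>+ \<omega>. ennreal
        (err_bound k \<omega>) \<partial>M)"
      using nn_integral_indep_event[OF prob_space_axioms H_subalgebra[of K] E err[OF k], of k] kh(3)[OF k] kh(4)
      by (simp add: E_def)
  qed
  also have "\<dots> = ennreal (1 / real (K - 1)) * (\<Sum>k\<in>{1..<K}. \<integral>\<^sup>+ \<omega>. ennreal (err_bound k \<omega>) \<partial>M)"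
    by (simp add: sum_distrib_left)
  also have "\<dots> \<le> ennreal (1 / real (K - 1)) * ennreal (out_const x0)"
    by (intro mult_left_mono sum_err_bound) simp
  also have "\<dots> = ennreal (1 / real (K - 1) * out_const x0)"
    using K1 by (subst ennreal_mult') auto
  also have "\<dots> \<le> ennreal (\<epsilon>\<^sup>2)"
    using bound K1 by (intro ennreal_leI) (simp add: field_simps)
  finally have W: "(\<integral>\<^sup>+ \<omega>. W \<omega> \<partial>M) \<le> ennreal (\<epsilon>\<^sup>2)" .
  show ?thesis
    by (rule stochastic_KKT_dominated[OF X'm(1) _ X'm(2) _ _ _ W]) (use sel le in \<open>auto elim: eventually_mono\<close>)
qed

end

section \<open>Independent attempts\<close>

locale lalm_restart = lalm_oracle f c U P F D \<sigma>f Ls + prob_space M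
  for f :: "real^'n \<Rightarrow> real" and c :: "real^'n \<Rightarrow> real^'m" and U P
    and F :: "real^'n \<Rightarrow> 'xi \<Rightarrow> real" and D \<sigma>f Ls and M :: "'w measure" +
  fixes x0 :: "real^'n" and l0 :: "real^'m" and X :: "(real^'n) set" and K :: nat and \<delta> :: real
    and H :: "nat \<Rightarrow> nat \<Rightarrow> 'w measure" and \<xi> :: "nat \<Rightarrow> nat \<Rightarrow> nat \<Rightarrow> 'w \<Rightarrow> 'xi"
    and x :: "nat \<Rightarrow> nat \<Rightarrow> 'w \<Rightarrow> real^'n" and l :: "nat \<Rightarrow> nat \<Rightarrow> 'w \<Rightarrow> real^'m"
    and h p :: "nat \<Rightarrow> nat \<Rightarrow> 'w \<Rightarrow> real^'n" and khat :: "'w \<Rightarrow> nat"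
  assumes init: "norm l0 \<le> Lam P" "rho P * norm (c x0) \<le> Lam P"
    and K: "2 \<le> K" and \<delta>: "0 < \<delta>" "\<delta> < 1"
    and X: "X \<in> sets borel" "x0 \<in> X" "S_st f c x0 P \<sigma>f \<delta> \<subseteq> X" "nbhd (chi_cor P * Delta P) X \<subseteq> U"
    and restart: "restart_process M D F c P (Q_of K) K (b_of P Ls K) x0 l0 X K H \<xi> x l h p khat"
begin

lemma attempt: "lalm_process f c U P F D \<sigma>f Ls M x0 l0 X K (H t) (\<xi> t) (x t) (l t) (h t) (p t)"
proof
  show proc: "spider_process M D F c P (Q_of K) K (b_of P Ls K) x0 l0 X K (H t) (\<xi> t) (x t) (l t) (h t) (p t)"
    using restart by (simp add: restart_process_def)
  have "AE \<omega> in M. spider_run F c P (Q_of K) K (b_of P Ls K) x0 l0 X K (\<lambda>k i. \<xi> t k i \<omega>)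
        (\<lambda>k. x t k \<omega>) (\<lambda>k. l t k \<omega>) (\<lambda>k. h t k \<omega>) (\<lambda>k. p t k \<omega>)"
    using proc by (simp add: spider_process_def)
  then show "AE \<omega> in M. \<forall>k<K. (\<forall>j\<le>k. x t j \<omega> \<in> X) \<longrightarrow>
      good_step (closest_point (cball 0 (G P)) (h t k \<omega>)) (x t k \<omega>) (l t k \<omega>) (p t k \<omega>) (x t (Suc k) \<omega>) (l t
          (Suc k) \<omega>)"
  proof eventually_elim
    case (elim \<omega>)
    show ?case
    proof (intro allI impI)
      fix k assume k: "k < K" "\<forall>j\<le>k. x t j \<omega> \<in> X"
      show "good_step (closest_point (cball 0 (G P)) (h t k \<omega>)) (x t k \<omega>) (l t k \<omega>) (p t k \<omega>) (x t (Suc k) \<omega>)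
          (l t (Suc k) \<omega>)"
      proof (rule spider_run_good[OF elim init _ k])
        fix k assume "\<forall>j\<le>k. x t j \<omega> \<in> X"
        then have "cball (x t k \<omega>) (chi_cor P * Delta P) \<subseteq> U"
          using cball_subset_nbhd[of "x t k \<omega>" X] X(4) by blast
        then show "closed_segment (x t k \<omega>) (x t k \<omega> + p t k \<omega>) \<union> closed_segment (x t k \<omega> + p t k \<omega>) (x t
            (Suc k) \<omega>) \<subseteq> U
          \<or> cball (x t k \<omega>) (chi_cor P * Delta P) \<subseteq> U" ..
      qed
    qed
  qed
qed (use K X in auto)

lemmas H_subalgebra = lalm_process.H_subalgebra[OF attempt]

abbreviation acc where "acc t \<omega> \<equiv> accepted K X (\<lambda>k. x t k \<omega>)"

definition rejected where "rejected t = {\<omega> \<in> space M. \<not> acc t \<omega>}"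

lemma acc_measurable: "Measurable.pred (H t K) (acc t)"
proof -
  have "Measurable.pred (H t K) (\<lambda>\<omega>. x t i \<omega> \<in> X)" if "i \<in> {1..K}" for i
    using measurable_sets[OF lalm_process.x_measurable[OF attempt, of i K t] X(1)] that
    by (simp add: pred_def vimage_def Int_def conj_commute)
  then have "Measurable.pred (H t K) (\<lambda>\<omega>. \<forall>i\<in>{1..K}. x t i \<omega> \<in> X)"
    by (rule pred_intros_finite(3)[OF finite_atLeastAtMost])
  then show ?thesis by (simp only: accepted_iff)
qed

lemma acc_measurable_M [measurable]: "Measurable.pred M (acc t)"
  using measurable_from_subalg[OF H_subalgebra acc_measurable] by blast

lemma rejected_sets: "rejected t \<in> sets (H t K)" and rejected_events [measurable]: "rejected t \<in> events"
proof -
  have "space (H t K) = space M" using H_subalgebra[of K t] by (simp add: subalgebra_def)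
  then have "rejected t = {\<omega> \<in> space (H t K). \<not> acc t \<omega>}"
    by (simp add: rejected_def)
  then show "rejected t \<in> sets (H t K)"
    using sets.sets_Collect_neg[OF acc_measurable[of t, unfolded pred_def]] by (simp only:)
  then show "rejected t \<in> events"
    using H_subalgebra[of K t] by (auto simp: subalgebra_def)
qed

lemma prob_rejected: "prob (rejected t) \<le> \<delta>"
  unfolding rejected_def by (rule lalm_process.prob_exit_le[OF attempt \<delta>(1) X(3)])

definition all_rejected :: "nat \<Rightarrow> 'w \<Rightarrow> ennreal" where
  "all_rejected t \<omega> = (\<Prod>j<t. indicator (rejected j) \<omega>)"

lemma all_rejected_eq: "\<omega> \<in> space M \<Longrightarrow> all_rejected t \<omega> = (if \<forall>j<t. \<not> acc j \<omega> then 1 else 0)"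
  by (induction t) (auto simp: all_rejected_def rejected_def less_Suc_eq indicator_def)

text \<open>Earlier rejections are independent of everything in attempt \<open>t\<close>, and each
  contributes a factor at most \<open>\<delta>\<close>. With \<open>Y\<close> constant this bounds
  acceptance failure and cost; with \<open>Y\<close> an error of attempt \<open>t\<close> it bounds
  the output.\<close>

lemma nn_integral_all_rejected:
  assumes Y: "Y \<in> borel_measurable (H t K)"
  shows "(\<integral>\<^sup>+ \<omega>. all_rejected t \<omega> * Y \<omega> \<partial>M) \<le> ennreal (\<delta> ^ t) * (\<integral>\<^sup>+ \<omega>. Y \<omega> \<partial>M)"
proof -
  define Z where "Z j = (if j < t then indicator (rejected j) else Y)" for j
  have Zm: "Z j \<in> borel_measurable (H j K)" if "j \<le> t" for j
    using that Y rejected_sets[of j] by (auto simp: Z_def)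
  have indep: "indep_sets (\<lambda>t. sets (H t K)) UNIV"
    using restart by (simp add: restart_process_def)
  have "indep_vars (\<lambda>_. borel) Z {..t}"
    unfolding indep_vars_def2
  proof (intro conjI ballI)
    fix j assume "j \<in> {..t}"
    then show "Z j \<in> borel_measurable M"
      using measurable_from_subalg[OF H_subalgebra Zm] by simp
  next
    show "indep_sets (\<lambda>i. {Z i -` A \<inter> space M |A. A \<in> sets borel}) {..t}"
    proof (rule indep_sets_mono[OF indep])
      fix i assume "i \<in> {..t}"
      then show "{Z i -` A \<inter> space M |A. A \<in> sets borel} \<subseteq> sets (H i K)"
        using measurable_sets[OF Zm[of i]] H_subalgebra[of K i] by (auto simp: subalgebra_def)
    qed simp
  qed
  then have "(\<integral>\<^sup>+ \<omega>. (\<Prod>j\<in>{..t}. Z j \<omega>) \<partial>M) = (\<Prod>j\<in>{..t}. \<integral>\<^sup>+ \<omega>. Z j \<omega> \<partial>M)"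
    by (intro indep_vars_nn_integral) auto
  moreover have "(\<Prod>j\<in>{..t}. Z j \<omega>) = all_rejected t \<omega> * Y \<omega>" for \<omega>
    by (simp add: Z_def all_rejected_def lessThan_Suc_atMost[symmetric])
  moreover have "(\<Prod>j\<in>{..t}. \<integral>\<^sup>+ \<omega>. Z j \<omega> \<partial>M) = (\<Prod>j<t. ennreal (prob (rejected j))) * (\<integral>\<^sup>+ \<omega>. Y \<omega> \<partial>M)"
    by (simp add: Z_def lessThan_Suc_atMost[symmetric] emeasure_eq_measure)
  moreover have "(\<Prod>j<t. ennreal (prob (rejected j))) \<le> ennreal \<delta> ^ t"
    by (induction t) (auto simp: mult.commute intro!: mult_mono ennreal_leI prob_rejected)
  moreover have "ennreal \<delta> ^ t = ennreal (\<delta> ^ t)"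
    using \<delta> by (simp add: ennreal_power)
  ultimately show ?thesis
    by (simp add: mult_right_mono)
qed

lemma geometric_ennreal: "0 \<le> a \<Longrightarrow> (\<Sum>t. ennreal (\<delta> ^ t) * ennreal a) = ennreal (a / (1 - \<delta>))"
proof -
  assume a: "0 \<le> a"
  have s: "(\<lambda>t. \<delta> ^ t * a) sums (1 / (1 - \<delta>) * a)"
    using \<delta> by (intro sums_mult2 geometric_sums) auto
  have "(\<Sum>t. ennreal (\<delta> ^ t) * ennreal a) = (\<Sum>t. ennreal (\<delta> ^ t * a))"
    using \<delta> a by (simp add: ennreal_mult)
  also have "\<dots> = ennreal (\<Sum>t. \<delta> ^ t * a)"
    using s \<delta> a by (intro suminf_ennreal2) (auto simp: sums_iff)
  finally show ?thesis using s by (simp add: sums_iff)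
qed

lemma AE_accepted: "AE \<omega> in M. \<exists>t. acc t \<omega>"
proof -
  define N where "N = {\<omega> \<in> space M. \<forall>t. \<not> acc t \<omega>}"
  have [measurable]: "N \<in> events" unfolding N_def by measurable
  have le: "prob N \<le> \<delta> ^ t" for t
  proof -
    have "ennreal (prob N) = (\<integral>\<^sup>+ \<omega>. indicator N \<omega> \<partial>M)"
      by (simp add: emeasure_eq_measure)
    also have "\<dots> \<le> (\<integral>\<^sup>+ \<omega>. all_rejected t \<omega> * 1 \<partial>M)"
      by (intro nn_integral_mono) (auto simp: all_rejected_eq N_def indicator_def)
    also have "\<dots> \<le> ennreal (\<delta> ^ t) * (\<integral>\<^sup>+ \<omega>. 1 \<partial>M)"
      by (rule nn_integral_all_rejected) simp
    finally show ?thesis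
      using \<delta> by (simp add: emeasure_space_1)
  qed
  have "prob N \<le> 0"
    using \<delta> le by (intro LIMSEQ_le_const[OF LIMSEQ_realpow_zero[of \<delta>]]) auto
  then have "prob N = 0" by (simp add: measure_le_0_iff)
  then have "N \<in> null_sets M" by (simp add: null_sets_def emeasure_eq_measure)
  then show ?thesis
    by (rule AE_I') (auto simp: N_def)
qed

text \<open>An attempt is paid for only when all earlier ones were rejected, and is charged in full
  even if cut short; a geometric series remains.\<close>

lemma expected_cost_le:
  assumes mono: "\<And>N. N \<le> K \<Longrightarrow> cost N \<le> cost K"
  shows "expected_restart_cost M cost K X x \<le> ennreal (real (cost K) / (1 - \<delta>))"
proof -
  have "expected_restart_cost M cost K X x \<le> (\<integral>\<^sup>+ \<omega>. (\<Sum>t. all_rejected t \<omega> * ennreal (real (cost K))) \<partial>M)"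
    unfolding expected_restart_cost_def
    by (intro nn_integral_mono suminf_le)
      (auto simp: all_rejected_eq ennreal_of_nat_eq_real_of_nat intro!: mono attempt_length_le ennreal_leI)
  also have "\<dots> = (\<Sum>t. \<integral>\<^sup>+ \<omega>. all_rejected t \<omega> * ennreal (real (cost K)) \<partial>M)"
    unfolding all_rejected_def by (intro nn_integral_suminf) measurable
  also have "\<dots> \<le> (\<Sum>t. ennreal (\<delta> ^ t) * ennreal (real (cost K)))"
    by (intro suminf_le order_trans[OF nn_integral_all_rejected]) (auto simp: emeasure_space_1)
  also have "\<dots> = ennreal (real (cost K) / (1 - \<delta>))"
    by (rule geometric_ennreal) simp
  finally show ?thesis .
qed

abbreviation err_bound where
  "err_bound t \<equiv> lalm_process.err_bound f U P X (x t) (h t) (p t)"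

text \<open>Selecting the first accepted attempt correlates its error with acceptance. The error is
  therefore dominated by the sum over all \<open>t\<close> of the error of attempt \<open>t\<close>
  on the event that the previous attempts were rejected. That event is independent of attempt
  \<open>t\<close>, and the price is the factor \<open>1 / (1 - \<delta>)\<close>.\<close>

lemma restart_output:
  assumes bound: "out_const x0 / (1 - \<delta>) \<le> \<epsilon>\<^sup>2 * real (K - 1)"
  shows "stochastic_eps_KKT M f c \<epsilon>
    (\<lambda>\<omega>. x (first_accepted K X x \<omega>) (Suc (khat \<omega>)) \<omega>) (\<lambda>\<omega>. l (first_accepted K X x \<omega>) (Suc (khat \<omega>)) \<omega>)"
proof -
  define \<A> where "\<A> = sigma_sets (space M) (\<Union>t. sets (H t K))"
  have khat: "uniform_index M K \<A> khat"
    using restart by (simp add: restart_process_def \<A>_def)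
  note kh = uniform_indexD[OF khat K]
  note [measurable] = kh(1)
  have K1: "0 < real (K - 1)" using K by simp
  \<comment> \<open>The index is independent of all attempts jointly, so its events must be factored
    off over one sigma-algebra that contains every \<open>H t K\<close>.\<close>
  define H\<A> where "H\<A> = sigma (space M) (\<Union>t. sets (H t K))"
  have HsubP: "(\<Union>t. sets (H t K)) \<subseteq> events"
    using H_subalgebra[of K] by (auto simp: subalgebra_def)
  then have HsubPow: "(\<Union>t. sets (H t K)) \<subseteq> Pow (space M)"
    using sets.space_closed by blast
  have sets_H\<A>: "sets H\<A> = \<A>" and space_H\<A>: "space H\<A> = space M"
    using HsubPow by (simp_all add: H\<A>_def \<A>_def sets_measure_of space_measure_of)
  have subM: "subalgebra M H\<A>"
    using HsubP by (simp add: subalgebra_def sets_H\<A> space_H\<A> \<A>_def sets.sigma_sets_subset)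
  have subH: "subalgebra H\<A> (H t K)" for t
    using H_subalgebra[of K t] by (auto simp: subalgebra_def sets_H\<A> space_H\<A> \<A>_def)
  define E where "E k = khat -` {k} \<inter> space M" for k
  have E: "E k \<in> events" for k unfolding E_def using kh(1) by measurable
  define T where "T = first_accepted K X x"
  have T [measurable]: "T \<in> M \<rightarrow>\<^sub>M count_space UNIV"
    unfolding T_def first_accepted_def[abs_def] by measurable
  define X' where "X' t \<omega> = (\<Sum>k\<in>{1..<K}. if khat \<omega> = k then x t (Suc k) \<omega> else 0)" for t \<omega>
  define L' where "L' t \<omega> = (\<Sum>k\<in>{1..<K}. if khat \<omega> = k then l t (Suc k) \<omega> else 0)" for t \<omega>
  define Y where "Y t k \<omega> = all_rejected t \<omega> * ennreal (err_bound t k \<omega>)" for t k \<omega>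
  define W where "W \<omega> = (\<Sum>t. \<Sum>k\<in>{1..<K}. indicator (E k) \<omega> * Y t k \<omega>)" for \<omega>
  have meas: "x t (Suc k) \<in> borel_measurable M" "l t (Suc k) \<in> borel_measurable M" if "k \<in> {1..<K}" for t k
    using that lalm_process.x_measurable[OF attempt, of "Suc k" K t] lalm_process.l_measurable[OF attempt, of
        "Suc k" K t]
      measurable_from_subalg[OF H_subalgebra[of K t]] by auto
  have X'm: "X' t \<in> borel_measurable M" "L' t \<in> borel_measurable M" for t
    unfolding X'_def[abs_def] L'_def[abs_def]
    by (intro borel_measurable_sum measurable_If meas; measurable)+
  have XT: "(\<lambda>\<omega>. X' (T \<omega>) \<omega>) \<in> borel_measurable M" "(\<lambda>\<omega>. L' (T \<omega>) \<omega>) \<in> borel_measurable M"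
    by (rule measurable_compose_countable[OF X'm(1) T], rule measurable_compose_countable[OF X'm(2) T])
  have err: "(\<lambda>\<omega>. ennreal (err_bound t k \<omega>)) \<in> borel_measurable (H t K)" if "k \<in> {1..<K}" for t k
    using lalm_process.err_bound_measurable[OF attempt, of k t] that by simp
  have all_rej: "all_rejected t \<in> borel_measurable H\<A>" for t
    unfolding all_rejected_def[abs_def]
    using rejected_sets subH by (intro borel_measurable_prod_ennreal borel_measurable_indicator)
        (auto simp: subalgebra_def)
  have Ym: "Y t k \<in> borel_measurable H\<A>" if "k \<in> {1..<K}" for t k
    unfolding Y_def[abs_def] by (intro borel_measurable_times_ennreal all_rej measurable_from_subalg[OF subH
        err[OF that]])
  have EY: "(\<lambda>\<omega>. indicator (E k) \<omega> * Y t k \<omega>) \<in> borel_measurable M" if "k \<in> {1..<K}" for t k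
    using E measurable_from_subalg[OF subM Ym[OF that]] by (intro borel_measurable_times_ennreal
        borel_measurable_indicator) auto
  have sel: "AE \<omega> in M. \<omega> \<in> space M \<and> khat \<omega> \<in> {1..<K} \<and> X' (T \<omega>) \<omega> = x (T \<omega>) (Suc (khat \<omega>)) \<omega> \<and> L' (T \<omega>) \<omega> = l
      (T \<omega>) (Suc (khat \<omega>)) \<omega>"
    using kh(2) AE_space
    by eventually_elim (simp add: X'_def L'_def)
  have outs: "AE \<omega> in M. \<forall>t. x t 0 \<omega> = x0 \<and> (\<forall>k\<in>{1..<K}. lalm_process.active X (x t) k \<omega> \<longrightarrow> x t (Suc k) \<omega> \<in> U \<and>
     (norm (kkt_residual (x t (Suc k) \<omega>) (l t (Suc k) \<omega>)))\<^sup>2 \<le> err_bound t k \<omega> \<and>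
     (norm (c (x t (Suc k) \<omega>)))\<^sup>2 \<le> err_bound t k \<omega>)"
    unfolding AE_all_countable
    using lalm_process.AE_output[OF attempt] lalm_process.AE_init[OF attempt] by auto
  have le: "AE \<omega> in M. X' (T \<omega>) \<omega> \<in> U \<and>
      ennreal ((norm (kkt_residual (X' (T \<omega>) \<omega>) (L' (T \<omega>) \<omega>)))\<^sup>2) \<le> W \<omega> \<and> ennreal ((norm (c (X' (T \<omega>) \<omega>)))\<^sup>2) \<le> W \<omega>"
    using sel outs AE_accepted
  proof eventually_elim
    case (elim \<omega>)
    \<comment> \<open>Acceptance enters here: it makes the selected attempt active up to the output
      index, where the pathwise bounds apply.\<close>
    have accT: "acc (T \<omega>) \<omega>"
      unfolding T_def first_accepted_def using elim(3) by (rule LeastI_ex)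
    have "\<not> acc j \<omega>" if "j < T \<omega>" for j
      using that not_less_Least unfolding T_def first_accepted_def by blast
    then have rej: "all_rejected (T \<omega>) \<omega> = 1"
      using elim by (simp add: all_rejected_eq)
    have act: "lalm_process.active X (x (T \<omega>)) (khat \<omega>) \<omega>"
      unfolding lalm_process.active_def[OF attempt]
    proof (intro allI impI)
      fix j assume "j \<le> khat \<omega>"
      then show "x (T \<omega>) j \<omega> \<in> X"
        using accT elim X(2) by (cases "j = 0") (auto simp: accepted_iff)
    qed
    have "ennreal (err_bound (T \<omega>) (khat \<omega>) \<omega>) = indicator (E (khat \<omega>)) \<omega> * Y (T \<omega>) (khat \<omega>) \<omega>"
      using elim rej by (simp add: E_def Y_def)
    also have "\<dots> \<le> (\<Sum>k\<in>{1..<K}. indicator (E k) \<omega> * Y (T \<omega>) k \<omega>)"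
      using elim by (intro member_le_sum) auto
    also have "\<dots> = (\<Sum>t\<in>{T \<omega>}. \<Sum>k\<in>{1..<K}. indicator (E k) \<omega> * Y t k \<omega>)" by simp
    also have "\<dots> \<le> W \<omega>"
      unfolding W_def by (intro sum_le_suminf) auto
    finally have "ennreal (err_bound (T \<omega>) (khat \<omega>) \<omega>) \<le> W \<omega>" .
    moreover have "x (T \<omega>) (Suc (khat \<omega>)) \<omega> \<in> U \<and>
     (norm (kkt_residual (x (T \<omega>) (Suc (khat \<omega>)) \<omega>) (l (T \<omega>) (Suc (khat \<omega>)) \<omega>)))\<^sup>2
        \<le> err_bound (T \<omega>) (khat \<omega>) \<omega> \<and>
     (norm (c (x (T \<omega>) (Suc (khat \<omega>)) \<omega>)))\<^sup>2 \<le> err_bound (T \<omega>) (khat \<omega>) \<omega>"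
      using elim(1,2) act by blast
    ultimately show ?case
      using elim(1) by (metis ennreal_leI order_trans)
  qed
  have "(\<integral>\<^sup>+ \<omega>. W \<omega> \<partial>M) = (\<Sum>t. \<integral>\<^sup>+ \<omega>. (\<Sum>k\<in>{1..<K}. indicator (E k) \<omega> * Y t k \<omega>) \<partial>M)"
    unfolding W_def by (rule nn_integral_suminf, rule borel_measurable_sum, rule EY)
  also have "\<dots> = (\<Sum>t. \<Sum>k\<in>{1..<K}. \<integral>\<^sup>+ \<omega>. indicator (E k) \<omega> * Y t k \<omega> \<partial>M)"
    by (intro suminf_cong nn_integral_sum EY)
  also have "\<dots> \<le> (\<Sum>t. ennreal (\<delta> ^ t) * ennreal (max 0 (out_const x0) / real (K - 1)))"
  proof (intro suminf_le)
    fix t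
    have "(\<Sum>k\<in>{1..<K}. \<integral>\<^sup>+ \<omega>. indicator (E k) \<omega> * Y t k \<omega> \<partial>M)
        \<le> (\<Sum>k\<in>{1..<K}. ennreal (1 / real (K - 1)) * (ennreal (\<delta> ^ t) * (\<integral>\<^sup>+ \<omega>. ennreal (err_bound t k \<omega>) \<partial>M)))"
    proof (intro sum_mono)
      fix k assume k: "k \<in> {1..<K}"
      have "(\<integral>\<^sup>+ \<omega>. indicator (E k) \<omega> * Y t k \<omega> \<partial>M) = ennreal (1 / real (K - 1)) * (\<integral>\<^sup>+ \<omega>. Y t k \<omega> \<partial>M)"
        using nn_integral_indep_event[OF prob_space_axioms subM E Ym[OF k], of k t] kh(3)[OF k] kh(4)
        by (simp add: E_def sets_H\<A>)
      also have "(\<integral>\<^sup>+ \<omega>. Y t k \<omega> \<partial>M) \<le> ennreal (\<delta> ^ t) * (\<integral>\<^sup>+ \<omega>. ennreal (err_bound t k \<omega>) \<partial>M)"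
        unfolding Y_def by (rule nn_integral_all_rejected[OF err[OF k]])
      finally show "(\<integral>\<^sup>+ \<omega>. indicator (E k) \<omega> * Y t k \<omega> \<partial>M)
          \<le> ennreal (1 / real (K - 1)) * (ennreal (\<delta> ^ t) * (\<integral>\<^sup>+ \<omega>. ennreal (err_bound t k \<omega>) \<partial>M))"
        by (simp add: mult_left_mono)
    qed
    also have "\<dots> = ennreal (\<delta> ^ t) * (ennreal (1 / real (K - 1)) * (\<Sum>k\<in>{1..<K}. \<integral>\<^sup>+ \<omega>. ennreal (err_bound t k \<omega>) \<partial>M))"
      by (simp add: sum_distrib_left mult_ac)
    also have "\<dots> \<le> ennreal (\<delta> ^ t) * (ennreal (1 / real (K - 1)) * ennreal (max 0 (out_const x0)))"
      by (intro mult_left_mono order_trans[OF lalm_process.sum_err_bound[OF attempt]] ennreal_leI) auto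
    also have "ennreal (1 / real (K - 1)) * ennreal (max 0 (out_const x0)) = ennreal (max 0
        (out_const x0) / real (K - 1))"
      using K1 by (subst ennreal_mult[symmetric]) auto
    finally show "(\<Sum>k\<in>{1..<K}. \<integral>\<^sup>+ \<omega>. indicator (E k) \<omega> * Y t k \<omega> \<partial>M)
        \<le> ennreal (\<delta> ^ t) * ennreal (max 0 (out_const x0) / real (K - 1))" .
  qed auto
  also have "\<dots> = ennreal (max 0 (out_const x0) / real (K - 1) / (1 - \<delta>))"
    using K1 by (intro geometric_ennreal) auto
  also have "\<dots> \<le> ennreal (\<epsilon>\<^sup>2)"
  proof (intro ennreal_leI)
    have "max 0 (out_const x0) / (1 - \<delta>) \<le> \<epsilon>\<^sup>2 * real (K - 1)"
      using bound \<delta> K1 by (auto simp: max_def)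
    then have "max 0 (out_const x0) / (1 - \<delta>) / real (K - 1) \<le> \<epsilon>\<^sup>2"
      using K1 by (subst pos_divide_le_eq) auto
    then show "max 0 (out_const x0) / real (K - 1) / (1 - \<delta>) \<le> \<epsilon>\<^sup>2"
      by (simp only: divide_divide_eq_left mult.commute)
  qed
  finally have W: "(\<integral>\<^sup>+ \<omega>. W \<omega> \<partial>M) \<le> ennreal (\<epsilon>\<^sup>2)" .
  show ?thesis
    unfolding T_def[symmetric]
    by (rule stochastic_KKT_dominated[OF XT(1) _ XT(2) _ _ _ W]) (use sel le in \<open>auto elim: eventually_mono\<close>)
qed

end



theorem corollary4p2:
  fixes f :: "real^'n \<Rightarrow> real" and c :: "real^'n \<Rightarrow> real^'m"
    and U :: "(real^'n) set" and P :: lalm_params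
    and x0 :: "real^'n" and l0 :: "real^'m"
  assumes reg: "regularity f c U P"
    and pos: "0 < beta P" "0 < rho P" "0 < Delta P" "0 < Lam P"
    and ineqs: "corrected_inequalities P"
    and init: "norm l0 \<le> Lam P" "rho P * norm (c x0) \<le> Lam P"
  shows
    "(nbhd (chi_cor P * Delta P) (S_det f c x0 P) \<subseteq> U \<longrightarrow>
       (\<forall>x l p. det_run f c P x0 l0 x l p \<longrightarrow>
         (\<exists>C>0. \<forall>\<epsilon>. 0 < \<epsilon> \<and> \<epsilon> \<le> 1 \<longrightarrow>
            (\<exists>N. eps_KKT f c \<epsilon> (x N) (l N) \<and>
                 real N \<le> C / \<epsilon>^2 \<and>
                 real (first_order_oracle_count N) \<le> C / \<epsilon>^2 \<and>
                 real (operation_count Primal_Solve N) \<le> C / \<epsilon>^2 \<and>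
                 real (operation_count Correction_Solve N) \<le> C / \<epsilon>^2))))
     \<and>
     (\<forall>(F :: real^'n \<Rightarrow> 'xi \<Rightarrow> real) D \<sigma>f Ls. oracle_assumption f F D U \<sigma>f Ls \<longrightarrow>
       (\<exists>C>0.
          (\<forall>K \<epsilon>. 2 \<le> K \<and> 0 < \<epsilon> \<and> C / \<epsilon>^2 \<le> real (K - 1) \<longrightarrow>
             (\<forall>(M :: 'w measure) H \<xi> x l h p khat.
                spider_process M D F c P (Q_of K) K (b_of P Ls K) x0 l0 UNIV K H \<xi> x l h p \<and>
                (AE \<omega> in M. in_region U K (\<lambda>k. x k \<omega>) (\<lambda>k. p k \<omega>)) \<and>
                uniform_index M K (sets (H K)) khat \<longrightarrow>
                stochastic_eps_KKT M f c \<epsilon>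
                  (\<lambda>\<omega>. x (Suc (khat \<omega>)) \<omega>) (\<lambda>\<omega>. l (Suc (khat \<omega>)) \<omega>))) \<and>
          (\<forall>a\<ge>C + 2. \<exists>C'. \<forall>\<epsilon>. 0 < \<epsilon> \<and> \<epsilon> \<le> 1 \<longrightarrow>
             (\<exists>K. horizon_of_order C a \<epsilon> K) \<and>
             (\<forall>K. horizon_of_order C a \<epsilon> K \<longrightarrow>
                real (spider_cost (Q_of K) K (b_of P Ls K) K) \<le> C' / \<epsilon>^3 \<and>
                (\<forall>op. real (operation_count op K) \<le> C' / \<epsilon>^2)))) \<and>
       (\<forall>\<delta> X. 0 < \<delta> \<and> \<delta> < 1 \<and> X \<in> sets borel \<and> x0 \<in> X \<and> S_st f c x0 P \<sigma>f \<delta> \<subseteq> X \<and>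
          nbhd (chi_cor P * Delta P) X \<subseteq> U \<longrightarrow>
          (\<exists>C>0.
             (\<forall>K \<epsilon>. 2 \<le> K \<and> 0 < \<epsilon> \<and> C / \<epsilon>^2 \<le> real (K - 1) \<longrightarrow>
                (\<forall>(M :: 'w measure) H \<xi> x l h p khat.
                   restart_process M D F c P (Q_of K) K (b_of P Ls K) x0 l0 X K H \<xi> x l h p khat \<longrightarrow>
                   (AE \<omega> in M. \<exists>t. accepted K X (\<lambda>k. x t k \<omega>)) \<and>
                   stochastic_eps_KKT M f c \<epsilon>
                     (\<lambda>\<omega>. x (first_accepted K X x \<omega>) (Suc (khat \<omega>)) \<omega>)
                     (\<lambda>\<omega>. l (first_accepted K X x \<omega>) (Suc (khat \<omega>)) \<omega>))) \<and>
             (\<forall>a\<ge>C + 2. \<exists>C'. \<forall>\<epsilon>. 0 < \<epsilon> \<and> \<epsilon> \<le> 1 \<longrightarrow>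
                (\<exists>K. horizon_of_order C a \<epsilon> K) \<and>
                (\<forall>K. horizon_of_order C a \<epsilon> K \<longrightarrow>
                   (\<forall>(M :: 'w measure) H \<xi> x l h p khat.
                      restart_process M D F c P (Q_of K) K (b_of P Ls K) x0 l0 X K H \<xi> x l h p khat \<longrightarrow>
                      expected_restart_cost M (spider_cost (Q_of K) K (b_of P Ls K)) K X x
                        \<le> ennreal (C' / \<epsilon>^3) \<and>
                      (\<forall>op. expected_restart_cost M (operation_count op) K X x
                        \<le> ennreal (C' / \<epsilon>^2))))))))
     \<and>
     (nbhd (chi_cor P * Delta P) (S_det f c x0 P) \<subseteq> U \<and> compact (S_det f c x0 P) \<longrightarrow>
       (\<forall>x l p. det_run f c P x0 l0 x l p \<and>
          (\<forall>zb \<in> cluster_set (\<lambda>k. (x (Suc k), l (Suc k), p k)).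
             KL_property (U \<times> UNIV \<times> UNIV) (lyapunov f c P) zb) \<longrightarrow>
          summable (\<lambda>k. norm (x (Suc k) - x k) + norm (l (Suc k) - l k)) \<and>
          (\<exists>xs ls. x \<longlonglongrightarrow> xs \<and> l \<longlonglongrightarrow> ls \<and> KKT f c xs ls)))"
proof -
  interpret lalm f c U P
    using reg pos ineqs by unfold_locales
  show ?thesis
  proof (intro conjI allI impI, goal_cases)
    case (1 x l p)
    then show ?case using det_complexity init by blast
  next
    case (2 F D \<sigma>f Ls)
    then interpret lalm_oracle f c U P F D \<sigma>f Ls by unfold_locales
    define C where "C = max 1 (out_const x0)"
    have C0: "0 < C" by (simp add: C_def)
    show ?case
    proof (rule exI[of _ C], intro conjI allI impI C0, goal_cases)
      case (1 K \<epsilon> M H \<xi> x l h p khat)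
      then have K2: "2 \<le> K"
        and proc: "spider_process M D F c P (Q_of K) K (b_of P Ls K) x0 l0 UNIV K H \<xi> x l h p"
        and region: "AE \<omega> in M. in_region U K (\<lambda>k. x k \<omega>) (\<lambda>k. p k \<omega>)"
        and khat: "uniform_index M K (sets (H K)) khat" by auto
      interpret prob_space M using proc by (simp add: spider_process_def)
      \<comment> \<open>The method without safeguard is the process with \<open>X = UNIV\<close>,
        for which every index is active.\<close>
      interpret lalm_process f c U P F D \<sigma>f Ls M x0 l0 UNIV K H \<xi> x l h p
      proof
        have "AE \<omega> in M. spider_run F c P (Q_of K) K (b_of P Ls K) x0 l0 UNIV K (\<lambda>k i. \<xi> k i \<omega>)
              (\<lambda>k. x k \<omega>) (\<lambda>k. l k \<omega>) (\<lambda>k. h k \<omega>) (\<lambda>k. p k \<omega>)"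
          using proc by (simp add: spider_process_def)
        with region show "AE \<omega> in M. \<forall>k<K. (\<forall>j\<le>k. x j \<omega> \<in> UNIV) \<longrightarrow>
            good_step (closest_point (cball 0 (G P)) (h k \<omega>)) (x k \<omega>) (l k \<omega>) (p k \<omega>) (x (Suc k) \<omega>) (l (Suc k) \<omega>)"
        proof eventually_elim
          case (elim \<omega>)
          then show ?case
            using spider_run_good[OF elim(2) init] unfolding in_region_def by blast
        qed
      qed (use K2 proc in auto)
      have "C \<le> \<epsilon>\<^sup>2 * real (K - 1)"
        using 1(1) by (intro le_square_mult) auto
      then have "out_const x0 \<le> \<epsilon>\<^sup>2 * real (K - 1)"
        unfolding C_def by (rule order_trans[OF max.cobounded2])
      moreover have "AE \<omega> in M. \<forall>k<K. active k \<omega>"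
        by (simp only: active_def UNIV_I simp_thms AE_const)
      ultimately show ?case
        using single_run_output[OF khat] by blast
    next
      case (2 a)
      then have "0 \<le> a" using C0 by simp
      from run_costs[OF this] obtain C' where "0 \<le> C'"
        "\<forall>\<epsilon> K. 0 < \<epsilon> \<and> horizon_of_order C a \<epsilon> K \<longrightarrow>
           real (spider_cost (Q_of K) K (b_of P Ls K) K) \<le> C' / \<epsilon>^3 \<and> (\<forall>op. real (operation_count op K) \<le> C' / \<epsilon>^2)"
        by blast
      then show ?case
        using horizon_exists[OF C0 2] by blast
    qed
  next
    case (3 F D \<sigma>f Ls \<delta> X)
    then interpret lalm_oracle f c U P F D \<sigma>f Ls by unfold_locales
    define C where "C = max 1 (out_const x0 / (1 - \<delta>))"
    have C0: "0 < C" by (simp add: C_def)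
    have \<delta>: "0 < 1 - \<delta>" using 3 by simp
    have restart: "lalm_restart f c U P F D \<sigma>f Ls M x0 l0 X K \<delta> H \<xi> x l h p khat"
      if "2 \<le> K" "restart_process M D F c P (Q_of K) K (b_of P Ls K) x0 l0 X K H \<xi> x l h p khat"
      for M :: "'w measure" and K H \<xi> x l h p khat
    proof -
      interpret prob_space M using that by (simp add: restart_process_def)
      show ?thesis by unfold_locales (use that 3 init in auto)
    qed
    show ?case
    proof (rule exI[of _ C], intro conjI allI impI C0, goal_cases)
      case (1 K \<epsilon> M H \<xi> x l h p khat)
      then show ?case
        using lalm_restart.AE_accepted[OF restart] by blast
    next
      case (2 K \<epsilon> M H \<xi> x l h p khat)
      have "C \<le> \<epsilon>\<^sup>2 * real (K - 1)" using 2(1) by (intro le_square_mult) auto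
      then have "out_const x0 / (1 - \<delta>) \<le> \<epsilon>\<^sup>2 * real (K - 1)"
        unfolding C_def by (rule order_trans[OF max.cobounded2])
      then show ?case
        using lalm_restart.restart_output[OF restart[OF _ 2(2)]] 2(1) by blast
    next
      case (3 a)
      then have "0 \<le> a" using C0 by simp
      from run_costs[OF this] obtain C' where C': "0 \<le> C'"
        "\<And>\<epsilon> K. 0 < \<epsilon> \<and> horizon_of_order C a \<epsilon> K \<Longrightarrow>
           real (spider_cost (Q_of K) K (b_of P Ls K) K) \<le> C' / \<epsilon>^3 \<and> (\<forall>op. real (operation_count op K) \<le> C' / \<epsilon>^2)"
        by blast
      \<comment> \<open>The denominator \<open>e\<close> stands for the cube or the square of
        \<open>\<epsilon>\<close>, so sample and operation counts share one argument.\<close>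
      have le: "expected_restart_cost M cost K X x \<le> ennreal (C' / (1 - \<delta>) / e)"
        if "2 \<le> K" and rp: "restart_process M D F c P (Q_of K) K (b_of P Ls K) x0 l0 X K H \<xi> x l h p khat"
          and mono: "\<And>N. N \<le> K \<Longrightarrow> cost N \<le> cost K" and cost: "real (cost K) \<le> C' / e"
        for M :: "'w measure" and K H \<xi> x l h p khat cost e
      proof -
        have "real (cost K) / (1 - \<delta>) \<le> C' / e / (1 - \<delta>)"
          using cost \<delta> by (intro divide_right_mono) auto
        also have "\<dots> = C' / (1 - \<delta>) / e" by simp
        finally show ?thesis
          using lalm_restart.expected_cost_le[OF restart[OF that(1) rp], of cost] mono by
              (meson ennreal_leI order_trans)
      qed
      show ?case
      proof (rule exI[of _ "C' / (1 - \<delta>)"], intro allI impI conjI, goal_cases)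
        case (1 \<epsilon>)
        then show ?case using horizon_exists[OF C0 3] by blast
      next
        case (2 \<epsilon> K M H \<xi> x l h p khat)
        show ?case
        proof (rule le[OF _ 2(3)])
          show "spider_cost (Q_of K) K (b_of P Ls K) N \<le> spider_cost (Q_of K) K (b_of P Ls K) K" if "N \<le> K" for N
            unfolding spider_cost_def using that by (intro sum_mono2) auto
        qed (use C'(2) 2 in \<open>auto simp: horizon_of_order_def\<close>)
      next
        case (3 \<epsilon> K M H \<xi> x l h p khat op)
        show ?case
          by (rule le[OF _ 3(3)]) (use C'(2) 3 in \<open>auto simp: horizon_of_order_def operation_count_def\<close>)
      qed
    qed
  next
    case (4 x l p)
    then have "det_init x0 l0" "compact (S_det f c x0 P)" using init by auto
    from det_finite_length[OF conjunct1[OF 4(2)] this bspec[OF conjunct2[OF 4(2)]]]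
    show ?case by blast
  next
    case (5 x l p)
    then have "det_init x0 l0" "compact (S_det f c x0 P)" using init by auto
    from det_finite_length[OF conjunct1[OF 5(2)] this bspec[OF conjunct2[OF 5(2)]]]
    show ?case by blast
  qed
qed

end
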